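(* (1) The set of values of the sprawl over convex, centrally symmetric hexagons in the plane (with degenerate hexagons, i.e. parallelograms, included) is $$\{E(H): H \text{ a hexagon}\}=\left[\frac{23}{18},\frac43\right].$$ (2) Consequently, for every finite symmetric generating set $S=-S$ of $\mathbb{Z}^2$ with $|S|\le 6$, one has $\frac{23}{18}\le E(\mathbb{Z}^2,S)\le\frac43$.
   Context: A perimeter in $\mathbb{R}^d$ is the boundary $L$ of a centrally symmetric (under $x\mapsto -x$) convex body $Q$ (compact convex set with nonempty interior). The Minkowski norm $\|\cdot\|_L$ is the norm on $\mathbb{R}^d$ with unit ball $Q$. The cone measure $\mu_L$ is the Borel probability measure on $L$ given by $\mu_L(A)=\mathrm{Vol}(\{ta: a\in A,\,0\le t\le 1\})/\mathrm{Vol}(Q)$. The sprawl of $L$ is $$E(L):=\int_{L\times L}\|x-y\|_L\,d\mu_L(x)\,d\mu_L(y).$$ A hexagon here means a perimeter in $\mathbb{R}^2$ that is the boundary of the convex hull of $\{\pm v_1,\pm v_2,\pm v_3\}$; it is degenerate if it is a parallelogram. For a finite symmetric generating set $S$ of $\mathbb{Z}^d$, with word metric $d$ and $S_n$ the sphere of radius $n$ about the identity, $E(\mathbb{Z}^d,S):=\lim_{n\to\infty}\frac{1}{|S_n|^2}\sum_{x,y\in S_n}\frac1n d(x,y)$ (this limit always exists). *)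

theory Defs
  imports "HOL-Analysis.Analysis"
begin

definition symmetric_convex_body :: "'a::euclidean_space set \<Rightarrow> bool" where
  "symmetric_convex_body Q \<longleftrightarrow>
     compact Q \<and> convex Q \<and> interior Q \<noteq> {} \<and> (\<forall>x\<in>Q. - x \<in> Q)"

definition perimeter :: "'a::euclidean_space set \<Rightarrow> bool" where
  "perimeter L \<longleftrightarrow> (\<exists>Q. symmetric_convex_body Q \<and> L = frontier Q)"

(* A perimeter determines the body it bounds, see body_of_frontier below; this lets the
   norm, the cone measure and the sprawl be functions of the perimeter itself. *)
definition body_of :: "'a::euclidean_space set \<Rightarrow> 'a set" where
  "body_of L = convex hull L"

lemma body_of_frontier:
  assumes "symmetric_convex_body Q"
  shows "body_of (frontier Q) = Q"
  using assms Krein_Milman_frontier[of Q]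
  by (simp add: body_of_def symmetric_convex_body_def)

definition minkowski_norm :: "'a::euclidean_space set \<Rightarrow> 'a \<Rightarrow> real" where
  "minkowski_norm L x = Inf {t. 0 \<le> t \<and> x \<in> (\<lambda>y. t *\<^sub>R y) ` body_of L}"

lemma minkowski_norm_le_one_iff:
  assumes Q: "symmetric_convex_body Q"
  shows "minkowski_norm (frontier Q) x \<le> 1 \<longleftrightarrow> x \<in> Q"
proof -
  have cv: "convex Q" and cl: "closed Q" and bd: "bounded Q"
    and int: "interior Q \<noteq> {}" and sy: "\<And>x. x \<in> Q \<Longrightarrow> - x \<in> Q"
    using Q by (auto simp: symmetric_convex_body_def compact_eq_bounded_closed)
  obtain a where a: "a \<in> interior Q" using int by blast
  have aQ: "a \<in> Q" using a interior_subset by blast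
  have "0 \<in> interior Q"
  proof -
    have "- a - (1/2) *\<^sub>R (- a - a) \<in> interior Q"
      by (rule mem_interior_convex_shrink[OF cv a sy[OF aQ]]) auto
    moreover have "- a - (1/2) *\<^sub>R (- a - a) = 0"
    proof -
      have "- a - a = (- 2) *\<^sub>R a" using scaleR_2[of a] by simp
      then show ?thesis by simp
    qed
    ultimately show ?thesis by simp
  qed
  then obtain e where e: "e > 0" "cball 0 e \<subseteq> Q"
    by (meson mem_interior_cball)
  have Q0: "0 \<in> Q" using e by auto
  define T where "T = {t. 0 \<le> t \<and> x \<in> (\<lambda>y. t *\<^sub>R y) ` Q}"
  have N: "minkowski_norm (frontier Q) x = Inf T"
    by (simp add: minkowski_norm_def T_def body_of_frontier[OF Q])
  have bb: "bdd_below T" by (rule bdd_belowI[of _ 0]) (auto simp: T_def)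
  have "norm x / e \<in> T"
  proof (cases "x = 0")
    case True then show ?thesis using Q0 by (auto simp: T_def)
  next
    case False
    have "(e / norm x) *\<^sub>R x \<in> Q" using e False by (intro subsetD[OF e(2)]) auto
    moreover have "x = (norm x / e) *\<^sub>R ((e / norm x) *\<^sub>R x)" using e False by simp
    ultimately have "x \<in> (\<lambda>y. (norm x / e) *\<^sub>R y) ` Q" by (rule rev_image_eqI)
    then show ?thesis using e by (simp add: T_def)
  qed
  then have ne: "T \<noteq> {}" by blast
  show ?thesis
  proof
    assume "x \<in> Q"
    then have "1 \<in> T" by (auto simp: T_def)
    then show "minkowski_norm (frontier Q) x \<le> 1" using N bb by (simp add: cInf_lower)
  next
    assume le: "minkowski_norm (frontier Q) x \<le> 1"
    have s: "(1 / s) *\<^sub>R x \<in> Q" if "s > 1" for s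
    proof -
      have "Inf T < s" using le N that by simp
      then obtain t where t: "t \<in> T" "t < s" using cInf_lessD[OF ne] by blast
      then obtain y where y: "y \<in> Q" "x = t *\<^sub>R y" "0 \<le> t" by (auto simp: T_def)
      have "(1 - t / s) *\<^sub>R 0 + (t / s) *\<^sub>R y \<in> Q"
        using that t(2) y(3) by (intro convexD[OF cv Q0 y(1)]) auto
      then show ?thesis by (simp add: y(2))
    qed
    have "(\<lambda>n. (1 / (1 + 1 / real (Suc n))) *\<^sub>R x) \<longlonglongrightarrow> (1 / (1 + 0)) *\<^sub>R x"
      by (intro tendsto_scaleR tendsto_divide tendsto_add tendsto_const
          LIMSEQ_Suc[OF lim_1_over_n]) simp
    moreover have "\<And>n. (1 / (1 + 1 / real (Suc n))) *\<^sub>R x \<in> Q"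
      by (rule s) simp
    ultimately have "(1 / (1 + 0)) *\<^sub>R x \<in> Q"
      by (rule closed_sequentially[OF cl, rotated])
    then show "x \<in> Q" by simp
  qed
qed

definition cone_over :: "'a::euclidean_space set \<Rightarrow> 'a set" where
  "cone_over A = {t *\<^sub>R a | t a. a \<in> A \<and> 0 \<le> t \<and> t \<le> 1}"

definition cone_measure :: "'a::euclidean_space set \<Rightarrow> 'a measure" where
  "cone_measure L =
     measure_of L (sets (restrict_space borel L))
       (\<lambda>A. emeasure lborel (cone_over A) / emeasure lborel (body_of L))"

definition sprawl :: "'a::euclidean_space set \<Rightarrow> real" where
  "sprawl L =
     (LINT z|(cone_measure L \<Otimes>\<^sub>M cone_measure L). minkowski_norm L (fst z - snd z))"

(* Requiring the hull to be a body excludes the case where all v_i lie on one line;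
   parallelograms are included. *)
definition hexagon :: "(real^2) set \<Rightarrow> bool" where
  "hexagon H \<longleftrightarrow>
     (\<exists>v1 v2 v3. symmetric_convex_body (convex hull {v1, - v1, v2, - v2, v3, - v3}) \<and>
        H = frontier (convex hull {v1, - v1, v2, - v2, v3, - v3}))"

lemma hexagon_imp_perimeter: "hexagon H \<Longrightarrow> perimeter H"
  by (auto simp: hexagon_def perimeter_def)

definition symmetric_set :: "'g::ab_group_add set \<Rightarrow> bool" where
  "symmetric_set S \<longleftrightarrow> uminus ` S = S"

(* Words use the letters of S only, without inverses: everything below is meant for
   symmetric S. *)
definition generating_set :: "'g::ab_group_add set \<Rightarrow> bool" where
  "generating_set S \<longleftrightarrow> (\<forall>g. \<exists>w\<in>lists S. sum_list w = g)"

definition word_length :: "'g::ab_group_add set \<Rightarrow> 'g \<Rightarrow> nat" where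
  "word_length S g = (LEAST n. \<exists>w\<in>lists S. length w = n \<and> sum_list w = g)"

definition word_dist :: "'g::ab_group_add set \<Rightarrow> 'g \<Rightarrow> 'g \<Rightarrow> nat" where
  "word_dist S x y = word_length S (y - x)"

definition word_sphere :: "'g::ab_group_add set \<Rightarrow> nat \<Rightarrow> 'g set" where
  "word_sphere S n = {g. word_dist S 0 g = n}"

definition sphere_average :: "'g::ab_group_add set \<Rightarrow> nat \<Rightarrow> real" where
  "sphere_average S n =
     1 / (real (card (word_sphere S n)))\<^sup>2 *
     (\<Sum>x\<in>word_sphere S n. \<Sum>y\<in>word_sphere S n. 1 / real n * real (word_dist S x y))"

definition group_sprawl :: "'g::ab_group_add set \<Rightarrow> real" where
  "group_sprawl S = lim (sphere_average S)"

end

theory Submission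
  imports Defs
begin

text \<open>Up to a linear map, a hexagon has vertices \<open>\<pm>p\<close>, \<open>\<pm>w\<close>, \<open>\<pm>q\<close> with
  \<open>w = b p + a q\<close> and \<open>0 < a \<le> b \<le> 1 \<le> a + b\<close>: take for \<open>p\<close>, \<open>q\<close> the two vertices spanning the
  largest area. A parallelogram is the case \<open>a = b = 1/2\<close>, with the midpoint of a side as a third
  vertex. The cone measure is uniform on each side, and the sides have masses proportional to \<open>a\<close>,
  \<open>b\<close>, \<open>1\<close>. On a pair of sides the norms of \<open>x \<plusminus> y\<close> are piecewise linear in the two parameters, so
  the sprawl is an explicit rational function of \<open>a\<close> and \<open>b\<close>. In the nonnegative quantities
  \<open>b - a\<close>, \<open>1 - b\<close>, \<open>a + b - 1\<close>, its distances to \<open>4/3\<close> and to \<open>23/18\<close> have numerators with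
  nonnegative coefficients. The diagonal \<open>a = b\<close> joins the parallelogram to the affine regular
  hexagon \<open>a = b = 1\<close>, and there the two bounds are attained.

  For a generating set \<open>S\<close> of \<open>\<int>\<^sup>2\<close> the word length differs from the norm of the hull of \<open>S\<close> by a
  bounded amount. In a sector spanned by two neighbouring corners, the sphere of radius \<open>n\<close> consists,
  up to boundedly many points, of one arithmetic progression parallel to the side for each coset of
  the lattice spanned by the corners. The number of cosets is proportional to the area of the
  sector, so spheres equidistribute to the cone measure and the sphere averages converge to the
  sprawl of the hull.\<close>

section \<open>Averages over segments\<close>

text \<open>The hexagon itself is never moved: the normalisation consists in using coordinates with
  respect to \<open>p\<close> and \<open>q\<close>. Maximality of the area bounds both coordinates
  of the third vertex by 1; signs and order of \<open>p\<close>, \<open>q\<close> are then chosen to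
  give \<open>0 \<le> a \<le> b\<close>. If \<open>a + b \<le> 1\<close>, the third pair of points
  lies in the parallelogram of the other two and disappears from the hull. Central symmetry folds
  the thirty-six ordered pairs of sides into six averages; this is why \<open>N (x - y)\<close> and
  \<open>N (x + y)\<close> always occur together. The polynomial bounds work because 1 = (b - a) + 2
  (1 - b) + (a + b - 1), which turns the inhomogeneous numerators into quartic forms in these three
  quantities. For groups, the obstacle is the degenerate case. The parallelogram has the midpoint of
  a side as its third vertex, and this midpoint need not be a lattice point. Lattice points are
  therefore counted in an abstract system of sectors, used with six sectors or with four. The result
  is compared with the hexagon integral only up to a common factor, which cancels in the
  average.\<close>

definition cr :: "'a::comm_ring^2 \<Rightarrow> 'a^2 \<Rightarrow> 'a" where
  "cr u v = u$1 * v$2 - u$2 * v$1"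

definition seg_avg :: "real^2 \<Rightarrow> real^2 \<Rightarrow> (real^2 \<Rightarrow> real) \<Rightarrow> real" where
  "seg_avg u v h = integral {0..1} (\<lambda>s. h ((1 - s) *\<^sub>R u + s *\<^sub>R v))"

text \<open>Needs no integrability: reflection preserves \<open>has_integral\<close> for every
  candidate value, so both integrals agree by definition even when no value exists.\<close>

lemma integral_reverse_unit: "integral {0..1} (\<lambda>s. f (1 - s)) = integral {0..1} (f :: real \<Rightarrow> real)"
proof -
  have *: "((\<lambda>s. f (1 - s)) has_integral i) {0..1}" if "(f has_integral i) {0..1}" for f :: "real \<Rightarrow> real" and i
    using has_integral_affinity[of f i 0 1 "-1" 1] that
    by (simp add: image_affinity_atLeastAtMost_diff algebra_simps)
  have iff: "((\<lambda>s. f (1 - s)) has_integral i) {0..1} \<longleftrightarrow> (f has_integral i) {0..1}" for i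
    using *[of f i] *[of "\<lambda>s. f (1 - s)" i] by auto
  show ?thesis
    by (simp add: integral_def integrable_on_def iff)
qed

lemma seg_avg_commute: "seg_avg u v h = seg_avg v u h"
  unfolding seg_avg_def
  by (subst integral_reverse_unit[symmetric]) (simp add: add.commute)

lemma seg_avg_uminus: "seg_avg (- u) (- v) h = seg_avg u v (\<lambda>x. h (- x))"
  unfolding seg_avg_def by (simp add: algebra_simps)

lemma continuous_seg_param:
  fixes h :: "real^2 \<Rightarrow> real"
  assumes "continuous_on UNIV h"
  shows "continuous_on A (\<lambda>s. h ((1 - s) *\<^sub>R u + s *\<^sub>R v))"
  by (intro continuous_on_compose2[OF assms] continuous_intros) auto

lemma seg_integrable:
  fixes h :: "real^2 \<Rightarrow> real"
  assumes "continuous_on UNIV h"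
  shows "(\<lambda>s. h ((1 - s) *\<^sub>R u + s *\<^sub>R v)) integrable_on {0..1::real}"
  by (rule integrable_continuous_interval continuous_seg_param assms)+

lemma seg_avg_add:
  assumes "continuous_on UNIV f" "continuous_on UNIV g"
  shows "seg_avg u v (\<lambda>x. f x + g x) = seg_avg u v f + seg_avg u v g"
  unfolding seg_avg_def by (intro integral_add seg_integrable assms)

lemma seg_avg_cmult: "seg_avg u v (\<lambda>x. c * f x) = c * seg_avg u v f"
  unfolding seg_avg_def by simp

lemma continuous_seg_avg:
  fixes h :: "real^2 \<Rightarrow> real^2 \<Rightarrow> real"
  assumes "continuous_on UNIV (\<lambda>(x, y). h x y)"
  shows "continuous_on UNIV (\<lambda>x. seg_avg u v (h x))"
proof -
  have "continuous_on (UNIV \<times> cbox 0 1) (\<lambda>(x, s). h x ((1 - s) *\<^sub>R u + s *\<^sub>R v))"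
    unfolding case_prod_unfold
    using continuous_on_compose2[OF assms, of "UNIV \<times> cbox 0 1" "\<lambda>z. (fst z, (1 - snd z) *\<^sub>R u + snd z *\<^sub>R v)"]
    by (simp add: case_prod_unfold continuous_intros)
  then show ?thesis
    unfolding seg_avg_def using integral_continuous_on_param[of UNIV 0 1] by fastforce
qed

lemma has_integral_pos_part:
  fixes c :: real
  assumes "0 \<le> c" "c \<le> 1"
  shows "((\<lambda>t. max 0 (c - t)) has_integral c\<^sup>2 / 2) {0..1}"
proof -
  have "((\<lambda>t. c - t) has_integral ((c * c - c\<^sup>2 / 2) - (c * 0 - 0\<^sup>2 / 2))) {0..c}"
    using assms(1)
    by (intro fundamental_theorem_of_calculus)
       (auto intro!: derivative_eq_intros simp flip: has_real_derivative_iff_has_vector_derivative)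
  then have 1: "((\<lambda>t. max 0 (c - t)) has_integral c\<^sup>2 / 2) {0..c}"
    by (subst has_integral_cong[where g = "\<lambda>t. c - t"]) (auto simp: power2_eq_square)
  have 2: "((\<lambda>t. max 0 (c - t)) has_integral 0) {c..1}"
    by (subst has_integral_cong[where g = "\<lambda>t. 0"]) auto
  show ?thesis using has_integral_combine[OF assms 1 2] by simp
qed

lemma has_integral_linear_unit: "((\<lambda>s. u + v * s) has_integral (u + v / 2)) {0..1::real}"
proof -
  have "((\<lambda>s. u + v * s) has_integral ((u * 1 + v * 1\<^sup>2 / 2) - (u * 0 + v * 0\<^sup>2 / 2))) {0..1}"
    by (intro fundamental_theorem_of_calculus)
       (auto intro!: derivative_eq_intros simp flip: has_real_derivative_iff_has_vector_derivative)
  then show ?thesis by simp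
qed

lemma has_integral_square_unit: "((\<lambda>s. v * s\<^sup>2) has_integral (v / 3)) {0..1::real}"
proof -
  have "((\<lambda>s. v * s\<^sup>2) has_integral ((v * 1^3 / 3) - (v * 0^3 / 3))) {0..1}"
    by (intro fundamental_theorem_of_calculus)
       (auto intro!: derivative_eq_intros simp flip: has_real_derivative_iff_has_vector_derivative)
  then show ?thesis by simp
qed

lemma double_integral_pos_part:
  fixes \<kappa> :: real
  assumes "0 \<le> \<kappa>" "\<kappa> \<le> 1"
  shows "((\<lambda>s. integral {0..1} (\<lambda>t. max 0 (\<kappa> * s - t))) has_integral \<kappa>\<^sup>2 / 6) {0..1}"
proof -
  have "integral {0..1} (\<lambda>t. max 0 (\<kappa> * s - t)) = \<kappa>\<^sup>2 / 2 * s\<^sup>2" if "s \<in> {0..1}" for s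
    using has_integral_pos_part[of "\<kappa> * s"] that assms
    by (simp add: integral_unique mult_le_one power_mult_distrib)
  then show ?thesis
    using has_integral_square_unit[of "\<kappa>\<^sup>2 / 2"] by (subst has_integral_cong) auto
qed

text \<open>The shape of \<open>N (x - y) + N (x + y)\<close> for \<open>x\<close>, \<open>y\<close> on two sides of a hexagon, parametrised
  from a common vertex.\<close>

definition pw_lin :: "real \<Rightarrow> real \<Rightarrow> real \<Rightarrow> real \<Rightarrow> real \<Rightarrow> real \<Rightarrow> real \<Rightarrow> real \<Rightarrow> real
    \<Rightarrow> real \<Rightarrow> real \<Rightarrow> real" where
  "pw_lin k0 k1 k2 k3 \<kappa> k4 \<rho> k5 \<nu> s t =
     k0 + k1 * s + k2 * t + k3 * max 0 (\<kappa> * s - t) + k4 * max 0 (\<rho> * s - t) + k5 * max 0 (\<nu> * t - s)"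

lemma double_integral_pw_lin:
  assumes "0 \<le> \<kappa>" "\<kappa> \<le> 1" "0 \<le> \<rho>" "\<rho> \<le> 1" "0 \<le> \<nu>" "\<nu> \<le> 1"
  shows "integral {0..1} (\<lambda>s. integral {0..1} (\<lambda>t. pw_lin k0 k1 k2 k3 \<kappa> k4 \<rho> k5 \<nu> s t))
       = k0 + k1 / 2 + k2 / 2 + k3 * \<kappa>\<^sup>2 / 6 + k4 * \<rho>\<^sup>2 / 6 + k5 * \<nu>\<^sup>2 / 6"
proof -
  let ?P = "\<lambda>\<kappa> s. integral {0..1} (\<lambda>t. max 0 (\<kappa> * s - t))"
  let ?R = "\<lambda>s. integral {0..1} (\<lambda>t. max 0 (\<nu> * t - s))"
  have inner: "integral {0..1} (\<lambda>t. pw_lin k0 k1 k2 k3 \<kappa> k4 \<rho> k5 \<nu> s t)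
      = ((k0 + k2 / 2) + k1 * s) + k3 * ?P \<kappa> s + k4 * ?P \<rho> s + k5 * ?R s" for s
  proof -
    have "((\<lambda>t. ((k0 + k1 * s) + k2 * t) + k3 * max 0 (\<kappa> * s - t) + k4 * max 0 (\<rho> * s - t)
          + k5 * max 0 (\<nu> * t - s))
       has_integral (((k0 + k1 * s) + k2 / 2) + k3 * ?P \<kappa> s + k4 * ?P \<rho> s + k5 * ?R s)) {0..1}"
      by (intro has_integral_add has_integral_linear_unit has_integral_mult_right integrable_integral
           integrable_continuous_interval continuous_intros)
    then show ?thesis by (simp add: pw_lin_def integral_unique algebra_simps)
  qed
  have cont: "continuous_on {0..1} ?R"
    using integral_continuous_on_param[of "{0..1::real}" 0 1 "\<lambda>s t. max 0 (\<nu> * t - s)"]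
    by (simp add: case_prod_unfold continuous_intros)
  \<comment> \<open>The last positive part has its kink in the other variable; exchanging the order
    of integration makes it an instance of \<open>double_integral_pos_part\<close>.\<close>
  have "integral (cbox 0 1) (\<lambda>s. integral (cbox 0 1) (\<lambda>t. max 0 (\<nu> * t - s)))
      = integral (cbox 0 1) (\<lambda>t. integral (cbox 0 1) (\<lambda>s. max 0 (\<nu> * t - s)))"
    by (rule integral_swap_continuous) (auto simp: case_prod_unfold intro!: continuous_intros)
  also have "\<dots> = \<nu>\<^sup>2 / 6"
    using double_integral_pos_part[OF assms(5,6)] by (simp add: integral_unique)
  finally have R: "(?R has_integral \<nu>\<^sup>2 / 6) {0..1}"
    using integrable_integral[OF integrable_continuous_interval[OF cont]] by (metis box_real(2))
  have "((\<lambda>s. ((k0 + k2 / 2) + k1 * s) + k3 * ?P \<kappa> s + k4 * ?P \<rho> s + k5 * ?R s)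
      has_integral (((k0 + k2 / 2) + k1 / 2) + k3 * (\<kappa>\<^sup>2 / 6) + k4 * (\<rho>\<^sup>2 / 6) + k5 * (\<nu>\<^sup>2 / 6))) {0..1}"
    by (intro has_integral_add has_integral_linear_unit has_integral_mult_right
          double_integral_pos_part assms R)
  then show ?thesis by (simp add: inner integral_unique algebra_simps)
qed

section \<open>The norm of a hexagon in adapted coordinates\<close>

lemma cr_simps:
  fixes u v :: "'a::comm_ring^2"
  shows "cr (u + x) v = cr u v + cr x v" "cr u (v + x) = cr u v + cr u x"
    "cr (u - x) v = cr u v - cr x v" "cr u (v - x) = cr u v - cr u x"
    "cr (- u) v = - cr u v" "cr u (- v) = - cr u v"
    "cr u u = 0" "cr 0 u = 0" "cr u 0 = 0"
  by (auto simp: cr_def algebra_simps)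

lemma cr_scaleR:
  fixes u v :: "real^2"
  shows "cr (c *\<^sub>R u) v = c * cr u v" "cr u (c *\<^sub>R v) = c * cr u v"
  by (auto simp: cr_def algebra_simps)

lemma cr_commute: "cr u v = - cr v (u :: 'a::comm_ring^2)"
  by (simp add: cr_def algebra_simps)

text \<open>Cramer's rule in the basis \<open>p\<close>, \<open>q\<close>.\<close>

lemma cr_expand:
  fixes p q z :: "real^2"
  assumes "cr p q \<noteq> 0"
  shows "z = (cr z q / cr p q) *\<^sub>R p + (cr p z / cr p q) *\<^sub>R q"
proof -
  have "cr p q * z$i = cr z q * p$i + cr p z * q$i" for i
    using exhaust_2[of i] by (auto simp: cr_def algebra_simps)
  then have "z$i = (cr z q * p$i + cr p z * q$i) / cr p q" for i
    using assms by (metis nonzero_mult_div_cancel_left)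
  then show ?thesis
    by (simp add: vec_eq_iff add_divide_distrib)
qed

lemma linear_cr: "linear (\<lambda>z :: real^2. cr z q / c)" "linear (\<lambda>z :: real^2. cr q z / c)"
  by (auto intro!: linearI simp: cr_simps cr_scaleR add_divide_distrib)

locale hexagon_frame =
  fixes p q :: "real^2" and a b :: real
  assumes pq: "cr p q \<noteq> 0"
    and a_pos: "0 < a" and a_le_b: "a \<le> b" and b_le_1: "b \<le> 1" and ab_ge_1: "1 \<le> a + b"
begin

definition "w = b *\<^sub>R p + a *\<^sub>R q"
definition "X z = cr z q / cr p q"
definition "Y z = cr p z / cr p q"
text \<open>The three linear functionals equal 1 on the sides from \<open>p\<close> to
  \<open>w\<close>, from \<open>w\<close> to \<open>q\<close> and from \<open>q\<close> to
  \<open>- p\<close>; the largest absolute value is the gauge of the hexagon.\<close>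

definition "N z = max \<bar>X z + (1 - b) / a * Y z\<bar> (max \<bar>Y z + (1 - a) / b * X z\<bar> \<bar>Y z - X z\<bar>)"
text \<open>The seventh entry repeats \<open>p\<close>, so that side \<open>i\<close> runs from
  \<open>vt i\<close> to \<open>vt (Suc i)\<close> for every \<open>i < 6\<close>.\<close>

definition "vt i = [p, w, q, - p, - w, - q, p] ! i"
text \<open>The area of the triangle with corners 0, \<open>vt i\<close>, \<open>vt (Suc i)\<close>,
  relative to that of 0, \<open>p\<close>, \<open>q\<close>; see \<open>cr_vt\<close>.\<close>

definition "wt i = [a, b, 1, a, b, 1] ! i"
text \<open>\<open>hexint / (2 * (a + b + 1))\<close> is integration against the cone measure.\<close>

definition "hexint h = (\<Sum>i<6::nat. wt i * seg_avg (vt i) (vt (Suc i)) h)"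

lemma b_pos: "0 < b" using a_pos a_le_b by simp
lemma a_le_1: "a \<le> 1" using a_le_b b_le_1 by simp

lemmas params = a_pos a_le_b b_le_1 ab_ge_1 b_pos a_le_1

lemma coords: "z = X z *\<^sub>R p + Y z *\<^sub>R q"
  unfolding X_def Y_def by (rule cr_expand[OF pq])

lemma XY_simps [simp]:
  "X (u + v) = X u + X v" "X (u - v) = X u - X v" "X (- u) = - X u" "X (c *\<^sub>R u) = c * X u"
  "Y (u + v) = Y u + Y v" "Y (u - v) = Y u - Y v" "Y (- u) = - Y u" "Y (c *\<^sub>R u) = c * Y u"
  "X 0 = 0" "Y 0 = 0"
  by (auto simp: X_def Y_def cr_simps cr_scaleR diff_divide_distrib add_divide_distrib)

lemma XY_base [simp]: "X p = 1" "Y p = 0" "X q = 0" "Y q = 1" "X w = b" "Y w = a"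
  using pq by (auto simp: X_def Y_def w_def cr_simps cr_scaleR)

text \<open>Both upper bounds amount to \<open>1 \<le> a + b\<close>, the convexity of the hexagon
  at \<open>w\<close>.\<close>

lemma ratios:
  "0 \<le> (1 - b) / a" "(1 - b) / a \<le> 1" "0 \<le> (1 - a) / b" "(1 - a) / b \<le> 1"
  using params by (auto simp: field_simps)

lemma ratio_mult:
  assumes "0 \<le> \<sigma>"
  shows "0 \<le> (1 - b) / a * \<sigma>" "(1 - b) / a * \<sigma> \<le> \<sigma>" "0 \<le> (1 - a) / b * \<sigma>" "(1 - a) / b * \<sigma> \<le> \<sigma>"
  using assms ratios by (simp_all add: mult_left_le_one_le del: times_divide_eq_left)

lemma eq_iff_coords: "u = v \<longleftrightarrow> X u = X v \<and> Y u = Y v"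
  using coords[of u] coords[of v] by metis

lemma N_minus [simp]: "N (- z) = N z"
proof -
  have "X (- z) + c * Y (- z) = - (X z + c * Y z)" "Y (- z) + c * X (- z) = - (Y z + c * X z)"
    "Y (- z) - X (- z) = - (Y z - X z)" for c
    by (simp_all add: algebra_simps)
  then show ?thesis by (simp only: N_def abs_minus_cancel)
qed

lemma N_diff_commute: "N (x - y) = N (y - x)"
  using N_minus[of "x - y"] by simp

lemma N_scaleR: "N (c *\<^sub>R z) = \<bar>c\<bar> * N z"
proof -
  have "c * X z + (1 - b) / a * (c * Y z) = c * (X z + (1 - b) / a * Y z)"
    "c * Y z + (1 - a) / b * (c * X z) = c * (Y z + (1 - a) / b * X z)"
    "c * Y z - c * X z = c * (Y z - X z)"
    by (auto simp: algebra_simps)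
  then show ?thesis
    by (simp only: N_def XY_simps abs_mult max_mult_distrib_left abs_ge_zero if_True)
qed

lemma N_nonneg [simp]: "0 \<le> N z" by (simp add: N_def)

lemma N_triangle: "N (x + y) \<le> N x + N y"
proof -
  have "\<bar>u + u'\<bar> \<le> max \<bar>u\<bar> (max \<bar>v\<bar> \<bar>v'\<bar>) + max \<bar>u'\<bar> (max \<bar>z\<bar> \<bar>z'\<bar>)"
    "\<bar>u + u'\<bar> \<le> max \<bar>v\<bar> (max \<bar>u\<bar> \<bar>v'\<bar>) + max \<bar>z\<bar> (max \<bar>u'\<bar> \<bar>z'\<bar>)"
    "\<bar>u + u'\<bar> \<le> max \<bar>v\<bar> (max \<bar>v'\<bar> \<bar>u\<bar>) + max \<bar>z\<bar> (max \<bar>z'\<bar> \<bar>u'\<bar>)"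
    for u u' v v' z z' :: real
    by (rule order_trans[OF abs_triangle_ineq], intro add_mono, simp_all)+
  note le = this
  have e: "X (x + y) + (1 - b) / a * Y (x + y) = (X x + (1 - b) / a * Y x) + (X y + (1 - b) / a * Y y)"
    "Y (x + y) + (1 - a) / b * X (x + y) = (Y x + (1 - a) / b * X x) + (Y y + (1 - a) / b * X y)"
    "Y (x + y) - X (x + y) = (Y x - X x) + (Y y - X y)"
    by (simp_all add: distrib_left)
  show ?thesis
    unfolding N_def e by (intro max.boundedI le)
qed

lemma continuous_N: "continuous_on S N"
proof -
  have "continuous_on S X" "continuous_on S Y"
    unfolding X_def[abs_def] Y_def[abs_def] by (intro linear_continuous_on linear_linear[THEN iffD2] linear_cr)+
  then show ?thesis unfolding N_def by (intro continuous_intros)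
qed

lemma N_bound: "\<exists>C>0. \<forall>z. N z \<le> C * norm z"
proof -
  obtain C where C: "C > 0" "\<And>z. norm (X z) \<le> C * norm z"
    using linear_bounded_pos[OF linear_cr(1)] unfolding X_def by metis
  obtain D where D: "D > 0" "\<And>z. norm (Y z) \<le> D * norm z"
    using linear_bounded_pos[OF linear_cr(2)] unfolding Y_def by metis
  have m: "\<bar>c * x\<bar> \<le> \<bar>x\<bar>" if "0 \<le> c" "c \<le> 1" for c x :: real
    using that by (simp add: abs_mult mult_left_le_one_le)
  have "N z \<le> \<bar>X z\<bar> + \<bar>Y z\<bar>" for z
    unfolding N_def using m[OF ratios(1,2), of "Y z"] m[OF ratios(3,4), of "X z"] by linarith
  then have "N z \<le> (C + D) * norm z" for z
    using C(2)[of z] D(2)[of z] by (smt (verit) distrib_right real_norm_def)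
  then show ?thesis using C(1) D(1) by (intro exI[of _ "C + D"]) auto
qed

text \<open>The hypotheses say that \<open>z\<close> is \<sigma> p + \<tau> w; in this sector the
  functional of the side from \<open>p\<close> to \<open>w\<close> dominates the other two.
  \<open>N_side2\<close> and \<open>N_side3\<close> treat the sectors of \<open>w\<close>,
  \<open>q\<close> and of \<open>q\<close>, \<open>- p\<close> in the same way. Stating them in
  coordinates leaves only linear arithmetic to each application.\<close>

lemma N_side1:
  assumes "0 \<le> \<sigma>" "0 \<le> \<tau>" "X z = \<sigma> + b * \<tau>" "Y z = a * \<tau>"
  shows "N z = \<sigma> + \<tau>"
proof -
  have *: "0 \<le> b * \<tau>" "b * \<tau> \<le> \<tau>" "0 \<le> a * \<tau>" "a * \<tau> \<le> \<tau>"
    using assms(2) params by (auto simp: mult_left_le_one_le)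
  have "X z + (1 - b) / a * Y z = \<sigma> + \<tau>" using assms params by (simp add: field_simps)
  then have "\<bar>X z + (1 - b) / a * Y z\<bar> = \<sigma> + \<tau>" using assms by simp
  moreover have "Y z + (1 - a) / b * X z = \<tau> + (1 - a) / b * \<sigma>"
    using assms params by (simp add: field_simps)
  then have "\<bar>Y z + (1 - a) / b * X z\<bar> \<le> \<sigma> + \<tau>"
    using ratio_mult[OF assms(1)] assms by (intro abs_leI) simp_all
  moreover have "\<bar>Y z - X z\<bar> \<le> \<sigma> + \<tau>"
    unfolding assms(3,4) using * assms(1,2) by (intro abs_leI; linarith)
  ultimately show ?thesis unfolding N_def by simp
qed

lemma N_side2:
  assumes "0 \<le> \<sigma>" "0 \<le> \<tau>" "X z = b * \<sigma>" "Y z = a * \<sigma> + \<tau>"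
  shows "N z = \<sigma> + \<tau>"
proof -
  have *: "0 \<le> b * \<sigma>" "b * \<sigma> \<le> \<sigma>" "0 \<le> a * \<sigma>" "a * \<sigma> \<le> \<sigma>"
    using assms(1) params by (auto simp: mult_left_le_one_le)
  have "Y z + (1 - a) / b * X z = \<sigma> + \<tau>" using assms params by (simp add: field_simps)
  then have "\<bar>Y z + (1 - a) / b * X z\<bar> = \<sigma> + \<tau>" using assms by simp
  moreover have "X z + (1 - b) / a * Y z = \<sigma> + (1 - b) / a * \<tau>"
    using assms params by (simp add: field_simps)
  then have "\<bar>X z + (1 - b) / a * Y z\<bar> \<le> \<sigma> + \<tau>"
    using ratio_mult[OF assms(2)] assms by (intro abs_leI) simp_all
  moreover have "\<bar>Y z - X z\<bar> \<le> \<sigma> + \<tau>"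
    unfolding assms(3,4) using * assms(1,2) by (intro abs_leI; linarith)
  ultimately show ?thesis unfolding N_def by simp
qed

lemma N_side3:
  assumes "0 \<le> \<sigma>" "0 \<le> \<tau>" "X z = - \<tau>" "Y z = \<sigma>"
  shows "N z = \<sigma> + \<tau>"
proof -
  have "\<bar>Y z - X z\<bar> = \<sigma> + \<tau>" using assms by simp
  moreover have "\<bar>X z + (1 - b) / a * Y z\<bar> \<le> \<sigma> + \<tau>"
    unfolding assms(3,4) using ratio_mult[OF assms(1)] assms(1,2) by (intro abs_leI; linarith)
  moreover have "(1 - a) / b * - \<tau> = - ((1 - a) / b * \<tau>)" by simp
  then have "\<bar>Y z + (1 - a) / b * X z\<bar> \<le> \<sigma> + \<tau>"
    unfolding assms(3,4) using ratio_mult[OF assms(2)] assms(1,2) by (intro abs_leI; linarith)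
  ultimately show ?thesis unfolding N_def by simp
qed

text \<open>The second summand accounts for the side opposite to the one from \<open>v\<close> to
  \<open>v'\<close>.\<close>

definition "pair_avg u u' v v' = seg_avg u u' (\<lambda>x. seg_avg v v' (\<lambda>y. N (x - y) + N (x + y)))"

lemma continuous_N_pair: "continuous_on A (\<lambda>(x, y). N (x - y) + N (x + y))"
  unfolding case_prod_unfold
  by (intro continuous_intros continuous_on_compose2[OF continuous_N[of UNIV]]) auto

lemma pair_avg_swap: "pair_avg u u' v v' = pair_avg v v' u u'"
proof -
  let ?x = "\<lambda>s::real. (1 - s) *\<^sub>R u + s *\<^sub>R u'" and ?y = "\<lambda>t::real. (1 - t) *\<^sub>R v + t *\<^sub>R v'"
  have "integral (cbox 0 1) (\<lambda>s. integral (cbox 0 1) (\<lambda>t. N (?x s - ?y t) + N (?x s + ?y t)))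
      = integral (cbox 0 1) (\<lambda>t. integral (cbox 0 1) (\<lambda>s. N (?x s - ?y t) + N (?x s + ?y t)))"
    by (rule integral_swap_continuous, unfold case_prod_unfold)
       (intro continuous_intros continuous_on_compose2[OF continuous_N[of UNIV]], auto)
  then show ?thesis
    by (simp add: pair_avg_def seg_avg_def N_diff_commute[of "?x _"] add.commute[of "?x _"])
qed

lemma pair_avg_eqI:
  assumes "\<And>s t. 0 \<le> s \<Longrightarrow> s \<le> 1 \<Longrightarrow> 0 \<le> t \<Longrightarrow> t \<le> 1 \<Longrightarrow>
      N (((1 - s) *\<^sub>R u + s *\<^sub>R u') - ((1 - t) *\<^sub>R v + t *\<^sub>R v')) = f s t"
    and "\<And>s t. 0 \<le> s \<Longrightarrow> s \<le> 1 \<Longrightarrow> 0 \<le> t \<Longrightarrow> t \<le> 1 \<Longrightarrow>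
      N (((1 - s) *\<^sub>R u + s *\<^sub>R u') + ((1 - t) *\<^sub>R v + t *\<^sub>R v')) = g s t"
    and "\<And>s t. 0 \<le> s \<Longrightarrow> s \<le> 1 \<Longrightarrow> 0 \<le> t \<Longrightarrow> t \<le> 1 \<Longrightarrow>
      f s t + g s t = pw_lin k0 k1 k2 k3 \<kappa> k4 \<rho> k5 \<nu> s t"
    and "0 \<le> \<kappa>" "\<kappa> \<le> 1" "0 \<le> \<rho>" "\<rho> \<le> 1" "0 \<le> \<nu>" "\<nu> \<le> 1"
  shows "pair_avg u u' v v' = k0 + k1 / 2 + k2 / 2 + k3 * \<kappa>\<^sup>2 / 6 + k4 * \<rho>\<^sup>2 / 6 + k5 * \<nu>\<^sup>2 / 6"
  unfolding double_integral_pw_lin[OF assms(4-9), symmetric] pair_avg_def seg_avg_def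
  by (intro integral_cong) (simp add: assms(1-3))

text \<open>For two points of one side, the sum stays in the sector of that side and has norm 2,
  while the difference is a multiple of the side vector. The factor \<bar>s - t\<bar> is s - t + 2
  max 0 (t - s), which is the last term of \<open>pw_lin\<close> with \<nu> = 1.\<close>

lemma pair_avg_11: "pair_avg p w p w = 2 + (1 + a - b) / 3"
proof -
  have "pair_avg p w p w = 2 + (1 + a - b) / 2 + (- (1 + a - b)) / 2 + 0 * 0\<^sup>2 / 6 + 0 * 0\<^sup>2 / 6
      + (2 * (1 + a - b)) * 1\<^sup>2 / 6"
  proof (rule pair_avg_eqI)
    fix s t :: real assume st: "0 \<le> s" "s \<le> 1" "0 \<le> t" "t \<le> 1"
    have wp: "N (w - p) = a + (1 - b)" using params by (intro N_side3) auto
    have "(1 - s) *\<^sub>R p + s *\<^sub>R w - ((1 - t) *\<^sub>R p + t *\<^sub>R w) = (s - t) *\<^sub>R (w - p)"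
      by (simp add: eq_iff_coords algebra_simps)
    then show "N ((1 - s) *\<^sub>R p + s *\<^sub>R w - ((1 - t) *\<^sub>R p + t *\<^sub>R w)) = \<bar>s - t\<bar> * (1 + a - b)"
      by (simp add: N_scaleR wp)
    show "N ((1 - s) *\<^sub>R p + s *\<^sub>R w + ((1 - t) *\<^sub>R p + t *\<^sub>R w)) = (2 - s - t) + (s + t)"
      using st by (intro N_side1; (simp only: XY_simps XY_base)?) (auto simp: algebra_simps)
    show "\<bar>s - t\<bar> * (1 + a - b) + (2 - s - t + (s + t)) =
        pw_lin 2 (1 + a - b) (- (1 + a - b)) 0 0 0 0 (2 * (1 + a - b)) 1 s t"
      by (auto simp: pw_lin_def max_def abs_if algebra_simps)
  qed auto
  then show ?thesis by (simp add: field_simps)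
qed

lemma pair_avg_22: "pair_avg w q w q = 2 + (1 + b - a) / 3"
proof -
  have "pair_avg w q w q = 2 + (1 + b - a) / 2 + (- (1 + b - a)) / 2 + 0 * 0\<^sup>2 / 6 + 0 * 0\<^sup>2 / 6
      + (2 * (1 + b - a)) * 1\<^sup>2 / 6"
  proof (rule pair_avg_eqI)
    fix s t :: real assume st: "0 \<le> s" "s \<le> 1" "0 \<le> t" "t \<le> 1"
    have wp: "N (q - w) = (1 - a) + b" using params by (intro N_side3) auto
    have "(1 - s) *\<^sub>R w + s *\<^sub>R q - ((1 - t) *\<^sub>R w + t *\<^sub>R q) = (s - t) *\<^sub>R (q - w)"
      by (simp add: eq_iff_coords algebra_simps)
    then show "N ((1 - s) *\<^sub>R w + s *\<^sub>R q - ((1 - t) *\<^sub>R w + t *\<^sub>R q)) = \<bar>s - t\<bar> * (1 + b - a)"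
      by (simp add: N_scaleR wp)
    show "N ((1 - s) *\<^sub>R w + s *\<^sub>R q + ((1 - t) *\<^sub>R w + t *\<^sub>R q)) = (2 - s - t) + (s + t)"
      using st by (intro N_side2; (simp only: XY_simps XY_base)?) (auto simp: algebra_simps)
    show "\<bar>s - t\<bar> * (1 + b - a) + (2 - s - t + (s + t)) =
        pw_lin 2 (1 + b - a) (- (1 + b - a)) 0 0 0 0 (2 * (1 + b - a)) 1 s t"
      by (auto simp: pw_lin_def max_def abs_if algebra_simps)
  qed auto
  then show ?thesis by (simp add: field_simps)
qed

lemma pair_avg_33: "pair_avg q (- p) q (- p) = 2 + (1 + b - a) / (3 * b)"
proof -
  define c where "c = (1 + b - a) / b"
  have "pair_avg q (- p) q (- p) = 2 + c / 2 + (- c) / 2 + 0 * 0\<^sup>2 / 6 + 0 * 0\<^sup>2 / 6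
      + (2 * c) * 1\<^sup>2 / 6"
  proof (rule pair_avg_eqI)
    fix s t :: real assume st: "0 \<le> s" "s \<le> 1" "0 \<le> t" "t \<le> 1"
    \<comment> \<open>Here \<open>a \<le> b\<close> decides the sector: p + q = (1/b) w + (1 - a/b)
      q.\<close>
    have "N (p + q) = 1 / b + (1 - a / b)" using params by (intro N_side2; (simp only: XY_simps XY_base)?) (auto simp: field_simps)
    also have "\<dots> = c" using params by (simp add: c_def field_simps)
    finally have pq: "N (p + q) = c" .
    have "(1 - s) *\<^sub>R q + s *\<^sub>R (- p) - ((1 - t) *\<^sub>R q + t *\<^sub>R (- p)) = (t - s) *\<^sub>R (p + q)"
      by (simp add: eq_iff_coords algebra_simps)
    then show "N ((1 - s) *\<^sub>R q + s *\<^sub>R (- p) - ((1 - t) *\<^sub>R q + t *\<^sub>R (- p))) = \<bar>s - t\<bar> * c"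
      by (simp only: N_scaleR pq abs_minus_commute)
    show "N ((1 - s) *\<^sub>R q + s *\<^sub>R (- p) + ((1 - t) *\<^sub>R q + t *\<^sub>R (- p))) = (2 - s - t) + (s + t)"
      using st by (intro N_side3; (simp only: XY_simps XY_base)?) (auto simp: algebra_simps)
    show "\<bar>s - t\<bar> * c + (2 - s - t + (s + t)) = pw_lin 2 c (- c) 0 0 0 0 (2 * c) 1 s t"
      by (auto simp: pw_lin_def max_def abs_if algebra_simps)
  qed auto
  then have "pair_avg q (- p) q (- p) = 2 + c / 3" by simp
  then show ?thesis by (simp add: c_def)
qed

text \<open>Both sides are parametrised from \<open>w\<close>. The difference of the two points
  never leaves the sector of \<open>q\<close> and \<open>- p\<close> (up to sign), so its norm is
  linear. The sum crosses the ray of \<open>w\<close> along \<open>t = a / b * s\<close>, which is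
  the only kink.\<close>

lemma pair_avg_12:
  "pair_avg w p w q = 2 + ((1 + a - b) - (a + b - 1) / b) / 2 + (1 + b - a) / 2
     + (a + b - 1) / a * (a / b)\<^sup>2 / 6"
proof -
  let ?d = "a + b - 1"
  have "pair_avg w p w q = 2 + ((1 + a - b) - ?d / b) / 2 + (1 + b - a) / 2
     + ?d / a * (a / b)\<^sup>2 / 6 + 0 * 0\<^sup>2 / 6 + 0 * 0\<^sup>2 / 6"
  proof (rule pair_avg_eqI)
    fix s t :: real assume st: "0 \<le> s" "s \<le> 1" "0 \<le> t" "t \<le> 1"
    let ?x = "(1 - s) *\<^sub>R w + s *\<^sub>R p" and ?y = "(1 - t) *\<^sub>R w + t *\<^sub>R q"
    have "0 \<le> t * (1 - a) + s * a" "0 \<le> t * b + s * (1 - b)" using st params by simp_all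
    then have "N (?y - ?x) = (t * (1 - a) + s * a) + (t * b + s * (1 - b))"
      by (intro N_side3; (simp only: XY_simps XY_base)?) (auto simp: algebra_simps)
    then show "N (?x - ?y) = (t * (1 - a) + s * a) + (t * b + s * (1 - b))"
      by (simp add: N_diff_commute)
    show "N (?x + ?y) = (if t \<le> a / b * s then 2 - t * ?d / a else 2 - s * ?d / b)"
    proof (cases "t \<le> a / b * s")
      case True
      have "t \<le> t / a" using st params by (simp add: pos_le_divide_eq mult_left_le)
      then have "0 \<le> 2 - s - t + t / a" using st by linarith
      moreover have "0 \<le> s - t * b / a" using True params by (simp add: field_simps)
      ultimately have "N (?x + ?y) = (s - t * b / a) + (2 - s - t + t / a)"
        using params by (intro N_side1; (simp only: XY_simps XY_base)?) (auto simp: field_simps)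
      also have "\<dots> = 2 - t * ?d / a" using params by (simp add: field_simps)
      finally show ?thesis using True by simp
    next
      case False
      have "s \<le> s / b" using st params by (simp add: pos_le_divide_eq mult_left_le)
      then have "0 \<le> 2 - s - t + s / b" using st by linarith
      moreover have "0 \<le> t - s * a / b" using False params by (simp add: field_simps)
      ultimately have "N (?x + ?y) = (2 - s - t + s / b) + (t - s * a / b)"
        using params by (intro N_side2; (simp only: XY_simps XY_base)?) (auto simp: field_simps)
      also have "\<dots> = 2 - s * ?d / b" using params by (simp add: field_simps)
      finally show ?thesis using False by simp
    qed
    show "t * (1 - a) + s * a + (t * b + s * (1 - b))
       + (if t \<le> a / b * s then 2 - t * ?d / a else 2 - s * ?d / b)
       = pw_lin 2 ((1 + a - b) - ?d / b) (1 + b - a) (?d / a) (a / b) 0 0 0 0 s t"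
      using params by (auto simp: pw_lin_def max_def field_simps)
  qed (use params in auto)
  then show ?thesis by simp
qed

text \<open>The third side is replaced by its opposite, which shares the vertex \<open>p\<close>
  with the first and has the same pair average. The difference crosses the ray of \<open>q\<close>
  along \<open>t = (1 - b) * s\<close>, and the sum crosses the ray of \<open>p\<close> along
  \<open>t = a * s\<close>.\<close>

lemma pair_avg_13:
  "pair_avg p w p (- q) = 2 + ((a + b - 1) / b - (1 + a - b)) / 2 + (1 + b - a) / b / 2
     + (1 + b - a) / b * (1 - b)\<^sup>2 / 6 + (1 + a - b) / a * a\<^sup>2 / 6"
proof -
  let ?d = "a + b - 1"
  have "pair_avg p w p (- q) = 2 + (?d / b - (1 + a - b)) / 2 + (1 + b - a) / b / 2
     + (1 + b - a) / b * (1 - b)\<^sup>2 / 6 + (1 + a - b) / a * a\<^sup>2 / 6 + 0 * 0\<^sup>2 / 6"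
  proof (rule pair_avg_eqI)
    fix s t :: real assume st: "0 \<le> s" "s \<le> 1" "0 \<le> t" "t \<le> 1"
    let ?x = "(1 - s) *\<^sub>R p + s *\<^sub>R w" and ?y = "(1 - t) *\<^sub>R p + t *\<^sub>R (- q)"
    show "N (?x - ?y) = (if t \<le> (1 - b) * s then s * (1 + a - b) else s * ?d / b + t * (1 + b - a) / b)"
    proof (cases "t \<le> (1 - b) * s")
      case True
      then have "N (?x - ?y) = (s * a + t) + (s * (1 - b) - t)"
        using st params by (intro N_side3; (simp only: XY_simps XY_base)?) (auto simp: algebra_simps)
      with True show ?thesis by (simp add: algebra_simps)
    next
      case False
      define \<sigma> where "\<sigma> = (t - s * (1 - b)) / b"
      have \<sigma>: "0 \<le> \<sigma>" "b * \<sigma> = t - s * (1 - b)" using False params by (auto simp: \<sigma>_def field_simps)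
      have "a * \<sigma> \<le> b * \<sigma>" using \<sigma>(1) params by (simp add: mult_right_mono)
      moreover have "0 \<le> s * a" "0 \<le> s * (1 - b)" using st params by auto
      ultimately have "0 \<le> s * a + t - a * \<sigma>" using \<sigma>(2) by linarith
      then have "N (?x - ?y) = \<sigma> + (s * a + t - a * \<sigma>)"
        using \<sigma> by (intro N_side2; (simp only: XY_simps XY_base)?) (auto simp: algebra_simps)
      also have "\<dots> = s * ?d / b + t * (1 + b - a) / b" using params by (simp add: \<sigma>_def field_simps)
      finally show ?thesis using False by simp
    qed
    show "N (?x + ?y) = (if t \<le> a * s then 2 - t * (1 + a - b) / a else 2 - s * (1 + a - b))"
    proof (cases "t \<le> a * s")
      case True
      have "0 \<le> b * t / a" using st params by simp
      then have "0 \<le> 2 - s - t + b * t / a" using st by linarith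
      moreover have "0 \<le> s - t / a" using True params by (simp add: field_simps)
      ultimately have "N (?x + ?y) = (2 - s - t + b * t / a) + (s - t / a)"
        using st params by (intro N_side1; (simp only: XY_simps XY_base)?) (auto simp: field_simps)
      also have "\<dots> = 2 - t * (1 + a - b) / a" using params by (simp add: field_simps)
      finally show ?thesis using True by simp
    next
      case False
      have "s * (1 - b) \<le> 1" using st params by (simp add: mult_le_one)
      then have "N (- (?x + ?y)) = (t - s * a) + (2 - s * (1 - b) - t)"
        using False st by (intro N_side3; (simp only: XY_simps XY_base)?) (auto simp: algebra_simps)
      with False show ?thesis unfolding N_minus by (simp add: algebra_simps)
    qed
    show "(if t \<le> (1 - b) * s then s * (1 + a - b) else s * ?d / b + t * (1 + b - a) / b)
        + (if t \<le> a * s then 2 - t * (1 + a - b) / a else 2 - s * (1 + a - b))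
       = pw_lin 2 (?d / b - (1 + a - b)) ((1 + b - a) / b) ((1 + b - a) / b) (1 - b)
          ((1 + a - b) / a) a 0 0 s t"
      using params by (auto simp: pw_lin_def max_def field_simps)
  qed (use params in auto)
  then show ?thesis by simp
qed

text \<open>With \<open>q\<close> as common vertex, the difference crosses two rays, that of
  \<open>p\<close> along \<open>t = (1 - a) * s\<close> and that of \<open>w\<close> along
  \<open>s = (b - a) / b * t\<close>; the sum crosses the ray of \<open>q\<close> along
  \<open>t = b * s\<close>. This is the pair for which \<open>pw_lin\<close> has three positive
  parts.\<close>

lemma pair_avg_23:
  "pair_avg q w q (- p) = 2 + ((a + b - 1) / a - (1 + b - a)) / 2 + (1 + a - b) / a / 2
     + (1 + a - b) / a * (1 - a)\<^sup>2 / 6 + (1 + b - a) / b * b\<^sup>2 / 6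
     + (a + b - 1) / a * ((b - a) / b)\<^sup>2 / 6"
proof (rule pair_avg_eqI)
  let ?d = "a + b - 1"
  fix s t :: real assume st: "0 \<le> s" "s \<le> 1" "0 \<le> t" "t \<le> 1"
  let ?x = "(1 - s) *\<^sub>R q + s *\<^sub>R w" and ?y = "(1 - t) *\<^sub>R q + t *\<^sub>R (- p)"
  \<comment> \<open>The first inequality forces t \<le> s, the second s < t. Hence at most one of
    the two positive parts is nonzero, and the three-way case distinction below becomes a
    sum.\<close>
  have excl: "\<not> (t \<le> (1 - a) * s \<and> s < (b - a) / b * t)"
  proof
    assume *: "t \<le> (1 - a) * s \<and> s < (b - a) / b * t"
    have "(1 - a) * s \<le> s" using st params by (simp add: mult_left_le_one_le)
    moreover have "(b - a) / b * t \<le> t" using st params by (intro mult_left_le_one_le) auto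
    ultimately show False using * by linarith
  qed
  show "N (?x - ?y) = (if t \<le> (1 - a) * s then s * (1 + b - a)
      else if s < (b - a) / b * t then t * (1 + b - a) / b
      else s * ?d / a + t * (1 + a - b) / a)"
  proof -
    consider "t \<le> (1 - a) * s" | "\<not> t \<le> (1 - a) * s" "s < (b - a) / b * t"
      | "\<not> t \<le> (1 - a) * s" "\<not> s < (b - a) / b * t" by blast
    then show ?thesis
    proof cases
      case 1
      moreover have "0 \<le> s * b + t" using st params by simp
      ultimately have "N (?y - ?x) = (s * (1 - a) - t) + (s * b + t)"
        using st params by (intro N_side3; (simp only: XY_simps XY_base)?) (auto simp: algebra_simps)
      with 1 show ?thesis unfolding N_diff_commute[of ?x] by (simp add: algebra_simps)
    next
      case 2
      then have "N (?x - ?y) = (s + t / b) + (t - s - t * a / b)"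
        using st params by (intro N_side2; (simp only: XY_simps XY_base)?) (auto simp: field_simps)
      also have "\<dots> = t * (1 + b - a) / b" using params by (simp add: field_simps)
      finally show ?thesis using 2 by simp
    next
      case 3
      then have "N (?x - ?y) = (s * b + t * (a - b)) / a + (t - s * (1 - a)) / a"
        using st params by (intro N_side1; (simp only: XY_simps XY_base)?) (auto simp: field_simps)
      also have "\<dots> = s * ?d / a + t * (1 + a - b) / a" using params by (simp add: field_simps)
      finally show ?thesis using 3 by simp
    qed
  qed
  show "N (?x + ?y) = (if t \<le> b * s then 2 - t * (1 + b - a) / b else 2 - s * (1 + b - a))"
  proof (cases "t \<le> b * s")
    case True
    have "0 \<le> a * t / b" using st params by simp
    then have "0 \<le> 2 - s - t + a * t / b" using st by linarith
    moreover have "0 \<le> s - t / b" using True params by (simp add: field_simps)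
    ultimately have "N (?x + ?y) = (s - t / b) + (2 - s - t + a * t / b)"
      using st params by (intro N_side2; (simp only: XY_simps XY_base)?) (auto simp: field_simps)
    also have "\<dots> = 2 - t * (1 + b - a) / b" using params by (simp add: field_simps)
    finally show ?thesis using True by simp
  next
    case False
    have "s * (1 - a) \<le> 1" using st params by (simp add: mult_le_one)
    then have "N (?x + ?y) = (2 - s * (1 - a) - t) + (t - s * b)"
      using False st by (intro N_side3; (simp only: XY_simps XY_base)?) (auto simp: algebra_simps)
    with False show ?thesis by (simp add: algebra_simps)
  qed
  show "(if t \<le> (1 - a) * s then s * (1 + b - a)
      else if s < (b - a) / b * t then t * (1 + b - a) / b
      else s * ?d / a + t * (1 + a - b) / a)
      + (if t \<le> b * s then 2 - t * (1 + b - a) / b else 2 - s * (1 + b - a))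
     = pw_lin 2 (?d / a - (1 + b - a)) ((1 + a - b) / a) ((1 + a - b) / a) (1 - a)
        ((1 + b - a) / b) b (?d / a) ((b - a) / b) s t"
  proof -
    have A: "(if t \<le> (1 - a) * s then s * (1 + b - a)
      else if s < (b - a) / b * t then t * (1 + b - a) / b
      else s * ?d / a + t * (1 + a - b) / a)
      = ?d / a * s + (1 + a - b) / a * t + (1 + a - b) / a * max 0 ((1 - a) * s - t)
        + ?d / a * max 0 ((b - a) / b * t - s)"
    proof -
      have "s * (1 + b - a) = ?d / a * s + (1 + a - b) / a * t + (1 + a - b) / a * ((1 - a) * s - t)"
        using params by (simp add: field_simps)
      moreover have "t * (1 + b - a) / b = ?d / a * s + (1 + a - b) / a * t + ?d / a * ((b - a) / b * t - s)"
        using params by (simp add: field_simps)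
      moreover have "max 0 ((1 - a) * s - t) = (if t \<le> (1 - a) * s then (1 - a) * s - t else 0)"
        "max 0 ((b - a) / b * t - s) = (if s < (b - a) / b * t then (b - a) / b * t - s else 0)"
        by (simp_all add: max_def)
      ultimately show ?thesis using excl by (auto simp: mult.commute)
    qed
    have B: "(if t \<le> b * s then 2 - t * (1 + b - a) / b else 2 - s * (1 + b - a))
      = 2 - (1 + b - a) * s + (1 + b - a) / b * max 0 (b * s - t)"
      using params by (auto simp: max_def field_simps)
    show ?thesis unfolding A B pw_lin_def by (simp add: algebra_simps)
  qed
qed (use params in \<open>auto simp: field_simps\<close>)

end

section \<open>The closed form of the sprawl and its polynomial bounds\<close>

lemma hex_poly_bounds:
  fixes a b :: real
  defines "P \<equiv> 6*a^2*b - 6*a*b^2 + 2*b^3 + 6*b^2 - 2*b - 4*a^3*b + 4*a^2*b^2 - 4*b^4 - 2 - 2*a^3 + 2*a^2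
      + 4*a*b^3 + 2*a"
  assumes "0 < a" "a \<le> b" "b \<le> 1" "1 \<le> a + b"
  shows "0 \<le> P" "P \<le> 2/3 * b * (a + b + 1)^2"
proof -
  \<comment> \<open>In these quantities a = y + z, b = x + y + z and 1 = x + 2 y + z; substituting
    all three, also for the constants, makes both expressions homogeneous of degree 4.\<close>
  define x y z where "x = b - a" and "y = 1 - b" and "z = a + b - 1"
  have nn: "0 \<le> x" "0 \<le> y" "0 \<le> z" using assms by (auto simp: x_def y_def z_def)
  \<comment> \<open>Every monomial contains \<open>z\<close>, and \<open>z^4\<close> occurs: the
    value \<open>4/3\<close> belongs to \<open>z = 0\<close>, the parallelograms.\<close>
  have 1: "P = 56*x*y^2*z + 64*x*y*z^2 + 32*y^3*z + 56*y^2*z^2 + 24*x^2*y*z + 12*x^2*z^2 + 32*y*z^3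
      + 18*x*z^3 + 6*z^4"
    unfolding P_def x_def y_def z_def by algebra
  show "0 \<le> P" unfolding 1 using nn by simp
  \<comment> \<open>The term \<open>2/3 * b * (a + b + 1)^2\<close> is 1/18 of the denominator in
    \<open>sprawl_value_eq\<close>. Every monomial contains \<open>x\<close> or \<open>y\<close>,
    and \<open>x^4\<close> and \<open>y^4\<close> occur, so the value \<open>23/18\<close> belongs
    to \<open>x = y = 0\<close>, that is, \<open>a = b = 1\<close>.\<close>
  have 2: "2/3 * b * (a + b + 1)^2 - P =
      160/3*x*y^3 + 184/3*x*y^2*z + 48*x^2*y^2 + 64/3*y^4 + 32*y^3*z + 44/3*y^2*z^2 + 62/3*x*y*z^2
      + 136/3*x^2*y*z + 2*y*z^3 + 2*x*z^3 + 38/3*x^2*z^2 + 56/3*x^3*y + 40/3*x^3*z + 8/3*x^4"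
    unfolding P_def x_def y_def z_def by (simp add: field_simps) algebra
  have "0 \<le> 2/3 * b * (a + b + 1)^2 - P" unfolding 2 using nn by simp
  then show "P \<le> 2/3 * b * (a + b + 1)^2" by simp
qed

context hexagon_frame
begin

lemma hexint_expand:
  "hexint h = a * seg_avg p w h + b * seg_avg w q h + seg_avg q (- p) h
     + (a * seg_avg (- p) (- w) h + b * seg_avg (- w) (- q) h + seg_avg (- q) p h)"
  by (simp add: hexint_def wt_def vt_def eval_nat_numeral)

lemma hexint_symmetrize:
  assumes "continuous_on UNIV h"
  shows "hexint h = a * seg_avg p w (\<lambda>x. h x + h (- x)) + b * seg_avg w q (\<lambda>x. h x + h (- x))
      + seg_avg q (- p) (\<lambda>x. h x + h (- x))"
proof -
  have "continuous_on UNIV (\<lambda>x. h (- x))"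
    by (intro continuous_on_compose2[OF assms] continuous_intros) auto
  note add = seg_avg_add[OF assms this]
  have "seg_avg (- q) p h = seg_avg q (- p) (\<lambda>x. h (- x))"
    using seg_avg_uminus[of q "- p" h] by simp
  then show ?thesis unfolding hexint_expand add seg_avg_uminus by (simp add: algebra_simps)
qed

definition "sprawl_value = hexint (\<lambda>x. hexint (\<lambda>y. N (x - y))) / (2 * (a + b + 1))\<^sup>2"

text \<open>Opposite sides are folded together in both variables. The folded inner integral is even
  in the outer point, so the outer folding only doubles it; the remaining nine terms reduce to six
  by the symmetry of \<open>pair_avg\<close>.\<close>

lemma hexint_hexint_N:
  "hexint (\<lambda>x. hexint (\<lambda>y. N (x - y))) =
     2 * (a\<^sup>2 * pair_avg p w p w + b\<^sup>2 * pair_avg w q w q + pair_avg q (- p) q (- p)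
       + 2 * a * b * pair_avg w p w q + 2 * a * pair_avg p w p (- q) + 2 * b * pair_avg q w q (- p))"
proof -
  define F where "F v v' x = seg_avg v v' (\<lambda>y. N (x - y) + N (x + y))" for v v' x
  have cF: "continuous_on UNIV (F v v')" for v v'
    unfolding F_def[abs_def] by (intro continuous_seg_avg continuous_N_pair)
  have cN: "continuous_on UNIV (\<lambda>y. N (x - y))" for x
    by (intro continuous_on_compose2[OF continuous_N[of UNIV]] continuous_intros) auto
  have inner: "hexint (\<lambda>y. N (x - y)) = a * F p w x + b * F w q x + F q (- p) x" for x
    unfolding hexint_symmetrize[OF cN] F_def by simp
  have even: "F v v' (- x) = F v v' x" for v v' x
  proof -
    have "N (- x - y) = N (x + y)" "N (- x + y) = N (x - y)" for y
      using N_minus[of "x + y"] N_minus[of "x - y"] by (simp_all add: algebra_simps)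
    then show ?thesis by (simp add: F_def add.commute)
  qed
  define G where "G x = a * F p w x + b * F w q x + F q (- p) x" for x
  have cG: "continuous_on UNIV G"
    unfolding G_def[abs_def] by (intro continuous_intros cF)
  have GG: "G x + G (- x) = 2 * G x" for x unfolding G_def by (simp add: even)
  have avgG: "seg_avg u u' G = a * pair_avg u u' p w + b * pair_avg u u' w q + pair_avg u u' q (- p)" for u u'
    unfolding G_def[abs_def]
    by (subst seg_avg_add seg_avg_cmult; (intro continuous_intros cF)?)+
       (simp add: pair_avg_def F_def[abs_def] seg_avg_cmult)
  have "hexint G = 2 * (a * seg_avg p w G + b * seg_avg w q G + seg_avg q (- p) G)"
    unfolding hexint_symmetrize[OF cG] GG seg_avg_cmult by (simp add: algebra_simps)
  also have "\<dots> = 2 * (a\<^sup>2 * pair_avg p w p w + b\<^sup>2 * pair_avg w q w q + pair_avg q (- p) q (- p)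
       + 2 * a * b * pair_avg p w w q + 2 * a * pair_avg p w q (- p) + 2 * b * pair_avg w q q (- p))"
    unfolding avgG pair_avg_swap[of w q p w] pair_avg_swap[of q "- p" p w] pair_avg_swap[of q "- p" w q]
    by (simp add: algebra_simps power2_eq_square)
  also have "pair_avg p w w q = pair_avg w p w q"
    by (simp add: pair_avg_def seg_avg_commute[of w p])
  also have "pair_avg w q q (- p) = pair_avg q w q (- p)"
    by (simp add: pair_avg_def seg_avg_commute[of w q])
  \<comment> \<open>Negating the second side exchanges the two summands of the pair average, and
    reversing it lets it start at \<open>p\<close>.\<close>
  also have "pair_avg p w q (- p) = pair_avg p w p (- q)"
  proof -
    have "pair_avg p w q (- p) = pair_avg p w (- q) p"
      using seg_avg_uminus[of q "- p"] by (simp add: pair_avg_def add.commute)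
    then show ?thesis by (simp add: pair_avg_def seg_avg_commute[of "- q" p])
  qed
  finally show ?thesis unfolding inner G_def .
qed

lemma sprawl_value_eq:
  "sprawl_value = 4/3 - (6*a^2*b - 6*a*b^2 + 2*b^3 + 6*b^2 - 2*b - 4*a^3*b + 4*a^2*b^2 - 4*b^4 - 2 - 2*a^3
      + 2*a^2 + 4*a*b^3 + 2*a) / (12 * b * (a + b + 1)\<^sup>2)" (is "_ = 4/3 - ?P / _")
proof -
  let ?W = "a + b + 1"
  have nz: "a \<noteq> 0" "b \<noteq> 0" "?W \<noteq> 0" using params by auto
  have "a\<^sup>2 * pair_avg p w p w + b\<^sup>2 * pair_avg w q w q + pair_avg q (- p) q (- p)
       + 2 * a * b * pair_avg w p w q + 2 * a * pair_avg p w p (- q) + 2 * b * pair_avg q w q (- p)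
     = 8/3 * ?W\<^sup>2 - ?P / (6 * b)"
    unfolding pair_avg_11 pair_avg_22 pair_avg_33 pair_avg_12 pair_avg_13 pair_avg_23
    using nz(1,2) by (simp add: field_simps power2_eq_square power3_eq_cube power4_eq_xxxx)
  then have "sprawl_value = 2 * (8/3 * ?W\<^sup>2 - ?P / (6 * b)) / (2 * ?W)\<^sup>2"
    unfolding sprawl_value_def hexint_hexint_N by simp
  also have "\<dots> = 4/3 - ?P / (12 * b * ?W\<^sup>2)"
  proof -
    have "2 * (8/3 * W\<^sup>2 - P / (6 * b)) / (2 * W)\<^sup>2 = 4/3 - P / (12 * b * W\<^sup>2)" if "W \<noteq> 0" for W P
    using nz that by (simp add: field_simps power2_eq_square)
    from this[OF nz(3)] show ?thesis .
  qed
  finally show ?thesis .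
qed

lemma sprawl_value_bounds: "23/18 \<le> sprawl_value" "sprawl_value \<le> 4/3"
proof -
  note P = hex_poly_bounds[OF a_pos a_le_b b_le_1 ab_ge_1]
  have D: "0 < 12 * b * (a + b + 1)\<^sup>2" using params by simp
  show "sprawl_value \<le> 4/3" unfolding sprawl_value_eq using P(1) D by simp
  have "x / (12 * b * (a + b + 1)\<^sup>2) \<le> 1/18" if "x \<le> 2/3 * b * (a + b + 1)^2" for x
    using that D by (subst pos_divide_le_eq[OF D]) simp
  from this[OF P(2)] show "23/18 \<le> sprawl_value" unfolding sprawl_value_eq by simp
qed

end

section \<open>The hexagonal body and its cone measure\<close>

context hexagon_frame
begin

lemma vt_simps [simp]: "vt 0 = p" "vt 1 = w" "vt (Suc 0) = w" "vt 2 = q" "vt 3 = - p" "vt 4 = - w"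
    "vt 5 = - q" "vt 6 = p"
  by (simp_all add: vt_def eval_nat_numeral)

lemma wt_simps [simp]: "wt 0 = a" "wt 1 = b" "wt (Suc 0) = b" "wt 2 = 1" "wt 3 = a" "wt 4 = b" "wt 5 = 1"
  by (simp_all add: wt_def eval_nat_numeral)

lemma less_6_cases: "i < 6 \<Longrightarrow> i = 0 \<or> i = 1 \<or> i = 2 \<or> i = 3 \<or> i = 4 \<or> i = (5::nat)"
  by linarith

lemma wt_pos: "i < 6 \<Longrightarrow> 0 < wt i"
  using params by (auto dest!: less_6_cases)

lemma sum_wt: "(\<Sum>i<6. wt i) = 2 * (a + b + 1)"
  by (simp add: wt_def eval_nat_numeral)

lemma cr_vt: "i < 6 \<Longrightarrow> cr (vt i) (vt (Suc i)) = wt i * cr p q"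
  using cr_commute[of q p]
  by (auto dest!: less_6_cases simp: w_def cr_simps cr_scaleR numeral_2_eq_2[symmetric])

lemma vt_antipode: "i < 3 \<Longrightarrow> vt (i + 3) = - vt i" "i < 3 \<Longrightarrow> vt (Suc (i + 3)) = - vt (Suc i)"
  by (auto simp: vt_def eval_nat_numeral less_Suc_eq)

lemma N_cone:
  assumes "i < 6" "0 \<le> \<sigma>" "0 \<le> \<tau>"
  shows "N (\<sigma> *\<^sub>R vt i + \<tau> *\<^sub>R vt (Suc i)) = \<sigma> + \<tau>"
proof -
  have *: "N (\<sigma> *\<^sub>R vt i + \<tau> *\<^sub>R vt (Suc i)) = \<sigma> + \<tau>" if "i < 3" for i
  proof -
    have "i = 0 \<or> i = 1 \<or> i = 2" using that by linarith
    then show ?thesis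
      using assms(2,3)
      by (elim disjE)
         (simp_all add: numeral_2_eq_2[symmetric] numeral_3_eq_3[symmetric] N_side1 N_side2 N_side3
            mult.commute)
  qed
  show ?thesis
  proof (cases "i < 3")
    case False
    define j where "j = i - 3"
    have j: "i = j + 3" "j < 3" using assms(1) False by (auto simp: j_def)
    have "\<sigma> *\<^sub>R vt i + \<tau> *\<^sub>R vt (Suc i) = - (\<sigma> *\<^sub>R vt j + \<tau> *\<^sub>R vt (Suc j))"
      using vt_antipode[OF j(2)] by (simp add: j(1))
    then show ?thesis using *[OF j(2)] by (metis N_minus)
  qed (rule *)
qed

lemma cone_cover: "\<exists>i<6. \<exists>\<sigma> \<tau>. 0 \<le> \<sigma> \<and> 0 \<le> \<tau> \<and> z = \<sigma> *\<^sub>R vt i + \<tau> *\<^sub>R vt (Suc i)"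
proof -
  have *: "\<exists>i<3. \<exists>\<sigma> \<tau>. 0 \<le> \<sigma> \<and> 0 \<le> \<tau> \<and> z = \<sigma> *\<^sub>R vt i + \<tau> *\<^sub>R vt (Suc i)"
    if "Y z > 0 \<or> Y z = 0 \<and> X z \<ge> 0" for z
  proof (cases "X z < 0")
    case True
    then show ?thesis using that
      by (intro exI[of _ 2] conjI exI[of _ "Y z"] exI[of _ "- X z"])
         (auto simp: eq_iff_coords numeral_3_eq_3[symmetric])
  next
    case False
    show ?thesis
    proof (cases "a * X z \<ge> b * Y z")
      case True
      define \<sigma> \<tau> where "\<sigma> = X z - b * Y z / a" and "\<tau> = Y z / a"
      have "0 \<le> \<sigma>" "0 \<le> \<tau>" using that True params by (auto simp: \<sigma>_def \<tau>_def field_simps)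
      moreover have "z = \<sigma> *\<^sub>R vt 0 + \<tau> *\<^sub>R vt (Suc 0)"
        using params by (simp add: eq_iff_coords \<sigma>_def \<tau>_def)
      ultimately show ?thesis by (metis zero_less_numeral)
    next
      case F: False
      define \<sigma> \<tau> where "\<sigma> = X z / b" and "\<tau> = Y z - a * X z / b"
      have "0 \<le> \<sigma>" "0 \<le> \<tau>" using that F False params by (auto simp: \<sigma>_def \<tau>_def field_simps)
      moreover have "z = \<sigma> *\<^sub>R vt 1 + \<tau> *\<^sub>R vt (Suc 1)"
        using params by (simp add: eq_iff_coords \<sigma>_def \<tau>_def numeral_2_eq_2[symmetric])
      ultimately show ?thesis by (metis one_less_numeral_iff semiring_norm(77))
    qed
  qed
  show ?thesis
  proof (cases "Y z > 0 \<or> Y z = 0 \<and> X z \<ge> 0")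
    case True
    from *[OF this] obtain i \<sigma> \<tau> where "i < 3" "0 \<le> \<sigma>" "0 \<le> \<tau>" "z = \<sigma> *\<^sub>R vt i + \<tau> *\<^sub>R vt (Suc i)" by blast
    moreover from this(1) have "i < 6" by simp
    ultimately show ?thesis by blast
  next
    case False
    then have "Y (- z) > 0 \<or> Y (- z) = 0 \<and> X (- z) \<ge> 0" by auto
    from *[OF this] obtain i \<sigma> \<tau> where i: "i < 3" "0 \<le> \<sigma>" "0 \<le> \<tau>"
      "- z = \<sigma> *\<^sub>R vt i + \<tau> *\<^sub>R vt (Suc i)" by blast
    have "z = \<sigma> *\<^sub>R vt (i + 3) + \<tau> *\<^sub>R vt (Suc (i + 3))"
    proof -
      have "z = - (\<sigma> *\<^sub>R vt i + \<tau> *\<^sub>R vt (Suc i))" unfolding i(4)[symmetric] by simp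
      then show ?thesis unfolding vt_antipode[OF i(1)] by simp
    qed
    moreover have "i + 3 < 6" using i(1) by simp
    ultimately show ?thesis using i(2,3) by blast
  qed
qed

lemma N_eq_0: "N z = 0 \<longleftrightarrow> z = 0"
proof
  assume z: "N z = 0"
  obtain i \<sigma> \<tau> where "i < 6" "0 \<le> \<sigma>" "0 \<le> \<tau>" "z = \<sigma> *\<^sub>R vt i + \<tau> *\<^sub>R vt (Suc i)"
    using cone_cover by blast
  moreover from this have "\<sigma> = 0" "\<tau> = 0" using N_cone[of i \<sigma> \<tau>] z by auto
  ultimately show "z = 0" by simp
qed (simp add: N_def)

definition "body = {z. N z \<le> 1}"
definition "boundary = {z. N z = 1}"

lemma convex_body: "convex body"
  unfolding convex_def body_def
proof (clarsimp)
  fix x y :: "real^2" and u v :: real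
  assume *: "N x \<le> 1" "N y \<le> 1" "0 \<le> u" "0 \<le> v" "u + v = 1"
  have "N (u *\<^sub>R x + v *\<^sub>R y) \<le> u * N x + v * N y"
    using N_triangle[of "u *\<^sub>R x" "v *\<^sub>R y"] * by (simp add: N_scaleR)
  also have "\<dots> \<le> u * 1 + v * 1" using * by (intro add_mono mult_left_mono) auto
  finally show "N (u *\<^sub>R x + v *\<^sub>R y) \<le> 1" using * by simp
qed

lemma N_vt: "i < 6 \<Longrightarrow> N (vt i) = 1"
  using N_cone[of i 1 0] by simp

lemma hull_eq_body: "convex hull {p, - p, w, - w, q, - q} = body"
proof
  have "N p = 1" "N w = 1" "N q = 1" using N_vt[of 0] N_vt[of 1] N_vt[of 2] by simp_all
  then show "convex hull {p, - p, w, - w, q, - q} \<subseteq> body"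
    by (intro hull_minimal convex_body) (auto simp: body_def)
next
  let ?C = "convex hull {p, - p, w, - w, q, - q}"
  have cv: "convex ?C" by (rule convex_convex_hull)
  have vtC: "vt i \<in> ?C" if "i < 6" for i
    using less_6_cases[OF that] by (intro hull_inc) auto
  have vtC': "vt (Suc i) \<in> ?C" if "i < 6" for i
    using vtC[of "Suc i"] vtC[of 0] less_6_cases[OF that] by (cases "i = 5") (auto simp: vt_def)
  have "(1/2) *\<^sub>R vt 0 + (1/2) *\<^sub>R vt 3 \<in> ?C"
    by (intro convexD[OF cv] vtC) auto
  then have zero: "0 \<in> ?C" by simp
  show "body \<subseteq> ?C"
  proof
    fix z assume z: "z \<in> body"
    obtain i \<sigma> \<tau> where i: "i < 6" "0 \<le> \<sigma>" "0 \<le> \<tau>" and zz: "z = \<sigma> *\<^sub>R vt i + \<tau> *\<^sub>R vt (Suc i)"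
      using cone_cover by blast
    have le: "\<sigma> + \<tau> \<le> 1" using z N_cone[OF i] by (simp add: body_def zz)
    show "z \<in> ?C"
    proof (cases "\<sigma> + \<tau> = 0")
      case True
      then have "\<sigma> = 0" "\<tau> = 0" using i by auto
      then show ?thesis using zero zz by simp
    next
      case False
      have "(\<sigma> / (\<sigma> + \<tau>)) *\<^sub>R vt i + (\<tau> / (\<sigma> + \<tau>)) *\<^sub>R vt (Suc i) \<in> ?C"
        using False i by (intro convexD[OF cv] vtC vtC') (auto simp: add_divide_distrib[symmetric])
      then have "(\<sigma> + \<tau>) *\<^sub>R ((\<sigma> / (\<sigma> + \<tau>)) *\<^sub>R vt i + (\<tau> / (\<sigma> + \<tau>)) *\<^sub>R vt (Suc i)) + (1 - (\<sigma> + \<tau>)) *\<^sub>R 0 \<in> ?C"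
        by (rule convexD[OF cv _ zero]) (use le i in auto)
      then show ?thesis using False by (simp add: zz scaleR_add_right)
    qed
  qed
qed

lemma closed_body: "closed body"
  unfolding body_def using closed_Collect_le[OF continuous_N continuous_on_const] by simp

lemma open_N_less: "open {z. N z < 1}"
  using open_Collect_less[OF continuous_N continuous_on_const] by simp

lemma symmetric_convex_body_body: "symmetric_convex_body body"
proof -
  have "compact body"
    unfolding hull_eq_body[symmetric] by (intro compact_convex_hull finite_imp_compact) simp
  moreover have "0 \<in> interior body"
    by (rule interiorI[OF open_N_less]) (auto simp: N_eq_0 body_def N_def)
  ultimately show ?thesis
    unfolding symmetric_convex_body_def using convex_body by (auto simp: body_def)
qed

lemma frontier_body: "frontier body = boundary"
proof -
  have "interior body = {z. N z < 1}"
  proof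
    show "{z. N z < 1} \<subseteq> interior body"
      by (rule interior_maximal[OF _ open_N_less]) (auto simp: body_def)
    show "interior body \<subseteq> {z. N z < 1}"
    proof
      fix z assume "z \<in> interior body"
      then obtain e where e: "e > 0" "ball z e \<subseteq> body" by (meson mem_interior)
      \<comment> \<open>An interior point can be pushed outwards by the factor
        \<open>1 + \<delta>\<close> without leaving the body, which bounds its norm strictly below
        1; the \<open>+ 1\<close> in the denominator keeps the factor defined at
        \<open>z = 0\<close>.\<close>
      define \<delta> where "\<delta> = e / (2 * (norm z + 1))"
      have nz: "0 < norm z + 1" by (smt (verit) norm_ge_zero)
      then have \<delta>: "\<delta> > 0" using e by (simp add: \<delta>_def)
      have "\<delta> * norm z \<le> \<delta> * (norm z + 1)" using \<delta> by (intro mult_left_mono) auto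
      also have "\<dots> = e / 2" using nz by (simp add: \<delta>_def field_simps)
      finally have "z + \<delta> *\<^sub>R z \<in> ball z e" using e \<delta> by (simp add: dist_norm)
      then have "N (z + \<delta> *\<^sub>R z) \<le> 1" using e(2) by (auto simp: body_def)
      moreover have "z + \<delta> *\<^sub>R z = (1 + \<delta>) *\<^sub>R z" by (simp add: algebra_simps)
      ultimately have "(1 + \<delta>) * N z \<le> 1" using \<delta> by (simp add: N_scaleR)
      moreover have "N z < (1 + \<delta>) * N z" if "N z \<ge> 1" using \<delta> that by (simp add: algebra_simps)
      ultimately show "z \<in> {z. N z < 1}" by fastforce
    qed
  qed
  then have "frontier body = body - {z. N z < 1}"
    unfolding frontier_def closure_closed[OF closed_body] by simp
  also have "\<dots> = boundary" unfolding body_def boundary_def by (intro set_eqI) (simp, linarith)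
  finally show ?thesis .
qed

lemma body_of_boundary: "body_of boundary = body"
  using body_of_frontier[OF symmetric_convex_body_body] by (simp add: frontier_body)

lemma minkowski_norm_boundary: "minkowski_norm boundary z = N z"
proof -
  have "{t. 0 \<le> t \<and> z \<in> (\<lambda>y. t *\<^sub>R y) ` body} = {N z..}"
  proof (intro set_eqI iffI)
    fix t assume "t \<in> {t. 0 \<le> t \<and> z \<in> (\<lambda>y. t *\<^sub>R y) ` body}"
    then obtain y where y: "0 \<le> t" "N y \<le> 1" "z = t *\<^sub>R y" by (auto simp: body_def)
    then have "N z = t * N y" by (simp add: N_scaleR)
    also have "\<dots> \<le> t * 1" using y by (intro mult_left_mono) auto
    finally show "t \<in> {N z..}" by simp
  next
    fix t assume t: "t \<in> {N z..}"
    have t0: "0 \<le> t" using t order_trans[OF N_nonneg[of z]] by simp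
    show "t \<in> {t. 0 \<le> t \<and> z \<in> (\<lambda>y. t *\<^sub>R y) ` body}"
    proof (cases "t = 0")
      case True
      then have "z = 0" using t N_nonneg[of z] N_eq_0[of z] by simp
      then show ?thesis using True by (auto simp: body_def N_def intro!: image_eqI[where x = 0])
    next
      case False
      then have "(1 / t) *\<^sub>R z \<in> body" using t t0 by (simp add: body_def N_scaleR)
      moreover have "z = t *\<^sub>R (1 / t) *\<^sub>R z" using False by simp
      ultimately show ?thesis using t0 by blast
    qed
  qed
  then show ?thesis
    unfolding minkowski_norm_def body_of_boundary by simp
qed

end

section \<open>Areas of cones over subsets of a segment\<close>

lemma measurable_vector_pair:
  "(\<lambda>(x, y). vector [x, y] :: real^2) \<in> borel_measurable (lborel \<Otimes>\<^sub>M lborel)"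
proof -
  have "linear (\<lambda>(x, y). vector [x, y] :: real^2)"
    by (auto intro!: linearI simp: vec_eq_iff forall_2)
  then have "continuous_on UNIV (\<lambda>(x, y). vector [x, y] :: real^2)"
    by (simp add: linear_continuous_on linear_linear)
  then show ?thesis
    unfolding lborel_prod using borel_measurable_continuous_onI by simp
qed

text \<open>Transports Fubini from the product of two lines to \<open>real^2\<close>, so that areas
  can be computed by slices. It suffices to compare the two measures on boxes.\<close>

lemma lborel_real2_eq_pair:
  "(lborel :: (real^2) measure) = distr (lborel \<Otimes>\<^sub>M lborel) borel (\<lambda>(x, y). vector [x, y])"
proof (rule lborel_eqI)
  note meas = measurable_vector_pair
  fix l u :: "real^2" assume le: "\<And>b. b \<in> Basis \<Longrightarrow> l \<bullet> b \<le> u \<bullet> b"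
  have le': "l$1 \<le> u$1" "l$2 \<le> u$2"
    using le[of "axis 1 1"] le[of "axis 2 1"] by (auto simp: inner_axis axis_in_Basis_iff)
  have "(\<lambda>(x, y). vector [x, y] :: real^2) -` box l u \<inter> space (lborel \<Otimes>\<^sub>M lborel)
      = {l$1<..<u$1} \<times> {l$2<..<u$2}"
    by (auto simp: mem_box_cart forall_2 space_pair_measure)
  then have "emeasure (distr (lborel \<Otimes>\<^sub>M lborel) borel (\<lambda>(x, y). vector [x, y])) (box l u)
      = emeasure (lborel \<Otimes>\<^sub>M lborel) ({l$1<..<u$1} \<times> {l$2<..<u$2})"
    by (subst emeasure_distr[OF meas]) auto
  also have "\<dots> = ennreal ((u$1 - l$1) * (u$2 - l$2))"
    using le' by (subst lborel.emeasure_pair_measure_Times) (auto simp: ennreal_mult)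
  also have "(u$1 - l$1) * (u$2 - l$2) = (\<Prod>b\<in>Basis. (u - l) \<bullet> b)"
  proof -
    have "(Basis :: (real^2) set) = {axis 1 1, axis 2 1}"
      unfolding Basis_vec_def using exhaust_2 by (auto simp: UNIV_2)
    then show ?thesis unfolding \<open>Basis = _\<close> by (simp add: inner_axis axis_eq_axis)
  qed
  finally show "emeasure (distr (lborel \<Otimes>\<^sub>M lborel) borel (\<lambda>(x, y). vector [x, y])) (box l u)
      = ennreal (\<Prod>b\<in>Basis. (u - l) \<bullet> b)" .
qed simp

text \<open>The apex \<open>t = 0\<close> is left out so that cones over different sides can be
  disjoint.\<close>

definition punctured_cone :: "real^2 \<Rightarrow> real^2 \<Rightarrow> real set \<Rightarrow> (real^2) set" where
  "punctured_cone u v B = {t *\<^sub>R ((1 - s) *\<^sub>R u + s *\<^sub>R v) | t s. 0 < t \<and> t \<le> 1 \<and> s \<in> B}"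

text \<open>The cone is the image, under a linear map of determinant \<open>cr u v\<close> up to
  sign, of the set of points (t, t s) with t in (0, 1] and s in \<open>B\<close>. The slice of that
  set at t is \<open>B\<close> scaled by t, so its area is half the length of
  \<open>B\<close>.\<close>

lemma punctured_cone_measure:
  assumes B: "B \<in> sets borel" "B \<subseteq> {0..1}" and cr: "cr u v \<noteq> 0"
  shows "punctured_cone u v B \<in> sets borel"
    and "emeasure lborel (punctured_cone u v B) = ennreal (\<bar>cr u v\<bar> / 2 * measure lborel B)"
proof -
  define f :: "real^2 \<Rightarrow> real^2" where "f x = x$1 *\<^sub>R u + x$2 *\<^sub>R (v - u)" for x
  define S :: "(real^2) set" where "S = {x. 0 < x$1 \<and> x$1 \<le> 1 \<and> x$2 / x$1 \<in> B}"
  note B(1)[measurable]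
  have S_borel: "S \<in> sets borel" unfolding S_def by measurable
  have image: "f ` S = punctured_cone u v B"
  proof (intro set_eqI iffI)
    fix z assume "z \<in> f ` S"
    then obtain x where x: "z = f x" "0 < x$1" "x$1 \<le> 1" "x$2 / x$1 \<in> B" by (auto simp: S_def)
    have "z = x$1 *\<^sub>R ((1 - x$2 / x$1) *\<^sub>R u + (x$2 / x$1) *\<^sub>R v)"
      using x(2) unfolding x(1) f_def by (simp add: algebra_simps)
    then show "z \<in> punctured_cone u v B" using x unfolding punctured_cone_def by blast
  next
    fix z assume "z \<in> punctured_cone u v B"
    then obtain t s where t: "0 < t" "t \<le> 1" "s \<in> B" "z = t *\<^sub>R ((1 - s) *\<^sub>R u + s *\<^sub>R v)"
      by (auto simp: punctured_cone_def)
    show "z \<in> f ` S"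
      by (rule image_eqI[of _ _ "vector [t, t * s]"]) (use t in \<open>auto simp: f_def S_def algebra_simps\<close>)
  qed
  \<comment> \<open>The explicit inverse of \<open>f\<close>: the image under \<open>f\<close> is
    then a preimage under a Borel function, hence a Borel set.\<close>
  define g :: "real^2 \<Rightarrow> real^2" where
    "g z = vector [cr z (v - u) / cr u v, cr u z / cr u v]" for z
  have crvu: "cr u (v - u) = cr u v" by (simp add: cr_simps)
  have gf: "g (f x) = x" for x
    using cr by (simp add: g_def f_def vec_eq_iff forall_2 cr_simps cr_scaleR cr_commute[of v u])
  have fg: "f (g z) = z" for z
    using cr_expand[of u "v - u" z] cr unfolding f_def g_def by (simp add: crvu)
  have "f ` S = g -` S" using gf fg by (auto simp: image_iff) (metis fg)
  moreover have "g \<in> borel_measurable borel"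
  proof -
    have "linear g" unfolding g_def
      by (auto intro!: linearI simp: vec_eq_iff forall_2 cr_simps cr_scaleR add_divide_distrib
          diff_divide_distrib right_diff_distrib)
    then show ?thesis by (simp add: borel_measurable_continuous_onI linear_continuous_on linear_linear)
  qed
  ultimately have fS_borel: "f ` S \<in> sets borel"
    using measurable_sets[of g borel borel S] S_borel by simp
  then show "punctured_cone u v B \<in> sets borel" by (simp add: image)
  have linf: "linear f" unfolding f_def by (auto intro!: linearI simp: algebra_simps)
  have bounded: "bounded S"
  proof -
    have "S \<subseteq> cbox 0 1"
    proof
      fix x assume x: "x \<in> S"
      then have "0 \<le> x$2 / x$1" "x$2 / x$1 \<le> 1" using B(2) by (auto simp: S_def)
      then have "0 \<le> x$2" "x$2 \<le> x$1" using x by (auto simp: S_def field_simps zero_le_divide_iff)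
      then show "x \<in> cbox 0 1" using x by (auto simp: mem_box_cart forall_2 S_def)
    qed
    then show ?thesis using bounded_cbox bounded_subset by blast
  qed
  have S_lm: "S \<in> lmeasurable"
    using S_borel bounded by (intro bounded_set_imp_lmeasurable) auto
  have det: "\<bar>det (matrix f)\<bar> = \<bar>cr u v\<bar>"
    by (simp add: det_2 matrix_def f_def cr_def axis_def algebra_simps)
  have "emeasure lborel S = ennreal (measure lborel B / 2)"
  proof -
    let ?T = "{(x, y). 0 < x \<and> x \<le> 1 \<and> y / x \<in> B}"
    have "{z \<in> space (lborel \<Otimes>\<^sub>M lborel). 0 < fst z \<and> fst z \<le> 1 \<and> snd z / fst z \<in> B}
        \<in> sets (lborel \<Otimes>\<^sub>M lborel)" by measurable
    moreover have "{z \<in> space (lborel \<Otimes>\<^sub>M lborel). 0 < fst z \<and> fst z \<le> 1 \<and> snd z / fst z \<in> B} = ?T"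
      by (auto simp: space_pair_measure)
    ultimately have T: "?T \<in> sets (lborel \<Otimes>\<^sub>M lborel)" by simp
    have "emeasure lborel S = emeasure (lborel \<Otimes>\<^sub>M lborel)
        ((\<lambda>(x, y). vector [x, y]) -` S \<inter> space (lborel \<Otimes>\<^sub>M lborel))"
      unfolding lborel_real2_eq_pair by (rule emeasure_distr[OF measurable_vector_pair]) (rule S_borel)
    also have "(\<lambda>(x, y). vector [x, y]) -` S \<inter> space (lborel \<Otimes>\<^sub>M lborel) = ?T"
      by (auto simp: S_def space_pair_measure)
    also have "emeasure (lborel \<Otimes>\<^sub>M lborel) ?T = (\<integral>\<^sup>+x. emeasure lborel (Pair x -` ?T) \<partial>lborel)"
      by (rule lborel.emeasure_pair_measure_alt[OF T])
    also have "\<dots> = (\<integral>\<^sup>+x. ennreal (x * measure lborel B) * indicator {0..1} x \<partial>lborel)"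
    proof (rule nn_integral_cong)
      fix x :: real
      have fin: "emeasure lborel B < \<infinity>"
        using emeasure_mono[OF B(2), of lborel] by (simp add: order_le_less_trans)
      show "emeasure lborel (Pair x -` ?T) = ennreal (x * measure lborel B) * indicator {0..1} x"
      proof (cases "0 < x \<and> x \<le> 1")
        case True
        have "Pair x -` ?T = (\<lambda>y. 0 + (1 / x) * y) -` B" using True by auto
        moreover have "emeasure lborel B
            = emeasure (density (distr lborel borel (\<lambda>y. 0 + (1 / x) * y)) (\<lambda>_. ennreal \<bar>1 / x\<bar>)) B"
          using lborel_real_affine[of "1 / x" 0] True by simp
        moreover have "\<dots> = ennreal (1 / x) * emeasure lborel ((\<lambda>y. 0 + (1 / x) * y) -` B)"
          using True by (simp add: emeasure_density nn_integral_cmult_indicator emeasure_distr)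
        ultimately have "emeasure lborel B = ennreal (1 / x) * emeasure lborel (Pair x -` ?T)" by simp
        then have "ennreal x * emeasure lborel B = ennreal x * ennreal (1 / x) * emeasure lborel (Pair x -` ?T)"
          by (simp add: mult.assoc)
        also have "ennreal x * ennreal (1 / x) = 1" using True by (simp add: ennreal_mult[symmetric])
        finally have "emeasure lborel (Pair x -` ?T) = ennreal x * emeasure lborel B" by simp
        also have "\<dots> = ennreal (x * measure lborel B)"
          using True fin by (simp add: emeasure_eq_ennreal_measure ennreal_mult less_top)
        finally show ?thesis using True by simp
      qed (auto simp: indicator_def)
    qed
    also have "\<dots> = ennreal (measure lborel B / 2)"
    proof -
      have "((\<lambda>x. x * measure lborel B) has_integral (0 + measure lborel B / 2)) {0..1}"
        using has_integral_linear_unit[of 0 "measure lborel B"] by (simp add: mult.commute)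
      from nn_integral_has_integral_lebesgue[OF _ this]
      have "(\<integral>\<^sup>+x. ennreal (indicator {0..1} x * (x * measure lborel B)) \<partial>lborel) = ennreal (measure lborel B / 2)"
        by simp
      then show ?thesis by (simp add: ennreal_mult'' mult.commute ennreal_indicator)
    qed
    finally show ?thesis .
  qed
  then have mS: "measure lebesgue S = measure lborel B / 2"
    using S_borel by (simp add: measure_def)
  have "emeasure lborel (f ` S) = emeasure lebesgue (f ` S)" using fS_borel by simp
  also have "\<dots> = ennreal (measure lebesgue (f ` S))"
    using measurable_linear_image[OF linf S_lm] by (rule emeasure_eq_measure2)
  also have "measure lebesgue (f ` S) = \<bar>cr u v\<bar> / 2 * measure lborel B"
    unfolding measure_linear_image[OF linf S_lm] det mS by simp
  finally show "emeasure lborel (punctured_cone u v B) = ennreal (\<bar>cr u v\<bar> / 2 * measure lborel B)"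
    by (simp add: image)
qed

section \<open>The cone measure as a mixture of uniform measures on the sides\<close>

context hexagon_frame
begin

definition "side_pt i s = (1 - s) *\<^sub>R vt i + s *\<^sub>R vt (Suc i)"

text \<open>Reads off from the coordinates the sector of a nonzero point. Each sector contains its
  first bounding ray and not its second, so every nonzero point has exactly one.\<close>

definition "side_ix z = (if 0 \<le> Y z \<and> b * Y z < a * X z then 0 else if 0 < X z \<and> a * X z \<le> b * Y z then 1
   else if X z \<le> 0 \<and> 0 < Y z then 2 else if Y z \<le> 0 \<and> a * X z < b * Y z then 3
   else if X z < 0 \<and> b * Y z \<le> a * X z then 4 else (5::nat))"

lemma side_ix:
  assumes "i < 6" "0 < \<sigma>" "0 \<le> \<tau>"
  shows "side_ix (\<sigma> *\<^sub>R vt i + \<tau> *\<^sub>R vt (Suc i)) = i"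
proof -
  have pos: "0 < a * \<sigma>" "0 < b * \<sigma>" "0 \<le> a * \<tau>" "0 \<le> b * \<tau>" using assms params by auto
  have s: "vt (Suc 2) = - p" "vt (Suc 3) = - w" "vt (Suc 4) = - q" "vt (Suc 5) = p" "vt (Suc 1) = q"
    by (simp_all add: vt_def eval_nat_numeral)
  show ?thesis
    using less_6_cases[OF assms(1)]
  proof (elim disjE)
    assume i: "i = 0"
    show ?thesis using pos assms unfolding i side_ix_def by (simp add: s algebra_simps)
  next
    assume i: "i = 1"
    show ?thesis using pos assms unfolding i side_ix_def s by (simp add: algebra_simps)
  next
    assume i: "i = 2"
    show ?thesis using pos assms unfolding i side_ix_def s by simp
  next
    assume i: "i = 3"
    show ?thesis using pos assms unfolding i side_ix_def s by (simp add: algebra_simps)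
  next
    assume i: "i = 4"
    show ?thesis using pos assms unfolding i side_ix_def s by (simp add: algebra_simps)
  next
    assume i: "i = 5"
    show ?thesis using pos assms unfolding i side_ix_def s by (simp add: algebra_simps)
  qed
qed

lemma N_side_pt: "i < 6 \<Longrightarrow> 0 \<le> s \<Longrightarrow> s \<le> 1 \<Longrightarrow> N (side_pt i s) = 1"
  unfolding side_pt_def using N_cone[of i "1 - s" s] by simp

lemma side_pt_cover:
  assumes "z \<in> boundary"
  obtains i s where "i < 6" "0 \<le> s" "s < 1" "z = side_pt i s"
proof -
  obtain i \<sigma> \<tau> where i: "i < 6" "0 \<le> \<sigma>" "0 \<le> \<tau>" and z: "z = \<sigma> *\<^sub>R vt i + \<tau> *\<^sub>R vt (Suc i)"
    using cone_cover by blast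
  have \<sigma>: "\<sigma> = 1 - \<tau>" using N_cone[OF i] assms by (simp add: boundary_def z)
  show thesis
  proof (cases "\<tau> = 1")
    case False
    then show thesis using that[of i \<tau>] i \<sigma> by (simp add: z side_pt_def)
  next
    case True
    then have "z = side_pt (if i = 5 then 0 else Suc i) 0"
      using \<sigma> by (auto simp: z side_pt_def vt_def eval_nat_numeral)
    moreover have "(if i = 5 then 0 else Suc i) < 6" using i(1) by auto
    ultimately show thesis using that by fastforce
  qed
qed

text \<open>Parameters are taken from the half-open interval, so that each vertex is counted on one
  side only.\<close>

definition "side_trace A i = {s \<in> {0..<1}. side_pt i s \<in> A}"

lemma measurable_side_pt: "side_pt i \<in> borel_measurable borel"
  unfolding side_pt_def[abs_def] by (intro borel_measurable_continuous_onI continuous_intros)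

lemma side_trace_borel:
  assumes "A \<in> sets borel"
  shows "side_trace A i \<in> sets borel"
proof -
  have "side_trace A i = (side_pt i -` A \<inter> space borel) \<inter> {0..<1}" by (auto simp: side_trace_def)
  then show ?thesis using measurable_sets[OF measurable_side_pt assms] by simp
qed

text \<open>Up to the apex, a null set, the cone is the disjoint union of the punctured cones over
  the traces of \<open>A\<close> on the six sides; \<open>side_ix\<close> separates them.\<close>

lemma cone_over_measure:
  assumes A: "A \<in> sets borel" "A \<subseteq> boundary"
  shows "emeasure lborel (cone_over A) =
    ennreal (\<Sum>i<6. \<bar>cr p q\<bar> * wt i / 2 * measure lborel (side_trace A i))"
proof -
  let ?C = "\<lambda>i. punctured_cone (vt i) (vt (Suc i)) (side_trace A i)"
  have crn: "cr (vt i) (vt (Suc i)) \<noteq> 0" if "i < 6" for i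
    using wt_pos[OF that] pq by (simp add: cr_vt[OF that])
  have sub: "side_trace A i \<subseteq> {0..1}" for i by (auto simp: side_trace_def)
  note C = punctured_cone_measure[OF side_trace_borel[OF A(1)] sub crn]
  have ix: "side_ix x = i" if x: "x \<in> ?C i" and i: "i < 6" for x i
  proof -
    obtain t s where ts: "0 < t" "s \<in> side_trace A i" "x = t *\<^sub>R ((1 - s) *\<^sub>R vt i + s *\<^sub>R vt (Suc i))"
      using x unfolding punctured_cone_def by blast
    then have "0 \<le> s" "s < 1" by (auto simp: side_trace_def)
    then show ?thesis
      using side_ix[OF i, of "t * (1 - s)" "t * s"] ts by (simp add: scaleR_add_right)
  qed
  have disj: "disjoint_family_on ?C {..<6}"
    unfolding disjoint_family_on_def
  proof (intro ballI impI)
    fix m n :: nat assume mn: "m \<in> {..<6}" "n \<in> {..<6}" "m \<noteq> n"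
    have "x \<notin> ?C n" if "x \<in> ?C m" for x using ix[of x m] ix[of x n] that mn by auto
    then show "?C m \<inter> ?C n = {}" by blast
  qed
  have U: "cone_over A = (\<Union>i<6. ?C i) \<union> (cone_over A \<inter> {0})"
  proof (intro set_eqI iffI)
    fix x assume x: "x \<in> cone_over A"
    then obtain t z where t: "x = t *\<^sub>R z" "z \<in> A" "0 \<le> t" "t \<le> 1" by (auto simp: cone_over_def)
    show "x \<in> (\<Union>i<6. ?C i) \<union> (cone_over A \<inter> {0})"
    proof (cases "x = 0")
      case False
      then have "0 < t" using t by (cases "t = 0") auto
      obtain i s where s: "i < 6" "0 \<le> s" "s < 1" "z = side_pt i s"
        using side_pt_cover t(2) A(2) by blast
      then have "s \<in> side_trace A i" using t by (auto simp: side_trace_def)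
      then have "x \<in> ?C i"
        using \<open>0 < t\<close> t s unfolding punctured_cone_def side_pt_def by blast
      then show ?thesis using s(1) by blast
    qed (use x in auto)
  next
    fix x assume "x \<in> (\<Union>i<6. ?C i) \<union> (cone_over A \<inter> {0})"
    then show "x \<in> cone_over A"
      by (fastforce simp: punctured_cone_def cone_over_def side_trace_def side_pt_def)
  qed
  have null: "cone_over A \<inter> {0} \<in> null_sets lborel"
    by (rule null_sets_subset[of "{0}"]) (auto simp: Int_insert_right)
  have "emeasure lborel (cone_over A) = emeasure lborel (\<Union>i<6. ?C i)"
    by (subst U, rule emeasure_Un_null_set[OF _ null]) (use C(1) in auto)
  also have "\<dots> = (\<Sum>i<6. emeasure lborel (?C i))"
    by (rule sum_emeasure[symmetric]) (use C(1) disj in auto)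
  also have "\<dots> = (\<Sum>i<6. ennreal (\<bar>cr p q\<bar> * wt i / 2 * measure lborel (side_trace A i)))"
    using wt_pos by (intro sum.cong refl, subst C(2)) (auto simp: cr_vt abs_mult mult_ac less_imp_le abs_of_pos)
  also have "\<dots> = ennreal (\<Sum>i<6. \<bar>cr p q\<bar> * wt i / 2 * measure lborel (side_trace A i))"
    using wt_pos by (intro sum_ennreal) (auto simp: less_imp_le)
  finally show ?thesis .
qed

lemma compact_boundary: "compact boundary"
  using symmetric_convex_body_body frontier_body compact_frontier
  unfolding symmetric_convex_body_def by metis

lemma side_trace_boundary: "i < 6 \<Longrightarrow> side_trace boundary i = {0..<1}"
  using N_side_pt by (auto simp: side_trace_def boundary_def)

lemma emeasure_body: "emeasure lborel body = ennreal (\<bar>cr p q\<bar> * (a + b + 1))"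
proof -
  have "body = cone_over boundary"
  proof (intro set_eqI iffI)
    fix x assume x: "x \<in> body"
    show "x \<in> cone_over boundary"
    proof (cases "x = 0")
      case True
      have "0 *\<^sub>R vt 0 \<in> cone_over boundary"
        unfolding cone_over_def using N_vt[of 0] by (force simp: boundary_def)
      then show ?thesis using True by simp
    next
      case False
      then have "N x > 0" using N_eq_0[of x] N_nonneg[of x] by linarith
      then have "x = N x *\<^sub>R ((1 / N x) *\<^sub>R x)" "(1 / N x) *\<^sub>R x \<in> boundary" "0 \<le> N x" "N x \<le> 1"
        using x by (auto simp: boundary_def body_def N_scaleR)
      then show ?thesis unfolding cone_over_def by blast
    qed
  next
    fix x assume "x \<in> cone_over boundary"
    then show "x \<in> body" by (auto simp: cone_over_def body_def boundary_def N_scaleR)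
  qed
  moreover have "boundary \<in> sets borel" using compact_boundary by (simp add: borel_compact)
  ultimately have "emeasure lborel body =
      ennreal (\<Sum>i<6. \<bar>cr p q\<bar> * wt i / 2 * measure lborel (side_trace boundary i))"
    using cone_over_measure[of boundary] by simp
  also have "(\<Sum>i<6. \<bar>cr p q\<bar> * wt i / 2 * measure lborel (side_trace boundary i)) = (\<Sum>i<6. \<bar>cr p q\<bar> / 2 * wt i)"
    by (intro sum.cong refl) (simp add: side_trace_boundary)
  also have "\<dots> = \<bar>cr p q\<bar> * (a + b + 1)"
    unfolding sum_distrib_left[symmetric] sum_wt by simp
  finally show ?thesis .
qed

text \<open>With \<open>unit_measure\<close> this describes a random boundary point: a side is drawn
  with probability proportional to its weight, then a uniform parameter on it.\<close>

definition "side_weights = point_measure {..<6} (\<lambda>i. ennreal (wt i / (2 * (a + b + 1))))"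
definition "unit_measure = restrict_space lborel {0..<1::real}"

lemma W_pos: "0 < a + b + 1" using params by simp

lemma finite_side_weights: "finite_measure side_weights"
  unfolding side_weights_def
  by (rule finite_measureI) (simp add: space_point_measure emeasure_point_measure_finite2)

lemma finite_unit_measure: "finite_measure unit_measure"
  unfolding unit_measure_def
  by (rule finite_measureI) (simp add: space_restrict_space emeasure_restrict_space)

lemma measurable_sides: "(\<lambda>(i, s). side_pt i s) \<in> borel_measurable (side_weights \<Otimes>\<^sub>M unit_measure)"
proof -
  have "(\<lambda>(i, s). side_pt i s) \<in> borel_measurable (count_space {..<6} \<Otimes>\<^sub>M unit_measure)"
    by (rule measurable_pair_measure_countable1)
       (auto simp: unit_measure_def intro!: measurable_restrict_space1 measurable_side_pt[simplified])
  moreover have "sets (side_weights \<Otimes>\<^sub>M unit_measure) = sets (count_space {..<6} \<Otimes>\<^sub>M unit_measure)"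
    by (intro sets_pair_measure_cong) (auto simp: side_weights_def sets_point_measure)
  ultimately show ?thesis using measurable_cong_sets by blast
qed

lemma measurable_sides_boundary:
  "(\<lambda>(i, s). side_pt i s) \<in> measurable (side_weights \<Otimes>\<^sub>M unit_measure) (restrict_space borel boundary)"
  by (rule measurable_restrict_space2[OF _ measurable_sides])
     (auto simp: space_pair_measure side_weights_def unit_measure_def space_point_measure
        space_restrict_space boundary_def N_side_pt)

text \<open>\<open>cone_measure\<close> comes from a set function whose countable additivity is not
  evident. It is enough that this function agrees with the image measure on every measurable subset
  of the boundary, because \<open>measure_of\<close> then rebuilds the image measure.\<close>

lemma cone_measure_boundary:
  "cone_measure boundary =
     distr (side_weights \<Otimes>\<^sub>M unit_measure) (restrict_space borel boundary) (\<lambda>(i, s). side_pt i s)"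
  (is "_ = ?D")
proof -
  have bdry: "boundary \<in> sets borel" using compact_boundary by (simp add: borel_compact)
  have eq: "emeasure lborel (cone_over A) / emeasure lborel (body_of boundary) = emeasure ?D A"
    if A: "A \<in> sets (restrict_space borel boundary)" for A
  proof -
    have A': "A \<in> sets borel" "A \<subseteq> boundary"
      using A bdry by (auto simp: sets_restrict_space_iff)
    let ?P = "side_weights \<Otimes>\<^sub>M unit_measure"
    interpret U: finite_measure unit_measure by (rule finite_unit_measure)
    have X: "(\<lambda>(i, s). side_pt i s) -` A \<inter> space ?P \<in> sets ?P"
      using measurable_sets[OF measurable_sides A'(1)] .
    have "emeasure ?D A = emeasure ?P ((\<lambda>(i, s). side_pt i s) -` A \<inter> space ?P)"
      by (rule emeasure_distr[OF measurable_sides_boundary A])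
    also have "\<dots> = (\<integral>\<^sup>+i. emeasure unit_measure (Pair i -` ((\<lambda>(i, s). side_pt i s) -` A \<inter> space ?P)) \<partial>side_weights)"
      by (rule U.emeasure_pair_measure_alt[OF X])
    also have "\<dots> = (\<Sum>i<6. ennreal (wt i / (2 * (a + b + 1)))
        * emeasure unit_measure (Pair i -` ((\<lambda>(i, s). side_pt i s) -` A \<inter> space ?P)))"
      unfolding side_weights_def by (subst nn_integral_point_measure_finite) (simp_all add: mult.commute)
    also have "\<dots> = (\<Sum>i<6. ennreal (wt i / (2 * (a + b + 1)) * measure lborel (side_trace A i)))"
    proof (intro sum.cong refl)
      fix i :: nat assume i: "i \<in> {..<6}"
      have "Pair i -` ((\<lambda>(i, s). side_pt i s) -` A \<inter> space ?P) = side_trace A i"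
        using i by (auto simp: side_trace_def space_pair_measure side_weights_def unit_measure_def
            space_point_measure space_restrict_space)
      moreover have "emeasure unit_measure (side_trace A i) = emeasure lborel (side_trace A i)"
        unfolding unit_measure_def by (subst emeasure_restrict_space) (auto simp: side_trace_def)
      moreover have "emeasure lborel (side_trace A i) \<noteq> top"
      proof -
        have "side_trace A i \<subseteq> {0..<1}" by (auto simp: side_trace_def)
        from emeasure_mono[OF this, of lborel] show ?thesis by (auto simp: top_unique)
      qed
      then have "emeasure lborel (side_trace A i) = ennreal (measure lborel (side_trace A i))"
        by (rule emeasure_eq_ennreal_measure)
      ultimately show "ennreal (wt i / (2 * (a + b + 1)))
          * emeasure unit_measure (Pair i -` ((\<lambda>(i, s). side_pt i s) -` A \<inter> space ?P))
          = ennreal (wt i / (2 * (a + b + 1)) * measure lborel (side_trace A i))"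
        using wt_pos[of i] i W_pos
        by (simp only: ennreal_mult measure_nonneg divide_nonneg_pos less_imp_le lessThan_iff
            mult_pos_pos zero_less_numeral)
    qed
    also have "\<dots> = ennreal (\<Sum>i<6. wt i / (2 * (a + b + 1)) * measure lborel (side_trace A i))"
      using wt_pos W_pos by (intro sum_ennreal) (auto simp: less_imp_le)
    also have "(\<Sum>i<6. wt i / (2 * (a + b + 1)) * measure lborel (side_trace A i))
        = (\<Sum>i<6. \<bar>cr p q\<bar> * wt i / 2 * measure lborel (side_trace A i)) / (\<bar>cr p q\<bar> * (a + b + 1))"
    proof -
      have "u / (2 * W) * m = c * u / 2 * m / (c * W)" if "c \<noteq> 0" "W \<noteq> 0" for u W m c :: real
        using that by (simp add: field_simps)
      from this[of "\<bar>cr p q\<bar>" "a + b + 1"] show ?thesis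
        using pq W_pos unfolding sum_divide_distrib by (intro sum.cong refl) simp
    qed
    also have "ennreal \<dots> = emeasure lborel (cone_over A) / emeasure lborel (body_of boundary)"
      unfolding body_of_boundary emeasure_body cone_over_measure[OF A']
      using pq W_pos wt_pos by (intro divide_ennreal[symmetric]) (auto intro!: sum_nonneg simp: less_imp_le)
    finally show ?thesis by simp
  qed
  have sp: "space ?D = boundary" "sets ?D = sets (restrict_space borel boundary)"
    by (simp_all add: space_restrict_space)
  have "cone_measure boundary = measure_of (space ?D) (sets ?D) (emeasure ?D)"
    unfolding cone_measure_def sp
  proof (rule measure_of_eq)
    show "sets (restrict_space borel boundary) \<subseteq> Pow boundary"
      using sets.space_closed[of "restrict_space borel boundary"] by (simp add: space_restrict_space)
    fix A assume "A \<in> sigma_sets boundary (sets (restrict_space borel boundary))"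
    then have "A \<in> sets (restrict_space borel boundary)"
      using sets.sigma_sets_eq[of "restrict_space borel boundary"] by (simp add: space_restrict_space)
    then show "emeasure lborel (cone_over A) / emeasure lborel (body_of boundary) = emeasure ?D A"
      by (rule eq)
  qed
  then show ?thesis by (simp only: measure_of_of_measure)
qed

lemma finite_cone_measure: "finite_measure (cone_measure boundary)"
proof -
  have "finite_measure (side_weights \<Otimes>\<^sub>M unit_measure)"
    by (rule finite_measure_pair_measure[OF finite_unit_measure finite_side_weights])
  then show ?thesis
    unfolding cone_measure_boundary by (rule finite_measure.finite_measure_distr[OF _ measurable_sides_boundary])
qed

lemma sets_cone_measure: "sets (cone_measure boundary) = sets (restrict_space borel boundary)"
  by (simp add: cone_measure_boundary)

lemma space_cone_measure: "space (cone_measure boundary) = boundary"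
  by (simp add: cone_measure_boundary space_restrict_space)

lemma integral_unit_measure:
  fixes h :: "real^2 \<Rightarrow> real"
  assumes "continuous_on UNIV h"
  shows "(LINT s|unit_measure. h ((1 - s) *\<^sub>R u + s *\<^sub>R v)) = seg_avg u v h"
proof -
  let ?f = "\<lambda>s. h ((1 - s) *\<^sub>R u + s *\<^sub>R v)"
  have "set_integrable lborel {0..1} ?f"
    by (intro borel_integrable_atLeastAtMost' continuous_seg_param assms)
  then have "set_integrable lborel {0..<1} ?f" by (rule set_integrable_subset) auto
  then have "(LINT s:{0..<1}|lborel. ?f s) = integral {0..<1} ?f"
    by (rule set_borel_integral_eq_integral)
  also have "\<dots> = integral {0..1} ?f"
  proof (rule integral_spike_set)
    have "{s \<in> {0..1} - {0..<1}. ?f s \<noteq> 0} \<subseteq> {1}" by auto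
    then show "negligible {s \<in> {0..1} - {0..<1}. ?f s \<noteq> 0}"
      using negligible_sing negligible_subset by blast
    have "{s \<in> {0..<1} - {0..1}. ?f s \<noteq> 0} = {}" by auto
    then show "negligible {s \<in> {0..<1} - {0..1}. ?f s \<noteq> 0}" by (simp only: negligible_empty)
  qed
  finally show ?thesis
    unfolding unit_measure_def seg_avg_def
    by (subst integral_restrict_space) (auto simp: set_lebesgue_integral_def)
qed

lemma integral_cone_measure:
  fixes h :: "real^2 \<Rightarrow> real"
  assumes h: "continuous_on UNIV h"
  shows "(LINT x|cone_measure boundary. h x) = hexint h / (2 * (a + b + 1))"
proof -
  let ?P = "side_weights \<Otimes>\<^sub>M unit_measure"
  interpret K: finite_measure side_weights by (rule finite_side_weights)
  interpret U: finite_measure unit_measure by (rule finite_unit_measure)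
  interpret KU: pair_sigma_finite side_weights unit_measure ..
  interpret P: finite_measure ?P
    by (rule finite_measure_pair_measure[OF finite_unit_measure finite_side_weights])
  have hm: "h \<in> borel_measurable borel" using h by (rule borel_measurable_continuous_onI)
  obtain B where B: "\<And>x. x \<in> boundary \<Longrightarrow> norm (h x) \<le> B"
    using compact_imp_bounded[OF compact_continuous_image[OF continuous_on_subset[OF h subset_UNIV] compact_boundary]]
    by (auto simp: bounded_iff)
  have integrable: "integrable ?P (\<lambda>z. h (case z of (i, s) \<Rightarrow> side_pt i s))"
  proof (rule P.integrable_const_bound[of _ B])
    show "(\<lambda>z. h (case z of (i, s) \<Rightarrow> side_pt i s)) \<in> borel_measurable ?P"
      by (rule measurable_compose[OF measurable_sides hm])
    have "norm (h (case z of (i, s) \<Rightarrow> side_pt i s)) \<le> B" if "z \<in> space ?P" for z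
      using B measurable_space[OF measurable_sides_boundary that] by (auto simp: space_restrict_space)
    then show "AE z in ?P. norm (h (case z of (i, s) \<Rightarrow> side_pt i s)) \<le> B" by (rule AE_I2)
  qed
  have "(LINT x|cone_measure boundary. h x) = (LINT z|?P. h (case z of (i, s) \<Rightarrow> side_pt i s))"
    unfolding cone_measure_boundary
    by (rule integral_distr[OF measurable_sides_boundary measurable_restrict_space1[OF hm]])
  also have "\<dots> = (LINT i|side_weights. LINT s|unit_measure. h (side_pt i s))"
    using KU.integral_fst'[OF integrable] by simp
  also have "\<dots> = (LINT i|side_weights. seg_avg (vt i) (vt (Suc i)) h)"
    by (simp add: side_pt_def integral_unit_measure[OF h])
  also have "\<dots> = (\<Sum>i<6. wt i / (2 * (a + b + 1)) * seg_avg (vt i) (vt (Suc i)) h)"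
    unfolding side_weights_def using wt_pos W_pos
    by (subst lebesgue_integral_point_measure_finite) (auto simp: less_imp_le)
  also have "\<dots> = hexint h / (2 * (a + b + 1))"
    by (simp add: hexint_def sum_divide_distrib)
  finally show ?thesis .
qed

lemma continuous_hexint:
  fixes h :: "real^2 \<Rightarrow> real^2 \<Rightarrow> real"
  assumes "continuous_on UNIV (\<lambda>(x, y). h x y)"
  shows "continuous_on UNIV (\<lambda>x. hexint (h x))"
  unfolding hexint_def by (intro continuous_on_sum continuous_on_mult continuous_on_const continuous_seg_avg assms)

theorem sprawl_boundary: "sprawl boundary = sprawl_value"
proof -
  let ?M = "cone_measure boundary"
  interpret M: finite_measure ?M by (rule finite_cone_measure)
  interpret MM: pair_sigma_finite ?M ?M ..
  interpret P: finite_measure "?M \<Otimes>\<^sub>M ?M"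
    by (rule finite_measure_pair_measure[OF finite_cone_measure finite_cone_measure])
  have id: "(\<lambda>x. x) \<in> borel_measurable ?M"
    unfolding measurable_cong_sets[OF sets_cone_measure refl] by (intro measurable_restrict_space1) simp
  have Nm: "N \<in> borel_measurable borel" by (intro borel_measurable_continuous_onI continuous_N)
  have cN2: "continuous_on UNIV (\<lambda>(x, y). N (x - y))"
    unfolding case_prod_unfold
    by (intro continuous_intros continuous_on_compose2[OF continuous_N[of UNIV]]) auto
  have cN: "continuous_on UNIV (\<lambda>y. N (x - y))" for x
    by (intro continuous_intros continuous_on_compose2[OF continuous_N[of UNIV]]) auto
  have integrable: "integrable (?M \<Otimes>\<^sub>M ?M) (\<lambda>z. N (fst z - snd z))"
  proof (rule P.integrable_const_bound[of _ 2])
    have "fst \<in> borel_measurable (?M \<Otimes>\<^sub>M ?M)" "snd \<in> borel_measurable (?M \<Otimes>\<^sub>M ?M)"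
      by (rule measurable_compose[OF measurable_fst id], rule measurable_compose[OF measurable_snd id])
    then show "(\<lambda>z. N (fst z - snd z)) \<in> borel_measurable (?M \<Otimes>\<^sub>M ?M)"
      by (intro measurable_compose[OF _ Nm] borel_measurable_diff)
    have "norm (N (fst z - snd z)) \<le> 2" if "z \<in> space (?M \<Otimes>\<^sub>M ?M)" for z
    proof -
      have "N (fst z) = 1" "N (snd z) = 1"
        using that unfolding space_pair_measure space_cone_measure by (auto simp: boundary_def)
      then show ?thesis using N_triangle[of "fst z" "- snd z"] by simp
    qed
    then show "AE z in ?M \<Otimes>\<^sub>M ?M. norm (N (fst z - snd z)) \<le> 2" by (rule AE_I2)
  qed
  have "sprawl boundary = (LINT z|(?M \<Otimes>\<^sub>M ?M). N (fst z - snd z))"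
    unfolding sprawl_def minkowski_norm_boundary ..
  also have "\<dots> = (LINT x|?M. LINT y|?M. N (x - y))"
    using MM.integral_fst'[OF integrable] by simp
  also have "\<dots> = (LINT x|?M. hexint (\<lambda>y. N (x - y)) / (2 * (a + b + 1)))"
    by (simp add: integral_cone_measure[OF cN])
  also have "\<dots> = (LINT x|?M. hexint (\<lambda>y. N (x - y))) / (2 * (a + b + 1))"
    by simp
  also have "\<dots> = sprawl_value"
    unfolding sprawl_value_def by (subst integral_cone_measure[OF continuous_hexint[OF cN2]]) (simp add: power2_eq_square)
  finally show ?thesis .
qed

end

section \<open>Normal form of a hexagon\<close>

text \<open>By Cramer's rule the coordinates of \<open>z\<close> are quotients of the given
  determinants, hence at most 1 in absolute value. Replacing \<open>p\<close> or \<open>q\<close> by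
  its negative makes them nonnegative, and exchanging the two puts them in order.\<close>

lemma normal_form:
  fixes p q z :: "real^2"
  assumes "cr p q \<noteq> 0" "\<bar>cr p z\<bar> \<le> \<bar>cr p q\<bar>" "\<bar>cr z q\<bar> \<le> \<bar>cr p q\<bar>"
  obtains p' q' a b where "{p', - p', q', - q'} = {p, - p, q, - q}" "cr p' q' \<noteq> 0"
    "0 \<le> a" "a \<le> b" "b \<le> 1" "z = b *\<^sub>R p' + a *\<^sub>R q'"
proof -
  define x y where "x = cr z q / cr p q" and "y = cr p z / cr p q"
  have z: "z = x *\<^sub>R p + y *\<^sub>R q" unfolding x_def y_def by (rule cr_expand[OF assms(1)])
  have le: "\<bar>x\<bar> \<le> 1" "\<bar>y\<bar> \<le> 1" using assms by (auto simp: x_def y_def abs_divide)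
  define p1 q1 where "p1 = (if 0 \<le> x then p else - p)" and "q1 = (if 0 \<le> y then q else - q)"
  have z1: "z = \<bar>x\<bar> *\<^sub>R p1 + \<bar>y\<bar> *\<^sub>R q1" unfolding z p1_def q1_def by auto
  have s: "{p1, - p1, q1, - q1} = {p, - p, q, - q}" unfolding p1_def q1_def by auto
  have c: "cr p1 q1 \<noteq> 0" using assms(1) by (auto simp: p1_def q1_def cr_simps)
  show thesis
  proof (cases "\<bar>y\<bar> \<le> \<bar>x\<bar>")
    case True
    then show thesis using that[of p1 q1 "\<bar>y\<bar>" "\<bar>x\<bar>"] s c z1 le by simp
  next
    case False
    have "{q1, - q1, p1, - p1} = {p, - p, q, - q}" using s by auto
    moreover have "cr q1 p1 \<noteq> 0" using c cr_commute[of q1 p1] by simp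
    moreover have "z = \<bar>y\<bar> *\<^sub>R q1 + \<bar>x\<bar> *\<^sub>R p1" using z1 by (simp add: add.commute)
    ultimately show thesis using that[of q1 p1 "\<bar>x\<bar>" "\<bar>y\<bar>"] le False by simp
  qed
qed

text \<open>If \<open>a + b \<le> 1\<close>, then \<open>z\<close> lies in the parallelogram with
  vertices \<open>p\<close>, \<open>q\<close>, \<open>- p\<close>, \<open>- q\<close> and does not
  change the hull. The same parallelogram arises from the frame whose third vertex is the midpoint
  of \<open>p\<close> and \<open>q\<close>.\<close>

lemma hexagon_frame_cases:
  fixes p q z :: "real^2"
  assumes "cr p q \<noteq> 0" "0 \<le> a" "a \<le> b" "b \<le> 1" "z = b *\<^sub>R p + a *\<^sub>R q"
  shows "hexagon_frame p q a b
      \<and> convex hull {p, - p, z, - z, q, - q} = hexagon_frame.body p q a b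
    \<or> hexagon_frame p q (1/2) (1/2)
      \<and> convex hull {p, - p, z, - z, q, - q} = hexagon_frame.body p q (1/2) (1/2)"
proof (cases "1 < a + b")
  case True
  then interpret hexagon_frame p q a b using assms by unfold_locales auto
  have "w = z" using assms(5) by (simp add: w_def)
  then show ?thesis using True hexagon_frame_axioms hull_eq_body by auto
next
  case False
  interpret hexagon_frame p q "1/2" "1/2" using assms(1) by unfold_locales auto
  have "N p = 1" "N q = 1" using N_vt[of 0] N_vt[of 2] by simp_all
  then have "N z \<le> a + b"
    using N_triangle[of "b *\<^sub>R p" "a *\<^sub>R q"] assms by (simp add: N_scaleR)
  then have z: "z \<in> body" "- z \<in> body" using False by (auto simp: body_def)
  have sub: "{p, - p, q, - q} \<subseteq> body"
    unfolding hull_eq_body[symmetric] using hull_subset[of "{p, - p, w, - w, q, - q}" convex] by blast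
  let ?C = "convex hull {p, - p, z, - z, q, - q}"
  have inC: "{p, - p, q, - q} \<subseteq> ?C" using hull_subset[of "{p, - p, z, - z, q, - q}" convex] by blast
  have "(1/2) *\<^sub>R p + (1/2) *\<^sub>R q \<in> ?C" "(1/2) *\<^sub>R (- p) + (1/2) *\<^sub>R (- q) \<in> ?C"
    using inC by (intro convexD[OF convex_convex_hull]; simp)+
  then have "w \<in> ?C" "- w \<in> ?C" by (simp_all add: w_def)
  then have "body \<subseteq> ?C"
    unfolding hull_eq_body[symmetric] using inC by (intro hull_minimal convex_convex_hull) auto
  moreover have "?C \<subseteq> body" using sub z by (intro hull_minimal convex_body) auto
  ultimately show ?thesis using False hexagon_frame_axioms by auto
qed

lemma interior_line_empty:
  fixes d :: "real^2"
  assumes "Q \<subseteq> {z. cr d z = 0}" "interior Q \<noteq> {}"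
  shows "d = 0"
proof (rule ccontr)
  assume d: "d \<noteq> 0"
  \<comment> \<open>A quarter turn of \<open>d\<close>: \<open>cr d u\<close> is the squared length
    of \<open>d\<close>, so moving in the direction \<open>u\<close> leaves the line.\<close>
  define u :: "real^2" where "u = vector [- d$2, d$1]"
  have cu: "cr d u = d$1 * d$1 + d$2 * d$2" by (simp add: cr_def u_def)
  have "cr d u \<noteq> 0"
  proof
    assume "cr d u = 0"
    then have "d$1 = 0" "d$2 = 0" unfolding cu by (auto simp: add_nonneg_eq_0_iff)
    then show False using d by (simp add: vec_eq_iff forall_2)
  qed
  then have "u \<noteq> 0" by (auto simp: cr_simps)
  obtain x where "x \<in> interior Q" using assms(2) by blast
  then obtain e where e: "e > 0" "ball x e \<subseteq> Q" by (meson mem_interior)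
  define \<delta> where "\<delta> = e / (2 * norm u)"
  have "\<delta> > 0" using e \<open>u \<noteq> 0\<close> by (simp add: \<delta>_def)
  have "x \<in> Q" "x + \<delta> *\<^sub>R u \<in> Q"
    using e \<open>u \<noteq> 0\<close> by (auto simp: \<delta>_def dist_norm intro!: subsetD[OF e(2)])
  then have "cr d x = 0" "cr d (x + \<delta> *\<^sub>R u) = 0" using assms(1) by auto
  then show False using \<open>\<delta> > 0\<close> \<open>cr d u \<noteq> 0\<close> by (simp add: cr_simps cr_scaleR)
qed

lemma hull_independent:
  fixes v1 v2 v3 :: "real^2"
  assumes "interior (convex hull {v1, - v1, v2, - v2, v3, - v3}) \<noteq> {}"
  shows "cr v1 v2 \<noteq> 0 \<or> cr v1 v3 \<noteq> 0 \<or> cr v2 v3 \<noteq> 0"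
proof (rule ccontr)
  assume "\<not> ?thesis"
  then have z: "cr v1 v2 = 0" "cr v1 v3 = 0" "cr v2 v3 = 0" by auto
  have cv: "convex {z. cr d z = 0}" for d :: "real^2"
    by (auto simp: convex_def cr_simps cr_scaleR)
  have zero: "d = 0" if "cr d v1 = 0" "cr d v2 = 0" "cr d v3 = 0" for d
  proof (rule interior_line_empty[OF _ assms])
    show "convex hull {v1, - v1, v2, - v2, v3, - v3} \<subseteq> {z. cr d z = 0}"
      using that by (intro hull_minimal cv) (auto simp: cr_simps)
  qed
  have "v1 = 0" "v2 = 0" "v3 = 0"
    using z cr_commute[of v2 v1] cr_commute[of v3 v1] cr_commute[of v3 v2]
    by (intro zero; simp add: cr_simps)+
  \<comment> \<open>Once all three points vanish, every vector satisfies the hypotheses of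
    \<open>zero\<close>, in particular a nonzero one.\<close>
  then have "(axis 1 1 :: real^2) = 0" by (intro zero) (auto simp: cr_simps)
  then show False by simp
qed

lemma hexagon_frame_of_hull:
  fixes v1 v2 v3 :: "real^2"
  assumes "interior (convex hull {v1, - v1, v2, - v2, v3, - v3}) \<noteq> {}"
  obtains p q a b where "hexagon_frame p q a b"
    "convex hull {v1, - v1, v2, - v2, v3, - v3} = hexagon_frame.body p q a b"
proof -
  note result = that
  have *: thesis if c: "cr p q \<noteq> 0" "\<bar>cr p z\<bar> \<le> \<bar>cr p q\<bar>" "\<bar>cr z q\<bar> \<le> \<bar>cr p q\<bar>"
    and s: "{v1, - v1, v2, - v2, v3, - v3} = {p, - p, q, - q, z, - z}" for p q z
  proof -
    obtain p' q' a b where f: "{p', - p', q', - q'} = {p, - p, q, - q}" "cr p' q' \<noteq> 0"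
      "0 \<le> a" "a \<le> b" "b \<le> 1" "z = b *\<^sub>R p' + a *\<^sub>R q'"
      using normal_form[OF c] by metis
    have "{v1, - v1, v2, - v2, v3, - v3} = {p', - p', q', - q'} \<union> {z, - z}"
      unfolding s f(1) by auto
    then have s': "{v1, - v1, v2, - v2, v3, - v3} = {p', - p', z, - z, q', - q'}" by auto
    show thesis unfolding s' using hexagon_frame_cases[OF f(2-6)] result[unfolded s'] by blast
  qed
  have cm: "\<bar>cr x y\<bar> = \<bar>cr y x\<bar>" for x y :: "real^2" using cr_commute[of x y] by simp
  consider "\<bar>cr v1 v3\<bar> \<le> \<bar>cr v1 v2\<bar>" "\<bar>cr v2 v3\<bar> \<le> \<bar>cr v1 v2\<bar>"
    | "\<bar>cr v1 v2\<bar> \<le> \<bar>cr v1 v3\<bar>" "\<bar>cr v2 v3\<bar> \<le> \<bar>cr v1 v3\<bar>"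
    | "\<bar>cr v1 v2\<bar> \<le> \<bar>cr v2 v3\<bar>" "\<bar>cr v1 v3\<bar> \<le> \<bar>cr v2 v3\<bar>"
    by linarith
  then show thesis
  proof cases
    case 1
    then have "cr v1 v2 \<noteq> 0" using hull_independent[OF assms] by auto
    from *[OF this, of v3] 1 cm show thesis by auto
  next
    case 2
    then have "cr v1 v3 \<noteq> 0" using hull_independent[OF assms] by auto
    from *[OF this, of v2] 2 cm show thesis by auto
  next
    case 3
    then have "cr v2 v3 \<noteq> 0" using hull_independent[OF assms] by auto
    from *[OF this, of v1] 3 cm show thesis by auto
  qed
qed

lemma hexagon_sprawl_values: "{sprawl H | H. hexagon H} = {23/18 .. 4/3}"
proof (intro set_eqI iffI)
  fix e assume "e \<in> {sprawl H | H. hexagon H}"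
  then obtain v1 v2 v3 :: "real^2" where Q: "symmetric_convex_body (convex hull {v1, - v1, v2, - v2, v3, - v3})"
    and e: "e = sprawl (frontier (convex hull {v1, - v1, v2, - v2, v3, - v3}))"
    unfolding hexagon_def by blast
  then obtain p q a b where f: "hexagon_frame p q a b"
    and "convex hull {v1, - v1, v2, - v2, v3, - v3} = hexagon_frame.body p q a b"
    using hexagon_frame_of_hull[of v1 v2 v3] unfolding symmetric_convex_body_def by metis
  then interpret hexagon_frame p q a b by simp
  have "e = sprawl_value"
    unfolding e \<open>convex hull _ = _\<close> frontier_body by (rule sprawl_boundary)
  then show "e \<in> {23/18 .. 4/3}" using sprawl_value_bounds by simp
next
  fix e :: real assume e: "e \<in> {23/18 .. 4/3}"
  \<comment> \<open>The numerator of \<open>sprawl_value_eq\<close> on the diagonal a = b = t. It is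
    left unsimplified so that it matches that equation term by term at the end.\<close>
  define P where "P t = 6*t^2*t - 6*t*t^2 + 2*t^3 + 6*t^2 - 2*t - 4*t^3*t + 4*t^2*t^2 - 4*t^4 - 2 - 2*t^3
      + 2*t^2 + 4*t*t^3 + 2*t" for t :: real
  define \<phi> where "\<phi> t = 4/3 - P t / (12 * t * (t + t + 1)\<^sup>2)" for t
  have "\<exists>t. 1/2 \<le> t \<and> t \<le> 1 \<and> \<phi> t = e"
  proof (rule IVT2')
    show "\<phi> 1 \<le> e" "e \<le> \<phi> (1/2)" using e by (simp_all add: \<phi>_def P_def power_divide)
    show "continuous_on {1/2..1} \<phi>"
      unfolding \<phi>_def P_def by (intro continuous_intros) auto
  qed simp
  then obtain t where t: "1/2 \<le> t" "t \<le> 1" "\<phi> t = e" by blast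
  interpret hexagon_frame "axis 1 1" "axis 2 1" t t
    using t by unfold_locales (auto simp: cr_def axis_def)
  have "hexagon boundary"
    unfolding hexagon_def frontier_body[symmetric] hull_eq_body[symmetric]
    using symmetric_convex_body_body hull_eq_body by metis
  moreover have "sprawl boundary = e"
    unfolding sprawl_boundary sprawl_value_eq t(3)[symmetric] \<phi>_def P_def ..
  ultimately show "e \<in> {sprawl H | H. hexagon H}" by blast
qed

section \<open>Lattice indices\<close>

definition lat :: "int^2 \<Rightarrow> int^2 \<Rightarrow> (int^2) set" where
  "lat u v = {m *s u + k *s v | m k. True}"

lemma latI: "m *s u + k *s v \<in> lat u v" by (auto simp: lat_def)

lemma lat_zero: "0 \<in> lat u v"
  using latI[of 0 u 0 v] by simp

lemma lat_add: "x \<in> lat u v \<Longrightarrow> y \<in> lat u v \<Longrightarrow> x + y \<in> lat u v"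
proof -
  assume "x \<in> lat u v" "y \<in> lat u v"
  then obtain m k m' k' where "x = m *s u + k *s v" "y = m' *s u + k' *s v" by (auto simp: lat_def)
  then have "x + y = (m + m') *s u + (k + k') *s v" by (simp add: vec_eq_iff algebra_simps)
  then show ?thesis by (simp only: latI)
qed

lemma lat_uminus: "x \<in> lat u v \<Longrightarrow> - x \<in> lat u v"
proof -
  assume "x \<in> lat u v"
  then obtain m k where "x = m *s u + k *s v" by (auto simp: lat_def)
  then have "- x = (- m) *s u + (- k) *s v" by (simp add: vec_eq_iff algebra_simps)
  then show ?thesis by (simp only: latI)
qed

lemma lat_diff: "x \<in> lat u v \<Longrightarrow> y \<in> lat u v \<Longrightarrow> x - y \<in> lat u v"
  using lat_add[of x u v "- y"] lat_uminus[of y u v] by simp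

lemma lat_subset: "u' \<in> lat u v \<Longrightarrow> v' \<in> lat u v \<Longrightarrow> lat u' v' \<subseteq> lat u v"
proof
  fix x assume "u' \<in> lat u v" "v' \<in> lat u v" "x \<in> lat u' v'"
  then obtain a b c d m k where "u' = a *s u + b *s v" "v' = c *s u + d *s v" "x = m *s u' + k *s v'"
    by (auto simp: lat_def)
  then have "x = (m * a + k * c) *s u + (m * b + k * d) *s v" by (simp add: vec_eq_iff algebra_simps)
  then show "x \<in> lat u v" by (simp only: latI)
qed

lemma lat_eqI:
  "u' \<in> lat u v \<Longrightarrow> v' \<in> lat u v \<Longrightarrow> u \<in> lat u' v' \<Longrightarrow> v \<in> lat u' v' \<Longrightarrow> lat u' v' = lat u v"
  by (simp add: lat_subset subset_antisym)

lemma lat_base: "u \<in> lat u v" "v \<in> lat u v"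
  using latI[of 1 u 0 v] latI[of 0 u 1 v] by simp_all

lemma lat_commute: "lat u v = lat v u"
  by (intro lat_eqI lat_base)

lemma lat_minus: "lat (- u) v = lat u v" "lat u (- v) = lat u v"
  using lat_uminus[OF lat_base(1)] lat_uminus[OF lat_base(2)]
  by (intro lat_eqI lat_base; metis minus_minus lat_base lat_uminus)+

definition coset :: "int^2 \<Rightarrow> int^2 \<Rightarrow> int^2 \<Rightarrow> (int^2) set" where
  "coset u v x = {y. y - x \<in> lat u v}"

lemma coset_eq_iff: "coset u v x = coset u v y \<longleftrightarrow> x - y \<in> lat u v"
proof
  assume "coset u v x = coset u v y"
  moreover have "x \<in> coset u v x" by (simp add: coset_def lat_zero)
  ultimately show "x - y \<in> lat u v" by (simp add: coset_def)
next
  assume *: "x - y \<in> lat u v"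
  have "z - x \<in> lat u v \<longleftrightarrow> z - y \<in> lat u v" for z
    using lat_add[OF _ *, of "z - x"] lat_diff[OF _ *, of "z - y"] by auto
  then show "coset u v x = coset u v y" by (simp add: coset_def)
qed

text \<open>Its value is the absolute value of \<open>cr u v\<close>. The argument uses positivity
  and the proportions between indices, which come from
  \<open>lattice_index_combination\<close>.\<close>

definition lattice_index :: "int^2 \<Rightarrow> int^2 \<Rightarrow> nat" where
  "lattice_index u v = card (range (coset u v))"

definition transversal :: "int^2 \<Rightarrow> int^2 \<Rightarrow> (int^2) set \<Rightarrow> bool" where
  "transversal u v R \<longleftrightarrow> (\<forall>x. \<exists>!r. r \<in> R \<and> x - r \<in> lat u v)"

lemma transversal_eq:
  assumes "transversal u v R" "r \<in> R" "r' \<in> R" "r - r' \<in> lat u v"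
  shows "r = r'"
  using assms lat_zero[of u v] unfolding transversal_def by (metis diff_self)

lemma transversal_bij: "transversal u v R \<Longrightarrow> bij_betw (coset u v) R (range (coset u v))"
  unfolding bij_betw_def
proof
  assume R: "transversal u v R"
  show "inj_on (coset u v) R"
    using transversal_eq[OF R] by (auto intro!: inj_onI simp: coset_eq_iff)
  have "coset u v x \<in> coset u v ` R" for x
  proof -
    obtain r where "r \<in> R" "x - r \<in> lat u v" using R unfolding transversal_def by metis
    then show ?thesis using coset_eq_iff[of u v x r] by auto
  qed
  then show "coset u v ` R = range (coset u v)" by auto
qed

lemma card_transversal: "transversal u v R \<Longrightarrow> card R = lattice_index u v"
  using bij_betw_same_card[OF transversal_bij] by (simp add: lattice_index_def)

text \<open>Cramer's rule over the integers puts \<open>cr u v *s x\<close> into the lattice for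
  every \<open>x\<close>. Each coset therefore has a representative with coordinates reduced modulo
  \<bar>cr u v\<bar>.\<close>

lemma finite_cosets:
  assumes "cr u v \<noteq> 0"
  shows "finite (range (coset u v))"
proof -
  define c where "c = \<bar>cr u v\<bar>"
  have c: "c > 0" using assms by (simp add: c_def)
  have mult: "c *s x \<in> lat u v" for x
  proof -
    have "cr u v *s x = cr x v *s u + cr u x *s v"
      by (simp add: vec_eq_iff forall_2 cr_def algebra_simps)
    then have "cr u v *s x \<in> lat u v" by (simp only: latI)
    moreover have "c *s x = cr u v *s x \<or> c *s x = - (cr u v *s x)"
      by (auto simp: c_def abs_if vec_eq_iff)
    ultimately show ?thesis using lat_uminus by auto
  qed
  let ?B = "(\<lambda>(i, j). vector [i, j] :: int^2) ` ({0..<c} \<times> {0..<c})"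
  have "coset u v x \<in> coset u v ` ?B" for x
  proof -
    define y :: "int^2" where "y = vector [x$1 mod c, x$2 mod c]"
    have "x - y = c *s (vector [x$1 div c, x$2 div c])"
      by (simp add: vec_eq_iff forall_2 y_def minus_mod_eq_mult_div)
    then have "coset u v x = coset u v y" by (simp only: coset_eq_iff mult)
    moreover have "y \<in> ?B" using c by (auto simp: y_def intro!: image_eqI[of _ _ "(x$1 mod c, x$2 mod c)"])
    ultimately show ?thesis by blast
  qed
  then have "range (coset u v) \<subseteq> coset u v ` ?B" by blast
  then show ?thesis by (rule finite_subset) simp
qed

lemma finite_transversal: "cr u v \<noteq> 0 \<Longrightarrow> transversal u v R \<Longrightarrow> finite R"
  using bij_betw_finite[OF transversal_bij] finite_cosets by blast

text \<open>Representatives may be required to have any property \<open>P\<close> that occurs in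
  every coset; later \<open>P\<close> says that the word length grows regularly from there
  on.\<close>

lemma transversal_exists:
  assumes "\<And>x. \<exists>r. P r \<and> x - r \<in> lat u v"
  obtains R where "transversal u v R" "\<And>r. r \<in> R \<Longrightarrow> P r"
proof
  let ?f = "\<lambda>C. SOME r. P r \<and> coset u v r = C"
  let ?R = "?f ` range (coset u v)"
  have f: "P (?f (coset u v x)) \<and> coset u v (?f (coset u v x)) = coset u v x" for x
  proof (rule someI_ex)
    obtain r where "P r" "x - r \<in> lat u v" using assms by blast
    then show "\<exists>r. P r \<and> coset u v r = coset u v x" using coset_eq_iff[of u v x r] by auto
  qed
  show "transversal u v ?R"
    unfolding transversal_def
  proof
    fix x
    have "\<exists>!r. r \<in> ?R \<and> coset u v x = coset u v r"
    proof (rule ex1I)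
      show "?f (coset u v x) \<in> ?R \<and> coset u v x = coset u v (?f (coset u v x))" using f[of x] by simp
      fix r assume r: "r \<in> ?R \<and> coset u v x = coset u v r"
      then obtain y where y: "r = ?f (coset u v y)" by blast
      then have "coset u v r = coset u v y" using f[of y] by simp
      then show "r = ?f (coset u v x)" using r y by simp
    qed
    then show "\<exists>!r. r \<in> ?R \<and> x - r \<in> lat u v" by (simp only: coset_eq_iff)
  qed
  fix r assume "r \<in> ?R"
  then show "P r" using f by auto
qed

lemma lattice_index_pos:
  assumes "cr u v \<noteq> 0"
  shows "0 < lattice_index u v"
  unfolding lattice_index_def using finite_cosets[OF assms] by (simp add: card_gt_0_iff)

lemma lat_independent:
  assumes "cr u v \<noteq> 0" "m *s u + k *s v = m' *s u + k' *s (v :: int^2)"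
  shows "m = m'" "k = k'"
proof -
  have "cr (m *s u + k *s v) v = cr (m' *s u + k' *s v) v" "cr u (m *s u + k *s v) = cr u (m' *s u + k' *s v)"
    using assms(2) by simp_all
  then have "(m - m') * cr u v = 0" "(k - k') * cr u v = 0" by (simp_all add: cr_def algebra_simps)
  then show "m = m'" "k = k'" using assms(1) by simp_all
qed

text \<open>A transversal of the finer lattice consists of the points \<open>r + int j *s v\<close>
  with \<open>r\<close> in a transversal of the coarser one and \<open>j < n\<close>.\<close>

lemma lattice_index_scale:
  assumes cr: "cr u v \<noteq> 0" and n: "0 < n"
  shows "lattice_index u (int n *s v) = n * lattice_index u v"
proof -
  obtain R where R: "transversal u v R"
  proof (rule transversal_exists[of "\<lambda>_. True" u v])
    show "\<exists>r. True \<and> x - r \<in> lat u v" for x using lat_zero[of u v] by (intro exI[of _ x]) simp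
  qed
  let ?g = "\<lambda>(r, j). r + int j *s v"
  have sub: "lat u (int n *s v) \<subseteq> lat u v"
    by (intro lat_subset lat_base) (use latI[of 0 u "int n" v] in simp)
  have key: "r = r' \<and> j = j'"
    if h: "r \<in> R" "r' \<in> R" "j < n" "j' < n" "(r + int j *s v) - (r' + int j' *s v) \<in> lat u (int n *s v)"
    for r r' j j'
  proof -
    have "r - r' = ((r + int j *s v) - (r' + int j' *s v)) + (0 *s u + (int j' - int j) *s v)"
      by (simp add: vec_eq_iff algebra_simps)
    moreover have "\<dots> \<in> lat u v" using h(5) sub by (intro lat_add latI) auto
    ultimately have r: "r = r'" using transversal_eq[OF R h(1,2)] by simp
    obtain m k where "(r + int j *s v) - (r' + int j' *s v) = m *s u + k *s (int n *s v)"
      using h(5) by (auto simp: lat_def)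
    then have "0 *s u + (int j - int j') *s v = m *s u + (k * int n) *s v"
      unfolding r by (simp add: vec_eq_iff algebra_simps)
    then have jj: "int j - int j' = k * int n" by (rule lat_independent(2)[OF cr])
    have "\<bar>int j - int j'\<bar> < int n" using h(3,4) by linarith
    then have "k = 0" unfolding jj abs_mult using n
      by (metis abs_of_nat linorder_not_less mult_le_cancel_right1 mult_eq_0_iff of_nat_0_le_iff zabs_less_one_iff)
    then show ?thesis using r jj by simp
  qed
  have inj: "inj_on ?g (R \<times> {..<n})"
    by (rule inj_onI) (use key lat_zero in auto)
  have "transversal u (int n *s v) (?g ` (R \<times> {..<n}))"
    unfolding transversal_def
  proof
    fix x
    obtain r m k where r: "r \<in> R" and x: "x - r = m *s u + k *s v"
      using R unfolding transversal_def lat_def by blast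
    define j where "j = nat (k mod int n)"
    have j: "int j = k mod int n" "j < n" using n by (auto simp: j_def nat_less_iff)
    have "k = int n * (k div int n) + int j" by (simp add: j)
    then have kk: "k *s v = (k div int n) *s (int n *s v) + int j *s v"
      by (metis (no_types, lifting) mult.commute vector_sadd_rdistrib vector_smult_assoc)
    have "x - (r + int j *s v) = (x - r) - int j *s v" by simp
    also have "\<dots> = m *s u + (k div int n) *s (int n *s v)" unfolding x kk by simp
    finally have mem: "x - (r + int j *s v) \<in> lat u (int n *s v)" by (simp only: latI)
    show "\<exists>!y. y \<in> ?g ` (R \<times> {..<n}) \<and> x - y \<in> lat u (int n *s v)"
    proof (rule ex1I[of _ "r + int j *s v"])
      show "r + int j *s v \<in> ?g ` (R \<times> {..<n}) \<and> x - (r + int j *s v) \<in> lat u (int n *s v)"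
        using r j(2) mem by (intro conjI image_eqI[of _ _ "(r, j)"]) auto
      fix y assume "y \<in> ?g ` (R \<times> {..<n}) \<and> x - y \<in> lat u (int n *s v)"
      then obtain r' j' where y: "r' \<in> R" "j' < n" "y = r' + int j' *s v"
        "x - y \<in> lat u (int n *s v)" by auto
      have "(x - (r + int j *s v)) - (x - y) \<in> lat u (int n *s v)" using mem y(4) by (rule lat_diff)
      moreover have "(x - (r + int j *s v)) - (x - y) = (r' + int j' *s v) - (r + int j *s v)"
        unfolding y(3) by (simp add: algebra_simps)
      ultimately have "(r' + int j' *s v) - (r + int j *s v) \<in> lat u (int n *s v)" by metis
      from key[OF y(1) r y(2) j(2) this] show "y = r + int j *s v" by (simp add: y(3))
    qed
  qed
  then have "lattice_index u (int n *s v) = card (?g ` (R \<times> {..<n}))" by (rule card_transversal[symmetric])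
  also have "\<dots> = n * lattice_index u v"
    using card_image[OF inj] card_transversal[OF R] by (simp add: card_cartesian_product)
  finally show ?thesis .
qed

lemma lattice_index_cong: "lat u v = lat u' v' \<Longrightarrow> lattice_index u v = lattice_index u' v'"
  by (simp add: lattice_index_def coset_def[abs_def])

text \<open>Modulo multiples of \<open>p\<close>, the vectors \<open>int c *s w\<close> and
  \<open>int k *s q\<close> coincide, so with \<open>p\<close> they span the same lattice; its index
  is computed in two ways.\<close>

lemma lattice_index_combination:
  assumes "cr p q \<noteq> 0" "cr p w \<noteq> 0" "0 < c" "0 < k" "int c *s w = m *s p + int k *s q"
  shows "c * lattice_index p w = k * lattice_index p q"
proof -
  have "lat p (int c *s w) = lat p (int k *s q)"
  proof (rule lat_eqI)
    have "int c *s w = m *s p + 1 *s (int k *s q)" using assms(5) by simp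
    then show "int c *s w \<in> lat p (int k *s q)" by (simp only: latI)
    have "int k *s q = (- m) *s p + 1 *s (int c *s w)" using assms(5) by (simp add: vec_eq_iff)
    then show "int k *s q \<in> lat p (int c *s w)" by (simp only: latI)
  qed (rule lat_base)+
  then have "lattice_index p (int c *s w) = lattice_index p (int k *s q)" by (rule lattice_index_cong)
  then show ?thesis using lattice_index_scale assms(1-4) by simp
qed

section \<open>Word lengths and the norm\<close>

definition emb :: "int^2 \<Rightarrow> real^2" where
  "emb x = (\<chi> i. real_of_int (x$i))"

lemma emb_simps [simp]:
  "emb (x + y) = emb x + emb y" "emb (x - y) = emb x - emb y" "emb (- x) = - emb x" "emb 0 = 0"
  "emb (m *s x) = real_of_int m *\<^sub>R emb x"
  by (simp_all add: emb_def vec_eq_iff)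

lemma inj_emb: "emb x = emb y \<longleftrightarrow> x = y"
  by (simp add: emb_def vec_eq_iff)

lemma cr_emb: "cr (emb x) (emb y) = real_of_int (cr x y)"
  by (simp add: cr_def emb_def)

locale generated =
  fixes S :: "(int^2) set"
  assumes sym: "symmetric_set S" and gen: "generating_set S"
begin

abbreviation "wl \<equiv> word_length S"

lemma word_length_witness: "\<exists>w\<in>lists S. length w = wl g \<and> sum_list w = g"
proof -
  obtain w where "w \<in> lists S" "sum_list w = g" using gen unfolding generating_set_def by blast
  then have "\<exists>n. \<exists>w\<in>lists S. length w = n \<and> sum_list w = g" by blast
  then show ?thesis unfolding word_length_def by (rule LeastI_ex)
qed

lemma word_length_le: "w \<in> lists S \<Longrightarrow> wl (sum_list w) \<le> length w"
  unfolding word_length_def by (rule Least_le) blast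

lemma word_length_add: "wl (x + y) \<le> wl x + wl y"
proof -
  obtain w w' where "w \<in> lists S" "length w = wl x" "sum_list w = x"
    "w' \<in> lists S" "length w' = wl y" "sum_list w' = y"
    using word_length_witness by metis
  then show ?thesis using word_length_le[of "w @ w'"] by simp
qed

lemma word_length_gen: "s \<in> S \<Longrightarrow> wl s \<le> 1"
  using word_length_le[of "[s]"] by simp

lemma S_uminus: "s \<in> S \<Longrightarrow> - s \<in> S"
  using sym unfolding symmetric_set_def by blast

lemma word_length_add_nat:
  assumes "s \<in> S"
  shows "wl (x + int m *s s) \<le> wl x + m"
proof (induction m)
  case (Suc m)
  have "x + int (Suc m) *s s = (x + int m *s s) + s" by (simp add: vec_eq_iff algebra_simps)
  then have "wl (x + int (Suc m) *s s) \<le> wl (x + int m *s s) + wl s" by (metis word_length_add)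
  then show ?case using Suc word_length_gen[OF assms] by linarith
qed simp

lemma word_length_add_int:
  assumes "s \<in> S"
  shows "int (wl (x + m *s s)) \<le> int (wl x) + \<bar>m\<bar>"
proof (cases "0 \<le> m")
  case True
  then show ?thesis using word_length_add_nat[OF assms, of x "nat m"] by simp
next
  case False
  have "m *s s = int (nat (- m)) *s (- s)" using False by (simp add: vec_eq_iff)
  then show ?thesis using word_length_add_nat[OF S_uminus[OF assms], of x "nat (- m)"] False by simp
qed

end

text \<open>The corners of the sectors are generators, hence lattice points. Hexagons use six
  sectors and parallelograms four, so the index set is left open. Sectors are disjoint only in their
  interiors; neighbours share a ray.\<close>

locale polygonal = generated S for S +
  fixes N :: "real^2 \<Rightarrow> real" and I :: "nat set" and u v :: "nat \<Rightarrow> int^2"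
  assumes N_tri: "\<And>x y. N (x + y) \<le> N x + N y"
    and N_neg: "\<And>x. N (- x) = N x"
    and N_hom: "\<And>c x. N (c *\<^sub>R x) = \<bar>c\<bar> * N x"
    and N_le: "\<exists>C>0. \<forall>z. N z \<le> C * norm z"
    and N_S: "\<And>s. s \<in> S \<Longrightarrow> N (emb s) \<le> 1"
    and finite_I: "finite I"
    and u_S: "\<And>i. i \<in> I \<Longrightarrow> u i \<in> S" and v_S: "\<And>i. i \<in> I \<Longrightarrow> v i \<in> S"
    and uv_cr: "\<And>i. i \<in> I \<Longrightarrow> cr (u i) (v i) \<noteq> 0"
    and N_sector: "\<And>i \<sigma> \<tau>. i \<in> I \<Longrightarrow> 0 \<le> \<sigma> \<Longrightarrow> 0 \<le> \<tau> \<Longrightarrow>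
      N (\<sigma> *\<^sub>R emb (u i) + \<tau> *\<^sub>R emb (v i)) = \<sigma> + \<tau>"
    and sector_cover: "\<And>z. \<exists>i\<in>I. \<exists>\<sigma> \<tau>. 0 \<le> \<sigma> \<and> 0 \<le> \<tau> \<and> z = \<sigma> *\<^sub>R emb (u i) + \<tau> *\<^sub>R emb (v i)"
    and sector_disjoint: "\<And>i j \<sigma> \<tau> \<sigma>' \<tau>'. i \<in> I \<Longrightarrow> j \<in> I \<Longrightarrow> 0 < \<sigma> \<Longrightarrow> 0 < \<tau> \<Longrightarrow> 0 < \<sigma>' \<Longrightarrow> 0 < \<tau>' \<Longrightarrow>
      \<sigma> *\<^sub>R emb (u i) + \<tau> *\<^sub>R emb (v i) = \<sigma>' *\<^sub>R emb (u j) + \<tau>' *\<^sub>R emb (v j) \<Longrightarrow> i = j"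
begin

definition "cx i z = cr z (emb (v i)) / cr (emb (u i)) (emb (v i))"
definition "cy i z = cr (emb (u i)) z / cr (emb (u i)) (emb (v i))"

lemma cr_emb_nz: "i \<in> I \<Longrightarrow> cr (emb (u i)) (emb (v i)) \<noteq> 0"
  using uv_cr by (simp add: cr_emb)

lemma sector_coords: "i \<in> I \<Longrightarrow> z = cx i z *\<^sub>R emb (u i) + cy i z *\<^sub>R emb (v i)"
  unfolding cx_def cy_def by (rule cr_expand[OF cr_emb_nz])

lemma cxy_simps:
  assumes "i \<in> I"
  shows "cx i (x + y) = cx i x + cx i y" "cy i (x + y) = cy i x + cy i y"
    "cx i (c *\<^sub>R x) = c * cx i x" "cy i (c *\<^sub>R x) = c * cy i x"
    "cx i (emb (u i)) = 1" "cx i (emb (v i)) = 0" "cy i (emb (u i)) = 0" "cy i (emb (v i)) = 1"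
  using cr_emb_nz[OF assms] by (auto simp: cx_def cy_def cr_simps cr_scaleR add_divide_distrib)

lemma cxy_lattice:
  assumes "i \<in> I"
  shows "cx i (emb (r + m *s u i + k *s v i)) = cx i (emb r) + of_int m"
    "cy i (emb (r + m *s u i + k *s v i)) = cy i (emb r) + of_int k"
  by (simp_all add: cxy_simps[OF assms])

text \<open>The functional \<open>cx i + cy i\<close> agrees with \<open>N\<close> on sector
  \<open>i\<close>. Adding a large vector of that sector moves \<open>z\<close> into it without
  changing the difference of the two sides, and the triangle inequality compares the norms.\<close>

lemma cxy_le_N:
  assumes i: "i \<in> I"
  shows "cx i z + cy i z \<le> N z"
proof -
  define M where "M = \<bar>cx i z\<bar> + \<bar>cy i z\<bar>"
  let ?e = "M *\<^sub>R emb (u i) + M *\<^sub>R emb (v i)"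
  have "z + ?e = (cx i z + M) *\<^sub>R emb (u i) + (cy i z + M) *\<^sub>R emb (v i)"
    using sector_coords[OF i, of z] by (simp add: algebra_simps)
  then have "N (z + ?e) = (cx i z + M) + (cy i z + M)"
    using i by (simp add: N_sector M_def)
  moreover have "N ?e = M + M" using i by (simp add: N_sector M_def)
  ultimately show ?thesis using N_tri[of z ?e] by simp
qed

lemma N_emb_le_wl: "N (emb x) \<le> real (wl x)"
proof -
  have N0: "N 0 = 0" using N_hom[of 0 0] by simp
  have "N (emb (sum_list w)) \<le> real (length w)" if "w \<in> lists S" for w
    using that
  proof (induction w)
    case (Cons s w)
    then show ?case using N_tri[of "emb s" "emb (sum_list w)"] N_S[of s] by simp
  qed (simp add: N0)
  then show ?thesis using word_length_witness[of x] by metis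
qed

text \<open>From such a point on, every step along either corner costs exactly one letter. Positive
  coordinates keep all these points in the interior of the sector.\<close>

definition "good i r \<longleftrightarrow> 0 < cx i (emb r) \<and> 0 < cy i (emb r) \<and>
   (\<forall>m k :: nat. wl (r + int m *s u i + int k *s v i) = wl r + m + k)"

text \<open>Along a coset of the lattice spanned by the two corners of a sector, the defect between
  word length and the linear functional of that sector is bounded below and never increases in
  the directions of the two corners, so it is constant beyond a point where it is minimal.\<close>

lemma good_exists:
  assumes i: "i \<in> I"
  shows "\<exists>r. good i r \<and> x - r \<in> lat (u i) (v i)"
proof -
  let ?pt = "\<lambda>m k. x + m *s u i + k *s v i"
  define c where "c = \<lfloor>cx i (emb x) + cy i (emb x)\<rfloor>"
  have lower: "c \<le> int (wl (?pt m k)) - m - k" for m k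
  proof -
    have "real_of_int c \<le> cx i (emb x) + cy i (emb x)" by (simp add: c_def)
    also have "\<dots> = cx i (emb (?pt m k)) + cy i (emb (?pt m k)) - of_int m - of_int k"
      by (simp only: cxy_lattice[OF i])
    also have "\<dots> \<le> real (wl (?pt m k)) - of_int m - of_int k"
      using cxy_le_N[OF i, of "emb (?pt m k)"] N_emb_le_wl[of "?pt m k"] by linarith
    finally show ?thesis by linarith
  qed
  \<comment> \<open>The lower bound \<open>c\<close> makes the defect a natural number without
    truncation, so a minimising pair exists.\<close>
  define g where "g z = (case z of (m, k) \<Rightarrow> nat (int (wl (?pt m k)) - m - k - c))" for z
  obtain z where z: "\<And>y. g z \<le> g y"
    using ex_has_least_nat[of "\<lambda>_. True" undefined g] by blast
  obtain m1 k1 where z_eq: "z = (m1, k1)" by (cases z)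
  have least: "int (wl (?pt m1 k1)) - m1 - k1 \<le> int (wl (?pt m k)) - m - k" for m k
    using z[of "(m, k)"] lower[of m k] lower[of m1 k1] unfolding g_def z_eq by simp
  have beyond: "int (wl (?pt m k)) = int (wl (?pt m1 k1)) - m1 - k1 + m + k" if "m1 \<le> m" "k1 \<le> k" for m k
  proof -
    have e: "?pt m1 k1 + (m - m1) *s u i = ?pt m k1" "?pt m k1 + (k - k1) *s v i = ?pt m k"
      by (simp_all add: vec_eq_iff algebra_simps)
    have "int (wl (?pt m k)) \<le> int (wl (?pt m1 k1)) + \<bar>m - m1\<bar> + \<bar>k - k1\<bar>"
      using word_length_add_int[OF u_S[OF i], of "?pt m1 k1" "m - m1"]
        word_length_add_int[OF v_S[OF i], of "?pt m k1" "k - k1"] unfolding e by linarith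
    then show ?thesis using least[of m k] that by simp
  qed
  \<comment> \<open>Beyond the minimising pair, and far enough out for both coordinates to be
    positive.\<close>
  define m0 k0 where "m0 = max m1 (\<lfloor>- cx i (emb x)\<rfloor> + 1)" and "k0 = max k1 (\<lfloor>- cy i (emb x)\<rfloor> + 1)"
  let ?r = "?pt m0 k0"
  have "0 < cx i (emb ?r)" "0 < cy i (emb ?r)"
    unfolding cxy_lattice[OF i] m0_def k0_def by linarith+
  moreover have "wl (?r + int m *s u i + int k *s v i) = wl ?r + m + k" for m k
  proof -
    have "?r + int m *s u i + int k *s v i = ?pt (m0 + int m) (k0 + int k)"
      by (simp add: vec_eq_iff algebra_simps)
    moreover have "m1 \<le> m0" "k1 \<le> k0" by (simp_all add: m0_def k0_def)
    then have "int (wl (?pt (m0 + int m) (k0 + int k))) = int (wl ?r) + int m + int k"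
      using beyond[of m0 k0] beyond[of "m0 + int m" "k0 + int k"] by linarith
    ultimately have "int (wl (?r + int m *s u i + int k *s v i)) = int (wl ?r) + int m + int k"
      by (simp only:)
    then show ?thesis by linarith
  qed
  moreover have "x - ?r = (- m0) *s u i + (- k0) *s v i" by (simp add: vec_eq_iff)
  then have "x - ?r \<in> lat (u i) (v i)" by (simp only: latI)
  ultimately show ?thesis unfolding good_def by blast
qed

definition "reps i = (SOME R. transversal (u i) (v i) R \<and> (\<forall>r\<in>R. good i r))"

lemma reps:
  assumes "i \<in> I"
  shows "transversal (u i) (v i) (reps i)" "r \<in> reps i \<Longrightarrow> good i r"
proof -
  obtain R where "transversal (u i) (v i) R" "\<And>r. r \<in> R \<Longrightarrow> good i r"
    using transversal_exists[of "good i" "u i" "v i"] good_exists[OF assms] by metis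
  then have "\<exists>R. transversal (u i) (v i) R \<and> (\<forall>r\<in>R. good i r)" by blast
  then have *: "transversal (u i) (v i) (reps i) \<and> (\<forall>r\<in>reps i. good i r)"
    unfolding reps_def by (rule someI_ex)
  then show "transversal (u i) (v i) (reps i)" by simp
  show "r \<in> reps i \<Longrightarrow> good i r" using * by simp
qed

lemma finite_reps: "i \<in> I \<Longrightarrow> finite (reps i)"
  using finite_transversal reps(1) uv_cr by blast

lemma card_reps: "i \<in> I \<Longrightarrow> card (reps i) = lattice_index (u i) (v i)"
  by (rule card_transversal[OF reps(1)])

lemma rep_of:
  assumes "i \<in> I"
  obtains r m k where "r \<in> reps i" "x = r + m *s u i + k *s v i"
proof -
  obtain r where "r \<in> reps i" "x - r \<in> lat (u i) (v i)"
    using reps(1)[OF assms] unfolding transversal_def by metis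
  moreover then obtain m k where "x - r = m *s u i + k *s v i" by (auto simp: lat_def)
  then have "x = r + m *s u i + k *s v i" by (metis add.assoc add_diff_cancel_left' diff_add_cancel add.commute)
  ultimately show thesis using that by blast
qed

definition "J = (SIGMA i:I. reps i)"

lemma finite_J: "finite J"
  unfolding J_def using finite_I finite_reps by (rule finite_SigmaI)

lemma J_bounds: "\<exists>M::nat. \<forall>(i, r)\<in>J. wl r \<le> M \<and> cx i (emb r) \<le> M \<and> cy i (emb r) \<le> M"
proof -
  let ?f = "\<lambda>(i, r). wl r + nat \<lceil>cx i (emb r)\<rceil> + nat \<lceil>cy i (emb r)\<rceil>"
  have "?f j \<le> Max (?f ` J)" if "j \<in> J" for j
    using that finite_J by (intro Max_ge) auto
  then have *: "wl r + nat \<lceil>cx i (emb r)\<rceil> + nat \<lceil>cy i (emb r)\<rceil> \<le> Max (?f ` J)" if "(i, r) \<in> J" for i r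
    using that by fastforce
  have **: "wl r \<le> M \<and> cx i (emb r) \<le> M \<and> cy i (emb r) \<le> M"
    if "wl r + nat \<lceil>cx i (emb r)\<rceil> + nat \<lceil>cy i (emb r)\<rceil> \<le> M" for i r M
    using that by linarith
  show ?thesis using **[OF *] by (intro exI[of _ "Max (?f ` J)"]) blast
qed

definition "bd = (SOME M::nat. \<forall>(i, r)\<in>J. wl r \<le> M \<and> cx i (emb r) \<le> M \<and> cy i (emb r) \<le> M)"

lemma bd:
  assumes "i \<in> I" "r \<in> reps i"
  shows "wl r \<le> bd" "cx i (emb r) \<le> bd" "cy i (emb r) \<le> bd"
proof -
  have "\<forall>(i, r)\<in>J. wl r \<le> bd \<and> cx i (emb r) \<le> bd \<and> cy i (emb r) \<le> bd"
    unfolding bd_def using J_bounds by (rule someI_ex)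
  moreover have "(i, r) \<in> J" using assms by (simp add: J_def)
  ultimately show "wl r \<le> bd" "cx i (emb r) \<le> bd" "cy i (emb r) \<le> bd" by auto
qed

lemma rep_pos:
  assumes "i \<in> I" "r \<in> reps i"
  shows "0 < cx i (emb r)" "0 < cy i (emb r)"
  using reps(2)[OF assms] by (auto simp: good_def)

lemma sector_rep:
  obtains i r m k where "i \<in> I" "r \<in> reps i" "x = r + m *s u i + k *s v i"
    "0 \<le> cx i (emb x)" "0 \<le> cy i (emb x)" "N (emb x) = cx i (emb x) + cy i (emb x)"
    "- int bd \<le> m" "- int bd \<le> k"
proof -
  obtain i \<sigma> \<tau> where i: "i \<in> I" "0 \<le> \<sigma>" "0 \<le> \<tau>" and x: "emb x = \<sigma> *\<^sub>R emb (u i) + \<tau> *\<^sub>R emb (v i)"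
    using sector_cover by blast
  obtain r m k where r: "r \<in> reps i" "x = r + m *s u i + k *s v i" using rep_of[OF i(1)] by metis
  have c: "cx i (emb x) = \<sigma>" "cy i (emb x) = \<tau>" unfolding x by (simp_all add: cxy_simps[OF i(1)])
  have "N (emb x) = \<sigma> + \<tau>" unfolding x by (rule N_sector[OF i])
  moreover have "cx i (emb r) + of_int m = \<sigma>" "cy i (emb r) + of_int k = \<tau>"
    using c cxy_lattice[OF i(1), of r m k] by (simp_all add: r(2))
  \<comment> \<open>The coordinates of \<open>x\<close> are nonnegative and those of its
    representative are at most \<open>bd\<close>.\<close>
  then have "- int bd \<le> m" "- int bd \<le> k" using bd(2,3)[OF i(1) r(1)] i(2,3) by linarith+
  ultimately show thesis using that i r c by blast
qed

lemma wl_le_N: "real (wl x) \<le> N (emb x) + 5 * real bd"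
proof -
  obtain i r m k where i: "i \<in> I" "r \<in> reps i" "x = r + m *s u i + k *s v i"
    "N (emb x) = cx i (emb x) + cy i (emb x)" "- int bd \<le> m" "- int bd \<le> k"
    using sector_rep[of x] by metis
  have "int (wl x) \<le> int (wl r) + \<bar>m\<bar> + \<bar>k\<bar>"
    using word_length_add_int[OF u_S[OF i(1)], of r m]
      word_length_add_int[OF v_S[OF i(1)], of "r + m *s u i" k] by (simp add: i(3))
  \<comment> \<open>The constant 5 arises here: one \<open>bd\<close> from the representative, and
    two from each absolute value, since \<open>m\<close> and \<open>k\<close> are at least
    \<open>- int bd\<close>.\<close>
  also have "\<dots> \<le> int bd + (m + 2 * int bd) + (k + 2 * int bd)"
    using bd(1)[OF i(1,2)] i(5,6) by linarith
  finally have "real (wl x) \<le> of_int m + of_int k + 5 * real bd" by linarith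
  also have "of_int m + of_int k \<le> N (emb x)"
    using rep_pos[OF i(1,2)] cxy_lattice[OF i(1), of r m k] unfolding i(4) by (simp add: i(3))
  finally show ?thesis by simp
qed

text \<open>Beyond a good point the word length is \<open>wl r + m + k\<close>, so radius
  \<open>n\<close> selects the pairs with sum \<open>n - wl r\<close>. The truncated subtraction is
  harmless once \<open>bd \<le> n\<close>.\<close>

definition "ray i r n = (\<lambda>m. r + int m *s u i + int (n - wl r - m) *s v i) ` {0..n - wl r}"

lemma ray_sphere:
  assumes "i \<in> I" "r \<in> reps i" "bd \<le> n"
  shows "ray i r n \<subseteq> word_sphere S n"
proof
  fix x assume "x \<in> ray i r n"
  then obtain m where m: "m \<le> n - wl r" "x = r + int m *s u i + int (n - wl r - m) *s v i"
    by (auto simp: ray_def)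
  have "wl x = wl r + m + (n - wl r - m)"
    unfolding m(2) using reps(2)[OF assms(1,2)] by (simp add: good_def)
  then show "x \<in> word_sphere S n"
    using m(1) bd(1)[OF assms(1,2)] assms(3) by (simp add: word_sphere_def word_dist_def)
qed

text \<open>Ray points lie in the interior of their sector, which determines \<open>i\<close>;
  inside a sector, a common point puts the two representatives into the same coset.\<close>

lemma ray_disjoint:
  assumes "(i, r) \<in> J" "(j, r') \<in> J" "x \<in> ray i r n" "x \<in> ray j r' n"
  shows "i = j" "r = r'"
proof -
  have i: "i \<in> I" "r \<in> reps i" "j \<in> I" "r' \<in> reps j" using assms by (auto simp: J_def)
  obtain m k where x: "x = r + int m *s u i + int k *s v i" using assms(3) by (auto simp: ray_def)
  obtain m' k' where x': "x = r' + int m' *s u j + int k' *s v j" using assms(4) by (auto simp: ray_def)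
  have "0 < cx i (emb x)" "0 < cy i (emb x)"
    unfolding x using cxy_lattice[OF i(1), of r "int m" "int k"] rep_pos[OF i(1,2)] by auto
  moreover have "0 < cx j (emb x)" "0 < cy j (emb x)"
    unfolding x' using cxy_lattice[OF i(3), of r' "int m'" "int k'"] rep_pos[OF i(3,4)] by auto
  ultimately show ij: "i = j"
    using sector_disjoint[OF i(1,3)] sector_coords[OF i(1)] sector_coords[OF i(3)] by metis
  have "r - r' = (int m' - int m) *s u i + (int k' - int k) *s v i"
    using x x' unfolding ij by (simp add: vec_eq_iff algebra_simps)
  then have "r - r' \<in> lat (u i) (v i)" by (simp only: latI)
  then show "r = r'" using transversal_eq[OF reps(1)[OF i(1)]] i ij by simp
qed

lemma ray_inj:
  assumes "i \<in> I"
  shows "inj_on (\<lambda>m. r + int m *s u i + int (n - wl r - m) *s v i) {0..n - wl r}"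
proof (rule inj_onI)
  fix m m' assume "r + int m *s u i + int (n - wl r - m) *s v i = r + int m' *s u i + int (n - wl r - m') *s v i"
  then have "int m *s u i + int (n - wl r - m) *s v i = int m' *s u i + int (n - wl r - m') *s v i" by simp
  from lat_independent(1)[OF uv_cr[OF assms] this] show "m = m'" by simp
qed

definition "rest n = word_sphere S n - (\<Union>(i, r)\<in>J. ray i r n)"

text \<open>A sphere point off the rays has a negative offset \<open>m\<close> or \<open>k\<close>,
  for which there are at most \<open>bd\<close> values. The sum \<open>m + k\<close> differs from
  \<open>n\<close> by a bounded amount, which leaves at most \<open>9 * bd + 1\<close> values for
  the other offset. The bound does not depend on \<open>n\<close>.\<close>

lemma rest_small: "finite (rest n)" "card (rest n) \<le> card J * (2 * (bd * (9 * bd + 1)))"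
proof -
  \<comment> \<open>The error in \<open>wl_le_N\<close>; a further \<open>2 * int bd\<close> below
    absorbs the coordinates of the representative, and the \<open>2 * int bd\<close> above covers
    the negative offset.\<close>
  define K where "K = 5 * int bd"
  let ?A = "{- int bd..<0} \<times> {int n - K - 2 * int bd .. int n + 2 * int bd}"
  let ?B = "{int n - K - 2 * int bd .. int n + 2 * int bd} \<times> {- int bd..<0}"
  let ?f = "\<lambda>((i, r), (m, k)). r + m *s u i + k *s v i"
  let ?Z = "J \<times> (?A \<union> ?B)"
  have "rest n \<subseteq> ?f ` ?Z"
  proof
    fix x assume x: "x \<in> rest n"
    then have wlx: "wl x = n" by (simp add: rest_def word_sphere_def word_dist_def)
    obtain i r m k where i: "i \<in> I" "r \<in> reps i" "x = r + m *s u i + k *s v i"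
      "N (emb x) = cx i (emb x) + cy i (emb x)" "- int bd \<le> m" "- int bd \<le> k"
      using sector_rep[of x] by metis
    have J: "(i, r) \<in> J" using i by (simp add: J_def)
    have N: "N (emb x) = cx i (emb r) + cy i (emb r) + of_int m + of_int k"
      using cxy_lattice[OF i(1), of r m k] unfolding i(4) by (simp add: i(3))
    have Nn: "N (emb x) \<le> n" "n \<le> N (emb x) + 5 * real bd"
      using N_emb_le_wl[of x] wl_le_N[of x] by (simp_all add: wlx)
    note b = bd[OF i(1,2)] rep_pos[OF i(1,2)]
    have sum: "m + k \<le> int n" "int n - K - 2 * int bd \<le> m + k"
      using N Nn b unfolding K_def by linarith+
    have "\<not> (0 \<le> m \<and> 0 \<le> k)"
    proof
      assume mk: "0 \<le> m \<and> 0 \<le> k"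
      then have x_eq: "x = r + int (nat m) *s u i + int (nat k) *s v i" by (simp add: i(3))
      then have "wl x = wl r + nat m + nat k" using reps(2)[OF i(1,2)] unfolding good_def by metis
      then have "nat k = n - wl r - nat m" "nat m \<le> n - wl r" using wlx by linarith+
      with x_eq have "x \<in> ray i r n"
        unfolding ray_def by (intro image_eqI[of _ _ "nat m"]) auto
      then show False using x J by (auto simp: rest_def)
    qed
    then have "(m, k) \<in> ?A \<union> ?B" using sum i(5,6) by auto
    then show "x \<in> ?f ` ?Z" using J i(3) by (intro image_eqI[of _ _ "((i, r), (m, k))"]) auto
  qed
  moreover have fZ: "finite ?Z" using finite_J by simp
  ultimately show "finite (rest n)" by (meson finite_imageI finite_subset)
  have cI: "card {int n - K - 2 * int bd .. int n + 2 * int bd} = 9 * bd + 1"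
    by (simp add: K_def)
  have "card (rest n) \<le> card ?Z"
    using \<open>rest n \<subseteq> ?f ` ?Z\<close> fZ by (meson card_image_le card_mono finite_imageI order_trans)
  also have "\<dots> = card J * card (?A \<union> ?B)" by (simp add: card_cartesian_product)
  also have "\<dots> \<le> card J * (card ?A + card ?B)" by (intro mult_left_mono card_Un_le) simp
  also have "\<dots> = card J * (2 * (bd * (9 * bd + 1)))"
    unfolding card_cartesian_product cI by simp
  finally show "card (rest n) \<le> card J * (2 * (bd * (9 * bd + 1)))" .
qed

lemma sphere_decomposition:
  assumes "bd \<le> n"
  shows "word_sphere S n = (\<Union>(i, r)\<in>J. ray i r n) \<union> rest n"
  using ray_sphere[OF _ _ assms] by (fastforce simp: rest_def J_def)

lemma finite_ray: "finite (ray i r n)"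
  by (simp add: ray_def)

end

section \<open>Limits of sphere averages\<close>

text \<open>After multiplication by \<open>n\<close>, each of the \<open>n\<close> subintervals
  contributes an error of at most \<open>L / n\<close>; the induction adds them up from the
  left.\<close>

lemma riemann_sum_lipschitz:
  fixes f :: "real \<Rightarrow> real"
  assumes lip: "\<And>s t. s \<in> {0..1} \<Longrightarrow> t \<in> {0..1} \<Longrightarrow> \<bar>f s - f t\<bar> \<le> L * \<bar>s - t\<bar>"
    and L: "0 \<le> L" and n: "0 < n"
  shows "\<bar>(\<Sum>m<n. f (real m / real n)) - real n * integral {0..1} f\<bar> \<le> L"
proof -
  have "L-lipschitz_on {0..1} f"
    using lip L by (intro lipschitz_onI) (auto simp: dist_real_def)
  then have cont: "continuous_on {0..1} f" by (rule lipschitz_on_continuous_on)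
  have "\<bar>(\<Sum>m<k. f (real m / real n)) - real n * integral {0..real k / real n} f\<bar> \<le> L * (real k / real n)"
    if "k \<le> n" for k
    using that
  proof (induction k)
    case (Suc k)
    let ?a = "real k / real n" and ?b = "real (Suc k) / real n"
    have ab: "0 \<le> ?a" "?a \<le> ?b" "?b \<le> 1" "?b - ?a = 1 / real n"
      using Suc(2) n by (auto simp: field_simps)
    have c: "continuous_on {?a..?b} f" "continuous_on {0..?b} f"
      by (rule continuous_on_subset[OF cont], meson ab atLeastAtMost_iff order_trans order_refl subsetI)+
    have split: "integral {0..?b} f = integral {0..?a} f + integral {?a..?b} f"
      using Henstock_Kurzweil_Integration.integral_combine[OF ab(1,2) integrable_continuous_interval[OF c(2)]] by simp
    have "norm (integral {?a..?b} (\<lambda>t. f t - f ?a)) \<le> L / real n * (?b - ?a)"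
    proof (rule integral_bound[OF ab(2)])
      show "continuous_on {?a..?b} (\<lambda>t. f t - f ?a)" by (intro continuous_intros c)
      fix t assume t: "t \<in> {?a..?b}"
      then have "t \<in> {0..1}" "?a \<in> {0..1}" using ab by (meson atLeastAtMost_iff order_trans)+
      then have "\<bar>f t - f ?a\<bar> \<le> L * \<bar>t - ?a\<bar>" by (rule lip)
      also have "\<dots> \<le> L * (1 / real n)" using t ab L by (intro mult_left_mono) auto
      finally show "norm (f t - f ?a) \<le> L / real n" by simp
    qed
    moreover have "integral {?a..?b} (\<lambda>t. f t - f ?a) = integral {?a..?b} f - f ?a / real n"
      using integral_diff[OF integrable_continuous_interval[OF c(1)]
          integrable_continuous_interval[OF continuous_on_const[of _ "f ?a"]]] ab(2) ab(4)
      by simp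
    ultimately have "\<bar>integral {?a..?b} f - f ?a / real n\<bar> \<le> L / real n * (1 / real n)"
      using ab(4) by simp
    then have "real n * \<bar>integral {?a..?b} f - f ?a / real n\<bar> \<le> real n * (L / real n * (1 / real n))"
      by (rule mult_left_mono) simp
    then have "\<bar>real n * (integral {?a..?b} f - f ?a / real n)\<bar> \<le> L / real n"
      using n by (simp add: abs_mult)
    then have "\<bar>real n * integral {?a..?b} f - f ?a\<bar> \<le> L / real n"
      using n by (simp add: right_diff_distrib)
    moreover have "\<bar>(\<Sum>m<k. f (real m / real n)) - real n * integral {0..?a} f\<bar> \<le> L * ?a"
      using Suc by simp
    moreover have "L * ?b = L * ?a + L / real n" by (simp add: add_divide_distrib distrib_left)
    moreover have "(\<Sum>m<Suc k. f (real m / real n)) = (\<Sum>m<k. f (real m / real n)) + f ?a" by simp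
    moreover have "real n * integral {0..?b} f = real n * integral {0..?a} f + real n * integral {?a..?b} f"
      unfolding split by (rule distrib_left)
    ultimately show ?case by linarith
  qed simp
  from this[of n] show ?thesis using n by simp
qed

lemma tendsto_of_bound_over_n:
  fixes f :: "nat \<Rightarrow> real"
  assumes "\<And>n. n \<ge> n0 \<Longrightarrow> \<bar>f n - l\<bar> \<le> C / real n"
  shows "f \<longlonglongrightarrow> l"
proof -
  have "(\<lambda>n. f n - l) \<longlonglongrightarrow> 0"
  proof (rule Lim_null_comparison)
    show "\<forall>\<^sub>F n in sequentially. norm (f n - l) \<le> C / real n"
      using assms eventually_sequentially by auto
    show "(\<lambda>n. C / real n) \<longlonglongrightarrow> 0" by (rule lim_const_over_n)
  qed
  then show ?thesis by (simp add: LIM_zero_iff)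
qed

definition lip :: "real \<Rightarrow> (real^2 \<Rightarrow> real) \<Rightarrow> bool" where
  "lip L h \<longleftrightarrow> 0 \<le> L \<and> (\<forall>x y. \<bar>h x - h y\<bar> \<le> L * norm (x - y))"

lemma lip_continuous: "lip L h \<Longrightarrow> continuous_on UNIV h"
  by (rule lipschitz_on_continuous_on[of L]) (auto simp: lip_def lipschitz_on_def dist_norm)

lemma seg_avg_diff_bound:
  assumes "continuous_on UNIV f" "continuous_on UNIV g" "\<And>x. \<bar>f x - g x\<bar> \<le> e"
  shows "\<bar>seg_avg u v f - seg_avg u v g\<bar> \<le> e"
proof -
  have "norm (integral {0..1} (\<lambda>s. f ((1 - s) *\<^sub>R u + s *\<^sub>R v) - g ((1 - s) *\<^sub>R u + s *\<^sub>R v))) \<le> e * (1 - 0)"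
    using assms by (intro integral_bound continuous_intros continuous_seg_param) auto
  then show ?thesis
    unfolding seg_avg_def by (subst (asm) integral_diff) (auto intro: seg_integrable assms)
qed

context polygonal
begin

abbreviation "U i \<equiv> emb (u i)"
abbreviation "V i \<equiv> emb (v i)"
abbreviation "ix i \<equiv> real (lattice_index (u i) (v i))"

text \<open>The unnormalised limit functional: a side counts once for every ray in its sector, that
  is, as often as the index says. The total mass is \<open>D\<close>.\<close>

definition "Ifun h = (\<Sum>i\<in>I. ix i * seg_avg (U i) (V i) h)"
definition "D = (\<Sum>i\<in>I. ix i)"

lemma wl_rep_pos:
  assumes "i \<in> I" "r \<in> reps i"
  shows "1 \<le> wl r"
  using rep_pos[OF assms] cxy_le_N[OF assms(1), of "emb r"] N_emb_le_wl[of r] by linarith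

text \<open>Scaled by \<open>1 / n\<close>, the point with parameter \<open>m\<close> differs from
  the point \<open>m / n\<close> of the side by
  \<open>(emb r - real (wl r) *\<^sub>R V i) / n\<close>. This turns the sum over the ray into a
  Riemann sum, up to the last few terms.\<close>

lemma ray_sum:
  assumes ir: "i \<in> I" "r \<in> reps i" and n: "bd \<le> n" "0 < n" and h: "lip L h"
    and B: "\<And>z. N z \<le> 1 \<Longrightarrow> \<bar>h z\<bar> \<le> B"
  shows "\<bar>(\<Sum>x\<in>ray i r n. h ((1 / real n) *\<^sub>R emb x)) - real n * seg_avg (U i) (V i) h\<bar>
     \<le> (2 * norm (emb r - real (wl r) *\<^sub>R V i) + norm (U i - V i) + real (wl r)) * (L + B)"
proof -
  let ?D = "norm (emb r - real (wl r) *\<^sub>R V i)"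
  define g where "g s = h ((1 - s) *\<^sub>R V i + s *\<^sub>R U i)" for s
  have L: "0 \<le> L" and lipL: "\<bar>h x - h y\<bar> \<le> L * norm (x - y)" for x y using h by (auto simp: lip_def)
  have B0: "0 \<le> B" using B[of 0] N_hom[of 0 0] by simp
  have wn: "wl r \<le> n" "1 \<le> wl r" using bd(1)[OF ir] n wl_rep_pos[OF ir] by auto
  have "(\<Sum>x\<in>ray i r n. h ((1 / real n) *\<^sub>R emb x))
      = (\<Sum>m\<in>{0..n - wl r}. h ((1 / real n) *\<^sub>R emb (r + int m *s u i + int (n - wl r - m) *s v i)))"
    unfolding ray_def by (subst sum.reindex[OF ray_inj[OF ir(1)]]) simp
  then have 1: "\<bar>(\<Sum>x\<in>ray i r n. h ((1 / real n) *\<^sub>R emb x)) - (\<Sum>m\<in>{0..n - wl r}. g (real m / real n))\<bar> \<le> 2 * (L * ?D)"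
  proof -
    have "\<bar>h ((1 / real n) *\<^sub>R emb (r + int m *s u i + int (n - wl r - m) *s v i)) - g (real m / real n)\<bar>
        \<le> L * ?D / real n" if "m \<in> {0..n - wl r}" for m
    proof -
      have nm: "real (n - wl r - m) = real n - real (wl r) - real m" using that wn by auto
      have "(1 / real n) *\<^sub>R emb (r + int m *s u i + int (n - wl r - m) *s v i)
          - ((1 - real m / real n) *\<^sub>R V i + (real m / real n) *\<^sub>R U i)
          = (1 / real n) *\<^sub>R (emb r - real (wl r) *\<^sub>R V i)"
        using n(2) by (simp only: emb_simps of_int_of_nat_eq nm) (simp add: vec_eq_iff field_simps)
      then show ?thesis
        using lipL[of "(1 / real n) *\<^sub>R emb (r + int m *s u i + int (n - wl r - m) *s v i)"
            "(1 - real m / real n) *\<^sub>R V i + (real m / real n) *\<^sub>R U i"] by (simp add: g_def)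
    qed
    then have "\<bar>\<Sum>m\<in>{0..n - wl r}. h ((1 / real n) *\<^sub>R emb (r + int m *s u i + int (n - wl r - m) *s v i)) - g (real m / real n)\<bar>
        \<le> (\<Sum>m\<in>{0..n - wl r}. L * ?D / real n)"
      by (intro order_trans[OF sum_abs] sum_mono)
    also have "\<dots> = real (n - wl r + 1) * (L * ?D / real n)" by simp
    also have "\<dots> \<le> (2 * real n) * (L * ?D / real n)"
      using L wn n by (intro mult_right_mono) auto
    also have "\<dots> = 2 * (L * ?D)" using n by simp
    finally show ?thesis
      using \<open>(\<Sum>x\<in>ray i r n. _ x) = _\<close> by (simp add: sum_subtractf)
  qed
  have 2: "\<bar>(\<Sum>m<n. g (real m / real n)) - (\<Sum>m\<in>{0..n - wl r}. g (real m / real n))\<bar> \<le> real (wl r) * B"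
  proof -
    \<comment> \<open>A representative has positive length, so the \<open>n - wl r + 1\<close>
      points of the ray use only indices below \<open>n\<close>.\<close>
    have sub: "{0..n - wl r} \<subseteq> {..<n}" using wn n by auto
    have "(\<Sum>m<n. g (real m / real n)) - (\<Sum>m\<in>{0..n - wl r}. g (real m / real n))
        = (\<Sum>m\<in>{..<n} - {0..n - wl r}. g (real m / real n))"
      using sum.subset_diff[OF sub, of "\<lambda>m. g (real m / real n)"] by simp
    also have "\<bar>\<dots>\<bar> \<le> (\<Sum>m\<in>{..<n} - {0..n - wl r}. B)"
    proof (intro order_trans[OF sum_abs] sum_mono)
      fix m assume "m \<in> {..<n} - {0..n - wl r}"
      then have "0 \<le> real m / real n" "real m / real n \<le> 1" by auto
      then have "N ((1 - real m / real n) *\<^sub>R V i + (real m / real n) *\<^sub>R U i) = 1"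
        using N_sector[OF ir(1), of "real m / real n" "1 - real m / real n"] by (simp add: add.commute)
      then show "\<bar>g (real m / real n)\<bar> \<le> B" unfolding g_def by (intro B) simp
    qed
    also have "\<dots> = real (card ({..<n} - {0..n - wl r})) * B" by simp
    also have "card ({..<n} - {0..n - wl r}) = n - (n - wl r + 1)"
      using card_Diff_subset[OF _ sub] by simp
    also have "real (n - (n - wl r + 1)) * B \<le> real (wl r) * B"
      using B0 by (intro mult_right_mono) auto
    finally show ?thesis .
  qed
  have 3: "\<bar>(\<Sum>m<n. g (real m / real n)) - real n * integral {0..1} g\<bar> \<le> L * norm (U i - V i)"
  proof (rule riemann_sum_lipschitz)
    fix s t :: real
    have "((1 - s) *\<^sub>R V i + s *\<^sub>R U i) - ((1 - t) *\<^sub>R V i + t *\<^sub>R U i) = (s - t) *\<^sub>R (U i - V i)"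
      by (simp add: algebra_simps)
    then show "\<bar>g s - g t\<bar> \<le> L * norm (U i - V i) * \<bar>s - t\<bar>"
      using lipL[of "(1 - s) *\<^sub>R V i + s *\<^sub>R U i" "(1 - t) *\<^sub>R V i + t *\<^sub>R U i"]
      unfolding g_def by (simp add: mult_ac)
  qed (use L n in auto)
  have 4: "integral {0..1} g = seg_avg (U i) (V i) h"
    unfolding seg_avg_commute[of "U i"] by (simp add: seg_avg_def g_def[abs_def])
  have "\<bar>(\<Sum>x\<in>ray i r n. h ((1 / real n) *\<^sub>R emb x)) - real n * seg_avg (U i) (V i) h\<bar>
      \<le> 2 * (L * ?D) + real (wl r) * B + L * norm (U i - V i)"
    using 1 2 3 unfolding 4 by linarith
  also have "\<dots> \<le> (2 * ?D + norm (U i - V i) + real (wl r)) * (L + B)"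
  proof -
    have "0 \<le> ?D * B" "0 \<le> norm (U i - V i) * B" "0 \<le> real (wl r) * L" using L B0 by simp_all
    then show ?thesis by (simp add: algebra_simps)
  qed
  finally show ?thesis .
qed

text \<open>One constant \<open>C\<close> serves all \<open>h\<close>, and the bound is linear in
  \<open>L + B\<close>. The double sum needs this uniformity, since it applies the estimate to a
  different function for every point of the sphere.\<close>

lemma sphere_sum:
  "\<exists>C\<ge>0. \<forall>n L B h. bd \<le> n \<longrightarrow> 0 < n \<longrightarrow> lip L h \<longrightarrow> (\<forall>z. N z \<le> 1 \<longrightarrow> \<bar>h z\<bar> \<le> B) \<longrightarrow>
     \<bar>(\<Sum>x\<in>word_sphere S n. h ((1 / real n) *\<^sub>R emb x)) - real n * Ifun h\<bar> \<le> C * (L + B)"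
proof -
  define c where "c j = (case j of (i, r) \<Rightarrow> 2 * norm (emb r - real (wl r) *\<^sub>R V i) + norm (U i - V i) + real (wl r))" for j
  define R0 where "R0 = card J * (2 * (bd * (9 * bd + 1)))"
  define C where "C = (\<Sum>j\<in>J. c j) + real R0"
  have c0: "0 \<le> c j" for j by (auto simp: c_def split: prod.split)
  have "0 \<le> C" unfolding C_def using c0 by (simp add: sum_nonneg)
  moreover have "\<bar>(\<Sum>x\<in>word_sphere S n. h ((1 / real n) *\<^sub>R emb x)) - real n * Ifun h\<bar> \<le> C * (L + B)"
    if n: "bd \<le> n" "0 < n" and h: "lip L h" and B: "\<forall>z. N z \<le> 1 \<longrightarrow> \<bar>h z\<bar> \<le> B" for n L B h
  proof -
    let ?h = "\<lambda>x. h ((1 / real n) *\<^sub>R emb x)"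
    let ?ray = "\<lambda>(i, r). ray i r n"
    have B0: "0 \<le> B" using B[rule_format, of 0] N_hom[of 0 0] by simp
    have L: "0 \<le> L" using h by (simp add: lip_def)
    have "(\<Sum>x\<in>word_sphere S n. ?h x) = (\<Sum>x\<in>(\<Union>j\<in>J. ?ray j). ?h x) + (\<Sum>x\<in>rest n. ?h x)"
      unfolding sphere_decomposition[OF n(1)]
    proof (rule sum.union_disjoint)
      show "finite (\<Union>(i, r)\<in>J. ray i r n)" by (auto simp: finite_J finite_ray)
      show "(\<Union>(i, r)\<in>J. ray i r n) \<inter> rest n = {}" by (auto simp: rest_def)
    qed (rule rest_small(1))
    also have "(\<Sum>x\<in>(\<Union>j\<in>J. ?ray j). ?h x) = (\<Sum>j\<in>J. \<Sum>x\<in>?ray j. ?h x)"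
    proof (rule sum.UNION_disjoint)
      show "\<forall>j\<in>J. \<forall>j'\<in>J. j \<noteq> j' \<longrightarrow> ?ray j \<inter> ?ray j' = {}"
      proof (intro ballI impI)
        fix j j' assume jj: "j \<in> J" "j' \<in> J" "j \<noteq> j'"
        show "?ray j \<inter> ?ray j' = {}"
        proof (rule ccontr)
          assume "?ray j \<inter> ?ray j' \<noteq> {}"
          then obtain x where "x \<in> ?ray j" "x \<in> ?ray j'" by blast
          moreover obtain i r i' r' where e: "j = (i, r)" "j' = (i', r')" by (metis surj_pair)
          ultimately show False
            using ray_disjoint[of i r i' r' x n] jj by auto
        qed
      qed
    qed (auto simp: finite_J finite_ray)
    finally have split: "(\<Sum>x\<in>word_sphere S n. ?h x) = (\<Sum>j\<in>J. \<Sum>x\<in>?ray j. ?h x) + (\<Sum>x\<in>rest n. ?h x)" .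
    have "\<bar>\<Sum>x\<in>rest n. ?h x\<bar> \<le> (\<Sum>x\<in>rest n. B)"
    proof (intro order_trans[OF sum_abs] sum_mono)
      fix x assume "x \<in> rest n"
      then have "N (emb x) \<le> real n"
        using N_emb_le_wl[of x] by (simp add: rest_def word_sphere_def word_dist_def)
      then have "N ((1 / real n) *\<^sub>R emb x) \<le> 1" using n by (simp add: N_hom)
      then show "\<bar>?h x\<bar> \<le> B" using B by blast
    qed
    also have "\<dots> = real (card (rest n)) * B" by simp
    also have "\<dots> \<le> real R0 * B"
      using rest_small(2)[of n] B0 unfolding R0_def by (intro mult_right_mono) (auto simp only: of_nat_le_iff)
    also have "\<dots> \<le> real R0 * (L + B)" using L by (intro mult_left_mono) auto
    finally have 1: "\<bar>\<Sum>x\<in>rest n. ?h x\<bar> \<le> real R0 * (L + B)" .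
    have Ifun_J: "real n * Ifun h = (\<Sum>(i, r)\<in>J. real n * seg_avg (U i) (V i) h)"
      unfolding J_def Ifun_def sum_distrib_left
      by (subst sum.Sigma[symmetric]) (auto simp: finite_I finite_reps card_reps intro!: sum.cong)
    have "\<bar>(\<Sum>j\<in>J. \<Sum>x\<in>?ray j. ?h x) - real n * Ifun h\<bar>
        = \<bar>\<Sum>j\<in>J. (\<Sum>x\<in>?ray j. ?h x) - (case j of (i, r) \<Rightarrow> real n * seg_avg (U i) (V i) h)\<bar>"
      unfolding Ifun_J by (simp add: sum_subtractf)
    also have "\<dots> \<le> (\<Sum>j\<in>J. c j * (L + B))"
    proof (intro order_trans[OF sum_abs] sum_mono)
      fix j assume "j \<in> J"
      then obtain i r where j: "j = (i, r)" "i \<in> I" "r \<in> reps i" by (auto simp: J_def)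
      show "\<bar>(\<Sum>x\<in>?ray j. ?h x) - (case j of (i, r) \<Rightarrow> real n * seg_avg (U i) (V i) h)\<bar> \<le> c j * (L + B)"
        using ray_sum[OF j(2,3) n h] B unfolding j(1) c_def by simp
    qed
    finally have 2: "\<bar>(\<Sum>j\<in>J. \<Sum>x\<in>?ray j. ?h x) - real n * Ifun h\<bar> \<le> (\<Sum>j\<in>J. c j) * (L + B)"
      by (simp add: sum_distrib_right)
    have "C * (L + B) = (\<Sum>j\<in>J. c j) * (L + B) + real R0 * (L + B)"
      unfolding C_def by (rule distrib_right)
    then show ?thesis unfolding split using 1 2 by linarith
  qed
  ultimately show ?thesis by blast
qed

lemma D_pos: "0 < D"
proof -
  obtain i where "i \<in> I" using sector_cover[of 0] by blast
  then show ?thesis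
    unfolding D_def using finite_I lattice_index_pos[OF uv_cr] by (intro sum_pos) auto
qed

lemma Ifun_const: "Ifun (\<lambda>_. c) = D * c"
  by (simp add: Ifun_def D_def seg_avg_def sum_distrib_right)

lemma Ifun_diff_bound:
  assumes "continuous_on UNIV f" "continuous_on UNIV g" "\<And>x. \<bar>f x - g x\<bar> \<le> e"
  shows "\<bar>Ifun f - Ifun g\<bar> \<le> D * e"
proof -
  have "\<bar>Ifun f - Ifun g\<bar> = \<bar>\<Sum>i\<in>I. ix i * (seg_avg (U i) (V i) f - seg_avg (U i) (V i) g)\<bar>"
    by (simp add: Ifun_def sum_subtractf right_diff_distrib)
  also have "\<dots> \<le> (\<Sum>i\<in>I. ix i * e)"
  proof (intro order_trans[OF sum_abs] sum_mono)
    fix i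
    show "\<bar>ix i * (seg_avg (U i) (V i) f - seg_avg (U i) (V i) g)\<bar> \<le> ix i * e"
      using seg_avg_diff_bound[OF assms] by (simp add: abs_mult mult_left_mono)
  qed
  finally show ?thesis by (simp add: D_def sum_distrib_right)
qed

lemma N_diff_le: "\<bar>N x - N y\<bar> \<le> N (x - y)"
  using N_tri[of "x - y" y] N_tri[of "y - x" x] N_neg[of "x - y"] by simp

lemma N_diff_lip:
  obtains C where "0 < C" "\<And>y. lip C (\<lambda>x. N (x - y))" "\<And>x y z. \<bar>N (x - y) - N (x - z)\<bar> \<le> C * norm (y - z)"
proof -
  obtain C where C: "0 < C" "\<And>z. N z \<le> C * norm z" using N_le by blast
  have "lip C (\<lambda>x. N (x - y))" for y
    unfolding lip_def
  proof (intro conjI allI)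
    fix x x'
    show "\<bar>N (x - y) - N (x' - y)\<bar> \<le> C * norm (x - x')"
      using N_diff_le[of "x - y" "x' - y"] C(2)[of "x - x'"] by simp
  qed (use C in simp)
  moreover have "\<bar>N (x - y) - N (x - z)\<bar> \<le> C * norm (y - z)" for x y z
    using N_diff_le[of "x - y" "x - z"] C(2)[of "z - y"] by (simp add: norm_minus_commute)
  ultimately show thesis using that C(1) by blast
qed

text \<open>Three approximations, each with an error of order 1/n: the cardinality of the sphere by
  \<open>n * D\<close>, the double sum of scaled norms \<open>T n\<close> by
  \<open>(real n)\<^sup>2 * Ifun G\<close>, and word distances by norms.\<close>

theorem sphere_average_tendsto:
  "sphere_average S \<longlonglongrightarrow> Ifun (\<lambda>y. Ifun (\<lambda>x. N (x - y))) / D\<^sup>2"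
proof -
  obtain C where C: "0 \<le> C" and sum: "\<And>n L B h. bd \<le> n \<Longrightarrow> 0 < n \<Longrightarrow> lip L h \<Longrightarrow>
      (\<And>z. N z \<le> 1 \<Longrightarrow> \<bar>h z\<bar> \<le> B) \<Longrightarrow>
      \<bar>(\<Sum>x\<in>word_sphere S n. h ((1 / real n) *\<^sub>R emb x)) - real n * Ifun h\<bar> \<le> C * (L + B)"
    using sphere_sum by blast
  obtain c where c: "0 < c" "\<And>y. lip c (\<lambda>x. N (x - y))"
      "\<And>x y z. \<bar>N (x - y) - N (x - z)\<bar> \<le> c * norm (y - z)"
    using N_diff_lip by blast
  define G where "G y = Ifun (\<lambda>x. N (x - y))" for y
  define T where "T n = (\<Sum>y\<in>word_sphere S n. \<Sum>x\<in>word_sphere S n. N ((1 / real n) *\<^sub>R emb x - (1 / real n) *\<^sub>R emb y))" for n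
  define s where "s n = real (card (word_sphere S n))" for n
  have cont: "continuous_on UNIV (\<lambda>x. N (x - y))" for y using c(2) by (rule lip_continuous)
  have N2: "\<bar>N (x - y)\<bar> \<le> 2" if "N x \<le> 1" "N y \<le> 1" for x y
    using N_tri[of x "- y"] N_neg[of y] that N_diff_le[of "x - y" 0] N_hom[of 0 0] by simp
  have lipG: "lip (D * c) G"
    unfolding lip_def
  proof (intro conjI allI)
    show "0 \<le> D * c" using D_pos c(1) by simp
    fix y z
    have "\<bar>G y - G z\<bar> \<le> D * (c * norm (y - z))"
      unfolding G_def by (rule Ifun_diff_bound[OF cont cont c(3)])
    then show "\<bar>G y - G z\<bar> \<le> D * c * norm (y - z)" by (simp add: mult.assoc)
  qed
  have G2: "\<bar>G y\<bar> \<le> D * 2" if "N y \<le> 1" for y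
  proof -
    have "\<bar>seg_avg (U i) (V i) (\<lambda>x. N (x - y))\<bar> \<le> 2" if i: "i \<in> I" for i
    proof -
      have "norm (integral {0..1} (\<lambda>t. N (((1 - t) *\<^sub>R U i + t *\<^sub>R V i) - y))) \<le> 2 * (1 - 0)"
      proof (rule integral_bound)
        show "continuous_on {0..1} (\<lambda>t. N (((1 - t) *\<^sub>R U i + t *\<^sub>R V i) - y))"
          by (rule continuous_seg_param[OF cont])
        fix t :: real assume "t \<in> {0..1}"
        then have "N ((1 - t) *\<^sub>R U i + t *\<^sub>R V i) = 1" using N_sector[OF i, of "1 - t" t] by simp
        then show "norm (N (((1 - t) *\<^sub>R U i + t *\<^sub>R V i) - y)) \<le> 2" using N2 \<open>N y \<le> 1\<close> by simp
      qed simp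
      then show ?thesis by (simp add: seg_avg_def)
    qed
    then have "\<bar>G y\<bar> \<le> (\<Sum>i\<in>I. ix i * 2)"
      unfolding G_def Ifun_def
      by (intro order_trans[OF sum_abs] sum_mono) (simp add: abs_mult mult_left_mono)
    then show ?thesis by (simp add: D_def sum_distrib_right)
  qed
  have card_bound: "\<bar>s n - real n * D\<bar> \<le> C" if "bd \<le> n" "0 < n" for n
    using sum[OF that, of 0 "\<lambda>_. 1" 1] by (simp add: Ifun_const s_def lip_def)
  have s_lim: "(\<lambda>n. s n / real n) \<longlonglongrightarrow> D"
  proof (rule tendsto_of_bound_over_n)
    fix n assume n: "n \<ge> Suc bd"
    then have "s n / real n - D = (s n - real n * D) / real n" by (simp add: field_simps)
    then have "\<bar>s n / real n - D\<bar> = \<bar>s n - real n * D\<bar> / real n" using n by (simp add: abs_divide)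
    then show "\<bar>s n / real n - D\<bar> \<le> C / real n"
      using card_bound[of n] n by (simp add: divide_right_mono)
  qed
  have sphere_N: "N ((1 / real n) *\<^sub>R emb x) \<le> 1" if "x \<in> word_sphere S n" "0 < n" for x n
    using that N_emb_le_wl[of x] by (simp add: N_hom word_sphere_def word_dist_def)
  \<comment> \<open>The estimate for spheres is used twice: for each fixed \<open>y\<close> with the
    function \<open>N (x - y)\<close>, then with \<open>G\<close>, which inherits a Lipschitz
    constant and a bound from \<open>N\<close>. The errors of the inner sums add up over at most
    \<open>n * (D + C)\<close> points.\<close>
  have T_bound: "\<bar>T n - (real n)\<^sup>2 * Ifun G\<bar> \<le> real n * ((D + C) * (C * (c + 2)) + C * (D * c + D * 2))"
    if n: "bd \<le> n" "0 < n" for n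
  proof -
    have "\<bar>T n - (\<Sum>y\<in>word_sphere S n. real n * G ((1 / real n) *\<^sub>R emb y))\<bar>
        \<le> (\<Sum>y\<in>word_sphere S n. C * (c + 2))"
      unfolding T_def sum_subtractf[symmetric]
    proof (intro order_trans[OF sum_abs] sum_mono)
      fix y assume y: "y \<in> word_sphere S n"
      show "\<bar>(\<Sum>x\<in>word_sphere S n. N ((1 / real n) *\<^sub>R emb x - (1 / real n) *\<^sub>R emb y))
          - real n * G ((1 / real n) *\<^sub>R emb y)\<bar> \<le> C * (c + 2)"
        unfolding G_def by (rule sum[OF n c(2)]) (rule N2[OF _ sphere_N[OF y n(2)]])
    qed
    also have "\<dots> = s n * (C * (c + 2))" by (simp add: s_def)
    also have "\<dots> \<le> (real n * (D + C)) * (C * (c + 2))"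
    proof (rule mult_right_mono)
      have "C * 1 \<le> C * real n" using C n by (intro mult_left_mono) auto
      then show "s n \<le> real n * (D + C)" using card_bound[OF n] by (simp add: algebra_simps)
      show "0 \<le> C * (c + 2)" using C c(1) by simp
    qed
    finally have 1: "\<bar>T n - real n * (\<Sum>y\<in>word_sphere S n. G ((1 / real n) *\<^sub>R emb y))\<bar>
        \<le> real n * ((D + C) * (C * (c + 2)))" by (simp add: sum_distrib_left mult_ac)
    have "\<bar>(\<Sum>y\<in>word_sphere S n. G ((1 / real n) *\<^sub>R emb y)) - real n * Ifun G\<bar> \<le> C * (D * c + D * 2)"
      by (rule sum[OF n lipG G2])
    then have "real n * \<bar>(\<Sum>y\<in>word_sphere S n. G ((1 / real n) *\<^sub>R emb y)) - real n * Ifun G\<bar>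
        \<le> real n * (C * (D * c + D * 2))" by (rule mult_left_mono) simp
    then have "\<bar>real n * ((\<Sum>y\<in>word_sphere S n. G ((1 / real n) *\<^sub>R emb y)) - real n * Ifun G)\<bar>
        \<le> real n * (C * (D * c + D * 2))" by (simp only: abs_mult abs_of_nat)
    then have 2: "\<bar>real n * (\<Sum>y\<in>word_sphere S n. G ((1 / real n) *\<^sub>R emb y)) - (real n)\<^sup>2 * Ifun G\<bar>
        \<le> real n * (C * (D * c + D * 2))"
      by (simp only: right_diff_distrib power2_eq_square mult.assoc)
    show ?thesis using 1 2 unfolding distrib_left by linarith
  qed
  have T_lim: "(\<lambda>n. T n / (real n)\<^sup>2) \<longlonglongrightarrow> Ifun G"
  proof (rule tendsto_of_bound_over_n)
    fix n assume n: "n \<ge> Suc bd"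
    then have n0: "real n > 0" by simp
    have "T n / (real n)\<^sup>2 - Ifun G = (T n - (real n)\<^sup>2 * Ifun G) / (real n)\<^sup>2"
      using n0 by (simp add: field_simps)
    then have "\<bar>T n / (real n)\<^sup>2 - Ifun G\<bar> = \<bar>T n - (real n)\<^sup>2 * Ifun G\<bar> / (real n)\<^sup>2"
      by (simp add: abs_divide)
    also have "\<dots> \<le> real n * ((D + C) * (C * (c + 2)) + C * (D * c + D * 2)) / (real n)\<^sup>2"
      using T_bound[of n] n by (intro divide_right_mono) auto
    also have "\<dots> = ((D + C) * (C * (c + 2)) + C * (D * c + D * 2)) / real n"
      using n0 by (simp add: power2_eq_square)
    finally show "\<bar>T n / (real n)\<^sup>2 - Ifun G\<bar> \<le> ((D + C) * (C * (c + 2)) + C * (D * c + D * 2)) / real n" .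
  qed
  have "(\<lambda>n. (T n / (real n)\<^sup>2) / (s n / real n)\<^sup>2) \<longlonglongrightarrow> Ifun G / D\<^sup>2"
    using D_pos by (intro tendsto_divide T_lim tendsto_power s_lim) simp
  moreover have "\<forall>\<^sub>F n in sequentially. (T n / (real n)\<^sup>2) / (s n / real n)\<^sup>2 = T n / (s n)\<^sup>2"
    using eventually_gt_at_top[of 0] by eventually_elim (simp add: power_divide)
  ultimately have lim1: "(\<lambda>n. T n / (s n)\<^sup>2) \<longlonglongrightarrow> Ifun G / D\<^sup>2"
    by (rule Lim_transform_eventually)
  have "(\<lambda>n. sphere_average S n - T n / (s n)\<^sup>2) \<longlonglongrightarrow> 0"
  proof (rule tendsto_of_bound_over_n)
    fix n assume n: "n \<ge> Suc bd"
    then have n0: "0 < n" by simp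
    have avg: "sphere_average S n - T n / (s n)\<^sup>2 = (\<Sum>x\<in>word_sphere S n. \<Sum>y\<in>word_sphere S n.
        1 / real n * real (wl (y - x)) - N ((1 / real n) *\<^sub>R emb y - (1 / real n) *\<^sub>R emb x)) / (s n)\<^sup>2"
      unfolding sphere_average_def T_def s_def word_dist_def
      by (simp add: sum_subtractf diff_divide_distrib)
    have "\<bar>1 / real n * real (wl (y - x)) - N ((1 / real n) *\<^sub>R emb y - (1 / real n) *\<^sub>R emb x)\<bar>
        \<le> 5 * real bd / real n" for x y
    proof -
      have "(1 / real n) *\<^sub>R emb y - (1 / real n) *\<^sub>R emb x = (1 / real n) *\<^sub>R emb (y - x)"
        by (simp add: scaleR_diff_right)
      then have "1 / real n * real (wl (y - x)) - N ((1 / real n) *\<^sub>R emb y - (1 / real n) *\<^sub>R emb x)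
          = (real (wl (y - x)) - N (emb (y - x))) / real n"
        by (simp only: N_hom) (simp add: diff_divide_distrib)
      moreover have "\<bar>real (wl (y - x)) - N (emb (y - x))\<bar> \<le> 5 * real bd"
        using N_emb_le_wl[of "y - x"] wl_le_N[of "y - x"] by linarith
      ultimately show ?thesis by (simp only: abs_divide abs_of_nat divide_right_mono of_nat_0_le_iff)
    qed
    then have "\<bar>\<Sum>x\<in>word_sphere S n. \<Sum>y\<in>word_sphere S n.
        1 / real n * real (wl (y - x)) - N ((1 / real n) *\<^sub>R emb y - (1 / real n) *\<^sub>R emb x)\<bar>
        \<le> (\<Sum>x\<in>word_sphere S n. \<Sum>y\<in>word_sphere S n. 5 * real bd / real n)"
      by (intro order_trans[OF sum_abs] sum_mono)
    also have "\<dots> = (s n)\<^sup>2 * (5 * real bd / real n)" by (simp add: s_def power2_eq_square)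
    finally have "\<bar>sphere_average S n - T n / (s n)\<^sup>2\<bar> \<le> (s n)\<^sup>2 * (5 * real bd / real n) / (s n)\<^sup>2"
      unfolding avg abs_divide abs_power2 by (rule divide_right_mono) simp
    \<comment> \<open>For an empty sphere the quotient is 0 by the convention for division.\<close>
    also have "\<dots> \<le> 5 * real bd / real n" by (cases "s n = 0") auto
    finally show "\<bar>sphere_average S n - T n / (s n)\<^sup>2 - 0\<bar> \<le> 5 * real bd / real n" by simp
  qed
  from tendsto_add[OF this lim1] show ?thesis unfolding G_def[abs_def] by simp
qed

end

section \<open>Generating sets with at most six elements\<close>

text \<open>Matches the four sides of a parallelogram with \<open>hexint\<close>, in which the
  midpoint \<open>w\<close> cuts two opposite sides into halves.\<close>

lemma seg_avg_halves:
  assumes h: "continuous_on UNIV h" and m: "m = (1/2) *\<^sub>R u + (1/2) *\<^sub>R v"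
  shows "seg_avg u v h = (1/2) * seg_avg u m h + (1/2) * seg_avg m v h"
proof -
  define f where "f s = h ((1 - s) *\<^sub>R u + s *\<^sub>R v)" for s :: real
  have int: "f integrable_on {c..d}" for c d
    unfolding f_def by (intro integrable_continuous_interval continuous_seg_param h)
  have "((\<lambda>s. f ((1/2) *\<^sub>R s + 0)) has_integral integral {0..1/2} f /\<^sub>R (1/2) ^ DIM(real))
      (cbox ((0 - 0) /\<^sub>R (1/2)) ((1/2 - 0) /\<^sub>R (1/2)))"
    by (rule has_integral_affinity') (use integrable_integral[OF int[of 0 "1/2"]] in auto)
  then have 1: "integral {0..1} (\<lambda>s. f (s / 2)) = 2 * integral {0..1/2} f"
    by (simp add: integral_unique)
  have "((\<lambda>s. f ((1/2) *\<^sub>R s + 1/2)) has_integral integral {1/2..1} f /\<^sub>R (1/2) ^ DIM(real))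
      (cbox ((1/2 - 1/2) /\<^sub>R (1/2)) ((1 - 1/2) /\<^sub>R (1/2)))"
    by (rule has_integral_affinity') (use integrable_integral[OF int[of "1/2" 1]] in auto)
  then have 2: "integral {0..1} (\<lambda>s. f (s / 2 + 1/2)) = 2 * integral {1/2..1} f"
    by (simp add: integral_unique)
  have e1: "(1 - s) *\<^sub>R u + s *\<^sub>R m = (1 - s / 2) *\<^sub>R u + (s / 2) *\<^sub>R v" for s
    unfolding m by (simp add: vec_eq_iff field_simps)
  have e2: "(1 - s) *\<^sub>R m + s *\<^sub>R v = (1 - (s / 2 + 1/2)) *\<^sub>R u + (s / 2 + 1/2) *\<^sub>R v" for s
    unfolding m by (simp add: vec_eq_iff field_simps)
  have "integral {0..1} f = integral {0..1/2} f + integral {1/2..1} f"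
    using Henstock_Kurzweil_Integration.integral_combine[of 0 "1/2" 1 f] int by simp
  then show ?thesis
    using 1 2 unfolding seg_avg_def e1 e2 f_def by simp
qed

text \<open>Cramer's rule over the integers expresses \<open>cr P Q *s w\<close> through
  \<open>P\<close> and \<open>Q\<close>, the coefficient of \<open>Q\<close> being
  \<open>cr P w\<close>, which is \<open>a\<close> times \<open>cr P Q\<close>; then
  \<open>lattice_index_combination\<close> applies.\<close>

lemma index_ratio:
  assumes "cr P Q \<noteq> 0" "emb w = b *\<^sub>R emb P + a *\<^sub>R emb Q" "0 < a"
  shows "real (lattice_index P w) = a * real (lattice_index P Q)"
proof -
  have cr: "real_of_int (cr P w) = a * real_of_int (cr P Q)"
    unfolding cr_emb[symmetric] assms(2) by (simp add: cr_simps cr_scaleR)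
  have nz: "cr P w \<noteq> 0" using cr assms(1,3) by (metis mult_eq_0_iff of_int_eq_0_iff less_irrefl)
  define c k where "c = nat \<bar>cr P Q\<bar>" and "k = nat \<bar>cr P w\<bar>"
  have pos: "0 < c" "0 < k" using assms(1) nz by (auto simp: c_def k_def)
  have sgn: "sgn (cr P w) = sgn (cr P Q)"
  proof -
    have "0 < real_of_int (cr P w) \<longleftrightarrow> 0 < real_of_int (cr P Q)"
      unfolding cr using assms(3) by (simp add: zero_less_mult_iff)
    then show ?thesis using nz assms(1) by (simp add: sgn_if)
  qed
  have "cr P Q *s w = cr w Q *s P + cr P w *s Q"
    by (simp add: vec_eq_iff forall_2 cr_def algebra_simps)
  \<comment> \<open>Since \<open>a\<close> is positive, \<open>cr P w\<close> has the same sign as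
    \<open>cr P Q\<close>; one factor \<open>sgn\<close> makes both coefficients positive, as
    natural numbers require.\<close>
  then have "sgn (cr P Q) *s (cr P Q *s w) = sgn (cr P Q) *s (cr w Q *s P + cr P w *s Q)" by simp
  then have "(sgn (cr P Q) * cr P Q) *s w = (sgn (cr P Q) * cr w Q) *s P + (sgn (cr P w) * cr P w) *s Q"
    by (simp add: vector_add_ldistrib vector_smult_assoc sgn)
  moreover have "sgn (cr P Q) * cr P Q = int c" "sgn (cr P w) * cr P w = int k"
    by (simp_all add: c_def k_def sgn_if)
  ultimately have "int c *s w = (sgn (cr P Q) * cr w Q) *s P + int k *s Q" by simp
  from lattice_index_combination[OF assms(1) nz pos this]
  have "real c * real (lattice_index P w) = real k * real (lattice_index P Q)"
    by (metis of_nat_mult)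
  moreover have "real k = a * real c"
  proof -
    have "real k = \<bar>real_of_int (cr P w)\<bar>" by (simp add: k_def)
    also have "\<dots> = a * \<bar>real_of_int (cr P Q)\<bar>" unfolding cr using assms(3) by (simp add: abs_mult)
    also have "\<bar>real_of_int (cr P Q)\<bar> = real c" by (simp add: c_def)
    finally show ?thesis .
  qed
  ultimately have "real c * real (lattice_index P w) = real c * (a * real (lattice_index P Q))" by simp
  then show ?thesis using pos(1) by simp
qed

lemma lattice_index_minus:
  "lattice_index (- u) v = lattice_index u v" "lattice_index u (- v) = lattice_index u v"
  by (rule lattice_index_cong, rule lat_minus)+

lemma lattice_index_commute: "lattice_index u v = lattice_index v u"
  by (rule lattice_index_cong, rule lat_commute)

text \<open>If \<open>cr\<close> vanished on all pairs from \<open>S\<close>, it would by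
  bilinearity vanish on all pairs of sums, but it is 1 on the standard basis.\<close>

lemma generating_independent:
  fixes S :: "(int^2) set"
  assumes "generating_set S"
  shows "\<exists>s\<in>S. \<exists>t\<in>S. cr s t \<noteq> 0"
proof (rule ccontr)
  assume "\<not> ?thesis"
  then have z: "cr s t = 0" if "s \<in> S" "t \<in> S" for s t using that by blast
  have 1: "cr s (sum_list w) = 0" if "s \<in> S" "w \<in> lists S" for s w
    using that(2) by (induction w) (auto simp: cr_simps z that(1))
  have 2: "cr (sum_list w) g = 0" if "w \<in> lists S" "\<And>s. s \<in> S \<Longrightarrow> cr s g = 0" for w g
    using that(1) by (induction w) (auto simp: cr_simps that(2))
  have "cr g g' = 0" for g g' :: "int^2"
  proof -
    obtain w w' :: "(int^2) list" where w: "w \<in> lists S" "sum_list w = g" "w' \<in> lists S" "sum_list w' = g'"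
      using assms unfolding generating_set_def by blast
    have "cr (sum_list w) (sum_list w') = 0" by (rule 2[OF w(1)]) (rule 1[OF _ w(3)])
    then show ?thesis by (simp add: w(2,4))
  qed
  from this[of "vector [1, 0]" "vector [0, 1]"] show False by (simp add: cr_def)
qed

text \<open>The pair \<open>p\<close>, \<open>q\<close> maximises \<bar>cr\<bar> over
  \<open>S\<close>. It accounts for four elements, so at most two remain. The identity may be one of
  the generators, whence the 0 in the conclusion.\<close>

lemma three_generators:
  fixes S :: "(int^2) set"
  assumes fin: "finite S" and sym: "symmetric_set S" and gen: "generating_set S" and card: "card S \<le> 6"
  obtains p q w where "p \<in> S" "q \<in> S" "w \<in> S" "cr p q \<noteq> 0" "\<bar>cr p w\<bar> \<le> \<bar>cr p q\<bar>" "\<bar>cr w q\<bar> \<le> \<bar>cr p q\<bar>"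
    "S \<subseteq> {0, p, - p, q, - q, w, - w}"
proof -
  have neg: "- s \<in> S" if "s \<in> S" for s using sym that unfolding symmetric_set_def by blast
  obtain s t where st: "s \<in> S" "t \<in> S" "cr s t \<noteq> 0" using generating_independent[OF gen] by blast
  let ?A = "(\<lambda>(x, y). \<bar>cr x y\<bar>) ` (S \<times> S)"
  have "Max ?A \<in> ?A" using fin st by (intro Max_in) auto
  then obtain p q where pq: "p \<in> S" "q \<in> S" "Max ?A = \<bar>cr p q\<bar>" by auto
  have max: "\<bar>cr x y\<bar> \<le> \<bar>cr p q\<bar>" if "x \<in> S" "y \<in> S" for x y
    unfolding pq(3)[symmetric] using fin that by (intro Max_ge) auto
  have c: "cr p q \<noteq> 0" using max[OF st(1,2)] st(3) by auto
  have dbl: "x = 0" if "x = - x" for x :: "int^2"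
    using that by (simp add: vec_eq_iff)
  let ?T = "{p, - p, q, - q}"
  have ne: "p \<noteq> - p" "q \<noteq> - q" "p \<noteq> q" "p \<noteq> - q" "- p \<noteq> q" "- p \<noteq> - q"
  proof -
    have "p \<noteq> 0" "q \<noteq> 0" using c by (auto simp: cr_simps)
    then show "p \<noteq> - p" "q \<noteq> - q" using dbl by blast+
    have "cr p p = 0" "cr p (- p) = 0" by (simp_all add: cr_simps)
    then show *: "p \<noteq> q" "p \<noteq> - q" using c by (metis, metis minus_minus)
    show "- p \<noteq> q" using *(2) by (metis minus_minus)
    show "- p \<noteq> - q" using *(1) by (metis minus_minus)
  qed
  then have "card ?T = 4" by simp
  moreover have "?T \<subseteq> S" using pq neg by auto
  ultimately have cardST: "card (S - ?T) \<le> 2" using card card_Diff_subset[of ?T S] by simp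
  show thesis
  proof (cases "S \<subseteq> {0, p, - p, q, - q}")
    \<comment> \<open>There is no third pair of generators; \<open>p\<close> itself serves as
      \<open>w\<close>.\<close>
    case True
    then have "S \<subseteq> {0, p, - p, q, - q, p, - p}" by blast
    moreover have "\<bar>cr p p\<bar> \<le> \<bar>cr p q\<bar>" by (simp add: cr_simps)
    ultimately show thesis using that[of p q p] pq(1,2) c by blast
  next
    case False
    then obtain w where w: "w \<in> S" "w \<notin> ?T" "w \<noteq> 0" by blast
    \<comment> \<open>A nonzero \<open>w\<close> brings its negative, and the two fill the remaining
      places.\<close>
    have "{w, - w} \<subseteq> S - ?T" using w neg by auto
    moreover have "w \<noteq> - w" using w(3) dbl by blast
    then have "card {w, - w} = 2" by (metis card_2_iff)
    ultimately have "{w, - w} = S - ?T" using cardST fin by (metis card_seteq finite_Diff)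
    then have "S \<subseteq> {0, p, - p, q, - q, w, - w}" by blast
    then show thesis using that[of p q w] pq w c max by blast
  qed
qed

text \<open>The factor \<kappa> enters the double integral and the squared total mass with the same
  power 2, so the limit of the sphere averages is the sprawl of the frame.\<close>

lemma polygonal_sprawl:
  assumes "hexagon_frame p q a b" "polygonal S (hexagon_frame.N p q a b) I u v" "0 < \<kappa>"
    and I: "\<And>h. continuous_on UNIV h \<Longrightarrow> polygonal.Ifun I u v h = \<kappa> * hexagon_frame.hexint p q a b h"
    and D: "polygonal.D I u v = \<kappa> * (2 * (a + b + 1))"
  shows "convergent (sphere_average S) \<and> 23/18 \<le> group_sprawl S \<and> group_sprawl S \<le> 4/3"
proof -
  interpret F: hexagon_frame p q a b by fact
  interpret L: polygonal S F.N I u v by fact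
  have cN2: "continuous_on UNIV (\<lambda>(y, x). F.N (x - y))"
    unfolding case_prod_unfold
    by (intro continuous_intros continuous_on_compose2[OF F.continuous_N[of UNIV]]) auto
  have cN: "continuous_on UNIV (\<lambda>x. F.N (x - y))" for y
    by (intro continuous_intros continuous_on_compose2[OF F.continuous_N[of UNIV]]) auto
  have cmult: "F.hexint (\<lambda>x. c * h x) = c * F.hexint h" for c h
    by (simp add: F.hexint_def seg_avg_cmult sum_distrib_left mult.left_commute)
  have "L.Ifun (\<lambda>y. L.Ifun (\<lambda>x. F.N (x - y))) = L.Ifun (\<lambda>y. \<kappa> * F.hexint (\<lambda>x. F.N (x - y)))"
    by (simp only: I[OF cN])
  also have "\<dots> = \<kappa> * F.hexint (\<lambda>y. \<kappa> * F.hexint (\<lambda>x. F.N (x - y)))"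
    by (intro I continuous_intros F.continuous_hexint cN2)
  also have "\<dots> = \<kappa>\<^sup>2 * F.hexint (\<lambda>y. F.hexint (\<lambda>x. F.N (y - x)))"
  proof -
    have "(\<lambda>x. F.N (x - y)) = (\<lambda>x. F.N (y - x))" for y by (rule ext, rule F.N_diff_commute)
    then show ?thesis by (simp only: cmult power2_eq_square mult.assoc)
  qed
  finally have "L.Ifun (\<lambda>y. L.Ifun (\<lambda>x. F.N (x - y))) / L.D\<^sup>2 = F.sprawl_value"
    unfolding D F.sprawl_value_def using \<open>0 < \<kappa>\<close> by (simp add: power_mult_distrib)
  with L.sphere_average_tendsto have lim: "sphere_average S \<longlonglongrightarrow> F.sprawl_value" by simp
  then have "group_sprawl S = F.sprawl_value" unfolding group_sprawl_def by (rule limI)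
  with lim show ?thesis using F.sprawl_value_bounds by (auto simp: convergent_def)
qed

text \<open>By \<open>index_ratio\<close>, the sectors of \<open>P\<close>, \<open>w\<close> and of
  \<open>w\<close>, \<open>Q\<close> have \<open>a\<close> and \<open>b\<close> times the index of
  \<open>P\<close>, \<open>Q\<close>: the number of rays per sector is in the proportions of the
  cone measure.\<close>

lemma hexagonal_group_sprawl:
  fixes P Q w :: "int^2"
  assumes S: "symmetric_set S" "generating_set S" "{P, - P, Q, - Q, w, - w} \<subseteq> S" "S \<subseteq> {0, P, - P, Q, - Q, w, - w}"
    and frame: "hexagon_frame (emb P) (emb Q) a b" and w: "emb w = b *\<^sub>R emb P + a *\<^sub>R emb Q"
  shows "convergent (sphere_average S) \<and> 23/18 \<le> group_sprawl S \<and> group_sprawl S \<le> 4/3"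
proof -
  interpret F: hexagon_frame "emb P" "emb Q" a b by fact
  define u where "u i = [P, w, Q, - P, - w, - Q, P] ! i" for i
  have Fw: "F.w = emb w" by (simp add: w F.w_def)
  have vt: "emb (u i) = F.vt i" if "i \<le> 6" for i
  proof -
    have "i = 0 \<or> i = 1 \<or> i = 2 \<or> i = 3 \<or> i = 4 \<or> i = 5 \<or> i = 6" using that by linarith
    then show ?thesis by (auto simp: u_def F.vt_def Fw)
  qed
  have uS: "u i \<in> S" if "i \<le> 6" for i
  proof -
    have "i = 0 \<or> i = 1 \<or> i = 2 \<or> i = 3 \<or> i = 4 \<or> i = 5 \<or> i = 6" using that by linarith
    then show ?thesis using S(3) by (auto simp: u_def)
  qed
  have crn: "cr (u i) (u (Suc i)) \<noteq> 0" if "i < 6" for i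
  proof -
    have "cr (emb (u i)) (emb (u (Suc i))) \<noteq> 0"
      using F.wt_pos[OF that] F.pq F.cr_vt[OF that] vt[of i] vt[of "Suc i"] that by simp
    then show ?thesis by (simp add: cr_emb)
  qed
  have poly: "polygonal S F.N {..<6} u (\<lambda>i. u (Suc i))"
  proof (unfold_locales)
    show "F.N (emb s) \<le> 1" if "s \<in> S" for s
    proof -
      have "F.N 0 = 0" by (simp add: F.N_eq_0)
      then show ?thesis
        using that S(4) F.N_vt[of 0] F.N_vt[of 1] F.N_vt[of 2] by (auto simp: Fw)
    qed
    show "F.N (\<sigma> *\<^sub>R emb (u i) + \<tau> *\<^sub>R emb (u (Suc i))) = \<sigma> + \<tau>"
      if "i \<in> {..<6}" "0 \<le> \<sigma>" "0 \<le> \<tau>" for i \<sigma> \<tau>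
      using F.N_cone[of i \<sigma> \<tau>] that by (simp add: vt)
    show "\<exists>i\<in>{..<6}. \<exists>\<sigma> \<tau>. 0 \<le> \<sigma> \<and> 0 \<le> \<tau> \<and> z = \<sigma> *\<^sub>R emb (u i) + \<tau> *\<^sub>R emb (u (Suc i))" for z
      using F.cone_cover[of z] by (auto simp: vt intro: bexI)
    show "i = j" if "i \<in> {..<6}" "j \<in> {..<6}" "0 < \<sigma>" "0 < \<tau>" "0 < \<sigma>'" "0 < \<tau>'"
      "\<sigma> *\<^sub>R emb (u i) + \<tau> *\<^sub>R emb (u (Suc i)) = \<sigma>' *\<^sub>R emb (u j) + \<tau>' *\<^sub>R emb (u (Suc j))" for i j \<sigma> \<tau> \<sigma>' \<tau>'
      using F.side_ix[of i \<sigma> \<tau>] F.side_ix[of j \<sigma>' \<tau>'] that by (simp add: vt)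
  qed (use S F.N_triangle F.N_scaleR F.N_bound uS crn in auto)
  have crPQ: "cr P Q \<noteq> 0" using F.pq by (simp add: cr_emb)
  define \<kappa> where "\<kappa> = real (lattice_index P Q)"
  have \<kappa>: "0 < \<kappa>" using lattice_index_pos[OF crPQ] by (simp add: \<kappa>_def)
  have iPw: "real (lattice_index P w) = a * \<kappa>"
    unfolding \<kappa>_def by (rule index_ratio[OF crPQ w F.a_pos])
  have "cr Q P \<noteq> 0" using crPQ cr_commute[of Q P] by simp
  moreover have "emb w = a *\<^sub>R emb Q + b *\<^sub>R emb P" using w by (simp add: add.commute)
  ultimately have iQw: "real (lattice_index w Q) = b * \<kappa>"
    unfolding \<kappa>_def lattice_index_commute[of w] lattice_index_commute[of P]
    by (rule index_ratio[OF _ _ F.b_pos])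
  have ix: "real (lattice_index (u i) (u (Suc i))) = \<kappa> * F.wt i" if "i < 6" for i
    using F.less_6_cases[OF that] iPw iQw
    by (auto simp: u_def F.wt_def lattice_index_minus \<kappa>_def lattice_index_commute[of Q P] eval_nat_numeral)
  interpret L: polygonal S F.N "{..<6}" u "\<lambda>i. u (Suc i)" by (rule poly)
  show ?thesis
  proof (rule polygonal_sprawl[OF frame poly \<kappa>])
    show "L.D = \<kappa> * (2 * (a + b + 1))"
      unfolding L.D_def F.sum_wt[symmetric] sum_distrib_left by (intro sum.cong) (auto simp: ix)
    show "L.Ifun h = \<kappa> * F.hexint h" for h
      unfolding L.Ifun_def F.hexint_def sum_distrib_left
      by (intro sum.cong) (auto simp: ix vt)
  qed
qed

text \<open>Only the four true corners span sectors. Any further generator enters through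
  \<open>N_S\<close> alone: it lies in the body, so words using it are no shorter than the norm
  allows.\<close>

lemma parallelogram_group_sprawl:
  fixes P Q :: "int^2"
  assumes S: "symmetric_set S" "generating_set S" "{P, - P, Q, - Q} \<subseteq> S"
    and frame: "hexagon_frame (emb P) (emb Q) (1/2) (1/2)"
    and N_S: "\<And>s. s \<in> S \<Longrightarrow> hexagon_frame.N (emb P) (emb Q) (1/2) (1/2) (emb s) \<le> 1"
  shows "convergent (sphere_average S) \<and> 23/18 \<le> group_sprawl S \<and> group_sprawl S \<le> 4/3"
proof -
  interpret F: hexagon_frame "emb P" "emb Q" "1/2" "1/2" by fact
  define u where "u i = [P, Q, - P, - Q, P] ! i" for i
  have cases4: "i = 0 \<or> i = 1 \<or> i = 2 \<or> i = 3" if "i < 4" for i :: nat using that by linarith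
  have u_simps: "u 0 = P" "u 1 = Q" "u (Suc 0) = Q" "u 2 = - P" "u (Suc 1) = - P" "u 3 = - Q"
    "u (Suc 2) = - Q" "u (Suc 3) = P" "u (Suc (Suc 0)) = - P" "u 4 = P"
    by (simp_all add: u_def eval_nat_numeral)
  \<comment> \<open>For \<open>a = b = 1/2\<close> the first two functionals coincide and the gauge
    is the sum norm in the coordinates.\<close>
  have sector_N: "F.N z = \<bar>F.X z\<bar> + \<bar>F.Y z\<bar>" for z
    unfolding F.N_def by (simp add: max_def abs_if)
  have crPQ: "cr P Q \<noteq> 0" using F.pq by (simp add: cr_emb)
  have poly: "polygonal S F.N {..<4} u (\<lambda>i. u (Suc i))"
  proof (unfold_locales)
    show "F.N (emb s) \<le> 1" if "s \<in> S" for s using N_S that .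
    show "u i \<in> S" "u (Suc i) \<in> S" if "i \<in> {..<4}" for i
      using cases4[of i] that S(3) by (auto simp: u_def)
    show "cr (u i) (u (Suc i)) \<noteq> 0" if "i \<in> {..<4}" for i
    proof -
      have "i = 0 \<or> i = 1 \<or> i = 2 \<or> i = 3" using cases4[of i] that by simp
      then show ?thesis
        using crPQ cr_commute[of Q P] by (elim disjE) (simp_all add: u_simps cr_simps)
    qed
    show "F.N (\<sigma> *\<^sub>R emb (u i) + \<tau> *\<^sub>R emb (u (Suc i))) = \<sigma> + \<tau>"
      if "i \<in> {..<4}" "0 \<le> \<sigma>" "0 \<le> \<tau>" for i \<sigma> \<tau>
    proof -
      have "i = 0 \<or> i = 1 \<or> i = 2 \<or> i = 3" using cases4[of i] that by simp
      then show ?thesis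
        unfolding sector_N using that(2,3) by (elim disjE) (simp_all add: u_simps)
    qed
    show "\<exists>i\<in>{..<4}. \<exists>\<sigma> \<tau>. 0 \<le> \<sigma> \<and> 0 \<le> \<tau> \<and> z = \<sigma> *\<^sub>R emb (u i) + \<tau> *\<^sub>R emb (u (Suc i))" for z
    proof -
      have ex: "\<exists>i\<in>{..<4}. \<exists>\<sigma> \<tau>. 0 \<le> \<sigma> \<and> 0 \<le> \<tau> \<and> z = \<sigma> *\<^sub>R emb (u i) + \<tau> *\<^sub>R emb (u (Suc i))"
        if "i < 4" "0 \<le> \<sigma>" "0 \<le> \<tau>" "z = \<sigma> *\<^sub>R emb (u i) + \<tau> *\<^sub>R emb (u (Suc i))" for i \<sigma> \<tau>
        using that by blast
      consider "0 \<le> F.X z" "0 \<le> F.Y z" | "F.X z \<le> 0" "0 \<le> F.Y z" | "F.X z \<le> 0" "F.Y z \<le> 0"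
        | "0 \<le> F.X z" "F.Y z \<le> 0" by linarith
      then show ?thesis
      proof cases
        case 1
        then show ?thesis
          by (intro ex[of 0 "F.X z" "F.Y z"]) (auto simp: u_simps F.eq_iff_coords)
      next
        case 2
        then show ?thesis
          by (intro ex[of 1 "F.Y z" "- F.X z"]) (auto simp: u_simps F.eq_iff_coords numeral_2_eq_2[symmetric])
      next
        case 3
        then show ?thesis
          by (intro ex[of 2 "- F.X z" "- F.Y z"]) (auto simp: u_simps F.eq_iff_coords)
      next
        case 4
        then show ?thesis
          by (intro ex[of 3 "- F.Y z" "F.X z"]) (auto simp: u_simps F.eq_iff_coords)
      qed
    qed
    show "i = j" if h: "i \<in> {..<4}" "j \<in> {..<4}" "0 < \<sigma>" "0 < \<tau>" "0 < \<sigma>'" "0 < \<tau>'"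
      "\<sigma> *\<^sub>R emb (u i) + \<tau> *\<^sub>R emb (u (Suc i)) = \<sigma>' *\<^sub>R emb (u j) + \<tau>' *\<^sub>R emb (u (Suc j))" for i j \<sigma> \<tau> \<sigma>' \<tau>'
    proof -
      define ix where "ix z = (if 0 < F.X z then if 0 < F.Y z then 0 else 3 else if 0 < F.Y z then 1 else (2::nat))" for z
      have "ix (\<sigma> *\<^sub>R emb (u i) + \<tau> *\<^sub>R emb (u (Suc i))) = i" if "i \<in> {..<4}" "0 < \<sigma>" "0 < \<tau>" for i \<sigma> \<tau>
      proof -
        have "i = 0 \<or> i = 1 \<or> i = 2 \<or> i = 3" using cases4[of i] that by simp
        then show ?thesis
          unfolding ix_def using that(2,3) by (elim disjE) (simp_all add: u_simps)
      qed
      from this[OF h(1,3,4)] this[OF h(2,5,6)] show ?thesis unfolding h(7) by simp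
    qed
  qed (use S F.N_triangle F.N_scaleR F.N_bound in auto)
  define \<kappa> where "\<kappa> = real (lattice_index P Q)"
  have \<kappa>: "0 < \<kappa>" using lattice_index_pos[OF crPQ] by (simp add: \<kappa>_def)
  interpret L: polygonal S F.N "{..<4}" u "\<lambda>i. u (Suc i)" by (rule poly)
  have ix: "real (lattice_index (u i) (u (Suc i))) = \<kappa>" if "i < 4" for i
    using cases4[OF that]
    by (auto simp: u_simps lattice_index_minus \<kappa>_def lattice_index_commute[of Q P] numeral_2_eq_2[symmetric])
  show ?thesis
  proof (rule polygonal_sprawl[OF frame poly \<kappa>])
    show "L.D = \<kappa> * (2 * (1/2 + 1/2 + 1))"
      unfolding L.D_def by (simp add: ix)
    fix h :: "real^2 \<Rightarrow> real" assume h: "continuous_on UNIV h"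
    have "L.Ifun h = \<kappa> * (\<Sum>i<4. seg_avg (emb (u i)) (emb (u (Suc i))) h)"
      unfolding L.Ifun_def sum_distrib_left by (intro sum.cong) (auto simp: ix)
    also have "(\<Sum>i<4. seg_avg (emb (u i)) (emb (u (Suc i))) h)
        = seg_avg (emb P) (emb Q) h + seg_avg (emb Q) (- emb P) h + seg_avg (- emb P) (- emb Q) h
          + seg_avg (- emb Q) (emb P) h"
      by (simp add: u_def eval_nat_numeral)
    also have "\<dots> = F.hexint h"
      using seg_avg_halves[OF h, of F.w "emb P" "emb Q"] seg_avg_halves[OF h, of "- F.w" "- emb P" "- emb Q"]
      unfolding F.hexint_expand by (simp add: F.w_def)
    finally show "L.Ifun h = \<kappa> * F.hexint h" .
  qed
qed

text \<open>Convergence is part of the conclusion because \<open>group_sprawl\<close> is a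
  \<open>lim\<close>, whose value says nothing about a divergent sequence.\<close>

lemma six_generator_group_sprawl:
  fixes S :: "(int^2) set"
  assumes S: "finite S" "symmetric_set S" "generating_set S" "card S \<le> 6"
  shows "convergent (sphere_average S) \<and> 23/18 \<le> group_sprawl S \<and> group_sprawl S \<le> 4/3"
proof -
  obtain p q w where pqw: "p \<in> S" "q \<in> S" "w \<in> S" "cr p q \<noteq> 0" "\<bar>cr p w\<bar> \<le> \<bar>cr p q\<bar>" "\<bar>cr w q\<bar> \<le> \<bar>cr p q\<bar>"
    "S \<subseteq> {0, p, - p, q, - q, w, - w}"
    using three_generators[OF S] by metis
  have neg: "- s \<in> S" if "s \<in> S" for s using S(2) that unfolding symmetric_set_def by blast
  have "cr (emb p) (emb q) \<noteq> 0" "\<bar>cr (emb p) (emb w)\<bar> \<le> \<bar>cr (emb p) (emb q)\<bar>"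
    "\<bar>cr (emb w) (emb q)\<bar> \<le> \<bar>cr (emb p) (emb q)\<bar>"
    using pqw(4-6) by (auto simp: cr_emb simp flip: of_int_abs)
  then obtain p' q' a b where f: "{p', - p', q', - q'} = {emb p, - emb p, emb q, - emb q}" "cr p' q' \<noteq> 0"
    "0 \<le> a" "a \<le> b" "b \<le> 1" "emb w = b *\<^sub>R p' + a *\<^sub>R q'"
    using normal_form by metis
  have "p' \<in> emb ` {p, - p, q, - q}" "q' \<in> emb ` {p, - p, q, - q}" using f(1) by auto
  then obtain P Q where PQ: "p' = emb P" "q' = emb Q" by blast
  have "emb ` {P, - P, Q, - Q} = emb ` {p, - p, q, - q}" using f(1) unfolding PQ by simp
  \<comment> \<open>The normal form was found over the reals; injectivity of \<open>emb\<close>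
    brings its corners back to lattice points in \<open>S\<close>.\<close>
  then have eq: "{P, - P, Q, - Q} = {p, - p, q, - q}"
    using inj_image_eq_iff[of emb] inj_emb by (metis injI)
  have sub: "{P, - P, Q, - Q} \<subseteq> S" unfolding eq using pqw neg by auto
  have "{0, p, - p, q, - q, w, - w} = {0, w, - w} \<union> {P, - P, Q, - Q}" unfolding eq by auto
  then have sup: "S \<subseteq> {0, P, - P, Q, - Q, w, - w}" using pqw(7) by auto
  consider "hexagon_frame (emb P) (emb Q) a b"
    | "hexagon_frame (emb P) (emb Q) (1/2) (1/2)"
      "convex hull {emb P, - emb P, emb w, - emb w, emb Q, - emb Q} = hexagon_frame.body (emb P) (emb Q) (1/2) (1/2)"
    using hexagon_frame_cases[OF f(2-6)] unfolding PQ by blast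
  then show ?thesis
  proof cases
    case 1
    show ?thesis
      using sub pqw(3) neg sup f(6)[unfolded PQ]
      by (intro hexagonal_group_sprawl[OF S(2,3) _ _ 1]) auto
  next
    case 2
    interpret F: hexagon_frame "emb P" "emb Q" "1/2" "1/2" by (rule 2(1))
    have "emb s \<in> F.body" if "s \<in> S" for s
    proof (cases "s = 0")
      case False
      then have "emb s \<in> {emb P, - emb P, emb w, - emb w, emb Q, - emb Q}" using that sup by auto
      then show ?thesis unfolding 2(2)[symmetric] by (rule hull_inc)
    qed (simp add: F.body_def F.N_def)
    then show ?thesis
      using parallelogram_group_sprawl[OF S(2,3) sub 2(1)] by (simp add: F.body_def)
  qed
qed

theorem theorem14:
  "{sprawl H | H. hexagon H} = {23/18 .. 4/3} \<and>
   (\<forall>S :: (int^2) set.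
      finite S \<and> symmetric_set S \<and> generating_set S \<and> card S \<le> 6 \<longrightarrow>
      convergent (sphere_average S) \<and> 23/18 \<le> group_sprawl S \<and> group_sprawl S \<le> 4/3)"
  using hexagon_sprawl_values six_generator_group_sprawl by blast

end
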